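(* Let $N\ge2$, $\nu\ne0$, and let $(\mathbf v,\mathbf u)$, with $\sum_jv_j=\sum_ju_j=0$ and $u_j\not\equiv u_k$ modulo $\mathbb Z+\tau\mathbb Z$ for $j\neq k$, be a point of the phase space $\mathcal R^{CM}$ of the elliptic $N$-body Calogero–Moser system, with Lax matrix $L^{CM}(z)$. Let $$\Xi(z)=\tilde\Xi(z)\times\mathrm{diag}_{l=1,\dots,N}\Bigl((-1)^l\prod_{j<k;\ j,k\neq l}\vartheta(u_k-u_j,\tau)\Bigr),\qquad \tilde\Xi_{ij}(z)=\theta\begin{bmatrix}\frac iN-\frac12\\ \frac N2\end{bmatrix}(z-Nu_j,N\tau).$$ Then $\Xi(z)$ is a singular gauge transformation (degenerate at $z=0$) that maps $L^{CM}$ to the Lax matrix of the elliptic $\mathrm{SL}(N,\mathbb C)$-rotator: $$\Xi(z)\,L^{CM}(z)\,\Xi(z)^{-1}=L^{rot}(z)$$ for some $\mathbf S$ in the coadjoint orbit $\mathcal R^{rot}$ of the matrix $\mathbf S^{(0)}=\mathrm{Res}_{z=0}L^{CM}$, and the resulting map $$\mathcal R^{CM}\to\mathcal R^{rot},\qquad(\mathbf v,\mathbf u)\mapsto\mathbf S,$$ is symplectic.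
   Context: Notation. $\mathbf e(z)=\exp(2\pi\sqrt{-1}z)$, $\mathrm{Im}\,\tau>0$, $$\theta\begin{bmatrix} a \\ b \end{bmatrix}(z,\tau)=\sum_{j\in\mathbb Z}\mathbf e\Bigl((j+a)^2\tfrac\tau2+(j+a)(z+b)\Bigr),\quad \vartheta(z)=\vartheta(z,\tau)=\theta\begin{bmatrix} 1/2 \\ 1/2 \end{bmatrix}(z,\tau),\quad \phi(u,z)=\frac{\vartheta(u+z)\vartheta'(0)}{\vartheta(u)\vartheta(z)}.$$ Calogero–Moser system. $\mathcal R^{CM}=\{(\mathbf v,\mathbf u)=(v_1,\dots,v_N,u_1,\dots,u_N):\sum v_j=\sum u_j=0\}$ with symplectic form $\omega^{CM}=\sum_jDv_j\wedge Du_j$. Its Lax matrix is $L^{CM}(z)=P+X$, $P=\mathrm{diag}(v_1,\dots,v_N)$, $X_{jk}=\nu\,\phi(u_j-u_k,z)$ for $j\ne k$, $X_{jj}=0$. Its residue at $z=0$ is $\nu$ times the matrix with zeros on the diagonal and ones off the diagonal. Rotator. $Q=\mathrm{diag}(\mathbf e(1/N),\dots,\mathbf e(m/N),\dots,1)$; $\Lambda$ is the cyclic permutation matrix with $\Lambda_{i,i+1}=1$ ($i=1,\dots,N-1$), $\Lambda_{N,1}=1$ and zeros elsewhere; $E_{mn}=\mathbf e(\frac{mn}{2N})Q^m\Lambda^n$, $0\le m,n\le N-1$, $(m,n)\neq(0,0)$, is a basis of $\mathrm{sl}(N,\mathbb C)$. The phase space is the coadjoint orbit $\mathcal R^{rot}=\{\mathbf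 S=g^{-1}\mathbf S^{(0)}g\}\subset\mathrm{sl}(N,\mathbb C)$ with the Kirillov–Kostant form $\omega^{rot}=\mathrm{tr}(\mathbf S^{(0)}Dg\,g^{-1}Dg\,g^{-1})$. Writing $\mathbf S=\sum S_{mn}E_{mn}$, the Lax matrix is $$L^{rot}(z)=\sum_{m,n}S_{mn}\,\mathbf e\Bigl(-\frac{nz}N\Bigr)\phi\Bigl(-\frac{m+n\tau}N,z\Bigr)E_{mn}.$$ *)

theory Defs
  imports "HOL-Complex_Analysis.Complex_Analysis"
begin

section \<open>Theta functions\<close>

definition ee :: "complex \<Rightarrow> complex" where
  "ee z = exp (2 * of_real pi * \<i> * z)"

definition theta :: "complex \<Rightarrow> complex \<Rightarrow> complex \<Rightarrow> complex \<Rightarrow> complex" where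
  "theta a b z \<tau> =
     (\<Sum>\<^sub>\<infinity>j::int. ee ((of_int j + a)^2 * (\<tau> / 2) + (of_int j + a) * (z + b)))"

definition vtheta :: "complex \<Rightarrow> complex \<Rightarrow> complex" where
  "vtheta z \<tau> = theta (1/2) (1/2) z \<tau>"

definition phi :: "complex \<Rightarrow> complex \<Rightarrow> complex \<Rightarrow> complex" where
  "phi \<tau> u z = vtheta (u + z) \<tau> * deriv (\<lambda>w. vtheta w \<tau>) 0 / (vtheta u \<tau> * vtheta z \<tau>)"

definition lattice :: "complex \<Rightarrow> complex set" where
  "lattice \<tau> = {of_int m + of_int n * \<tau> | m n. True}"


section \<open>Matrices\<close>

text \<open>An index type \<open>'n\<close> that is finite and linearly ordered stands for the
  index set \<open>{1, \<dots>, N}\<close> with \<open>N = CARD('n)\<close>; \<open>idx i\<close> is the position of \<open>i\<close>,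
  counted from 1.\<close>

type_synonym 'n cvec = "complex ^ 'n"
type_synonym 'n cmat = "complex ^ 'n ^ 'n"

definition idx :: "'n::{finite,linorder} \<Rightarrow> nat" where
  "idx i = card {..i}"

text \<open>The library product \<open>(*)\<close> on vectors and matrices is componentwise, so powers
  with respect to \<open>(**)\<close> and complex multiples are introduced separately.\<close>

definition mpow :: "'n::finite cmat \<Rightarrow> nat \<Rightarrow> 'n cmat" where
  "mpow A k = (((**) A) ^^ k) (mat 1)"

definition mscale :: "complex \<Rightarrow> 'n::finite cmat \<Rightarrow> 'n cmat" where
  "mscale c A = (\<chi> i j. c * A $ i $ j)"

definition diag :: "('n::finite \<Rightarrow> complex) \<Rightarrow> 'n cmat" where
  "diag d = (\<chi> i j. if i = j then d i else 0)"

definition residue_mat :: "(complex \<Rightarrow> 'n::finite cmat) \<Rightarrow> complex \<Rightarrow> 'n cmat" where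
  "residue_mat L z0 = (\<chi> i j. residue (\<lambda>z. L z $ i $ j) z0)"


section \<open>The Calogero--Moser system\<close>

text \<open>Points are pairs \<open>(v, u)\<close>; the particles are kept away from the collision
  locus, where the Lax matrix has its poles in \<open>u\<close>.\<close>

definition R_CM :: "complex \<Rightarrow> ('n::finite cvec \<times> 'n cvec) set" where
  "R_CM \<tau> = {(v, u). (\<Sum>j\<in>UNIV. v $ j) = 0 \<and> (\<Sum>j\<in>UNIV. u $ j) = 0 \<and>
               (\<forall>j k. j \<noteq> k \<longrightarrow> u $ j - u $ k \<notin> lattice \<tau>)}"

definition T_CM :: "('n::finite cvec \<times> 'n cvec) set" where
  "T_CM = {(dv, du). (\<Sum>j\<in>UNIV. dv $ j) = 0 \<and> (\<Sum>j\<in>UNIV. du $ j) = 0}"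

text \<open>Wedge convention, here and for \<open>omega_rot\<close>:
  \<open>(\<alpha> \<and> \<beta>)(\<xi>, \<eta>) = \<alpha>(\<xi>) \<beta>(\<eta>) - \<alpha>(\<eta>) \<beta>(\<xi>)\<close>.\<close>

definition omega_CM :: "'n::finite cvec \<times> 'n cvec \<Rightarrow> 'n cvec \<times> 'n cvec \<Rightarrow> complex" where
  "omega_CM \<xi> \<eta> = (\<Sum>j\<in>UNIV. fst \<xi> $ j * snd \<eta> $ j - fst \<eta> $ j * snd \<xi> $ j)"

definition L_CM ::
    "complex \<Rightarrow> complex \<Rightarrow> 'n::finite cvec \<times> 'n cvec \<Rightarrow> complex \<Rightarrow> 'n cmat" where
  "L_CM \<tau> \<nu> p z =
     (\<chi> j k. if j = k then fst p $ j else \<nu> * phi \<tau> (snd p $ j - snd p $ k) z)"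

definition S0 :: "complex \<Rightarrow> 'n::finite cmat" where
  "S0 \<nu> = (\<chi> j k. if j = k then 0 else \<nu>)"


section \<open>The rotator\<close>

definition Qmat :: "'n::{finite,linorder} cmat" where
  "Qmat = diag (\<lambda>i. ee (of_nat (idx i) / of_nat CARD('n)))"

definition Lam :: "'n::{finite,linorder} cmat" where
  "Lam = (\<chi> i j. if idx j = idx i mod CARD('n) + 1 then 1 else 0)"

definition E_mat :: "nat \<Rightarrow> nat \<Rightarrow> 'n::{finite,linorder} cmat" where
  "E_mat m n = mscale (ee (of_nat (m * n) / (2 * of_nat CARD('n))))
                 (mpow Qmat m ** mpow Lam n)"

definition E_index :: "nat \<Rightarrow> (nat \<times> nat) set" where
  "E_index N = ({0..<N} \<times> {0..<N}) - {(0, 0)}"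

text \<open>Coordinates of a traceless matrix in the basis \<open>E_mat m n\<close>; only the values
  on \<open>E_index CARD('n)\<close> are determined and used.\<close>

definition E_coords :: "'n::{finite,linorder} cmat \<Rightarrow> nat \<times> nat \<Rightarrow> complex" where
  "E_coords S = (SOME s. S = (\<Sum>(m, n)\<in>E_index CARD('n). mscale (s (m, n)) (E_mat m n)))"

definition L_rot :: "complex \<Rightarrow> 'n::{finite,linorder} cmat \<Rightarrow> complex \<Rightarrow> 'n cmat" where
  "L_rot \<tau> S z = (\<Sum>(m, n)\<in>E_index CARD('n).
     mscale (E_coords S (m, n) * ee (- (of_nat n * z / of_nat CARD('n)))
               * phi \<tau> (- ((of_nat m + of_nat n * \<tau>) / of_nat CARD('n))) z)
            (E_mat m n))"

definition SL :: "'n::finite cmat set" where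
  "SL = {g. det g = 1}"

definition R_rot :: "'n::finite cmat \<Rightarrow> 'n cmat set" where
  "R_rot A = {matrix_inv g ** A ** g | g. g \<in> SL}"

text \<open>\<open>lifts A S X g dg\<close>: the point \<open>S\<close> of the orbit is \<open>g\<^sup>-\<^sup>1 A g\<close> with \<open>g \<in> SL\<close>, the matrix
  \<open>dg\<close> is a tangent vector of \<open>SL\<close> at \<open>g\<close>, and \<open>X\<close> is its image under the
  differential of \<open>g \<mapsto> g\<^sup>-\<^sup>1 A g\<close>.\<close>

definition lifts ::
    "'n::finite cmat \<Rightarrow> 'n cmat \<Rightarrow> 'n cmat \<Rightarrow> 'n cmat \<Rightarrow> 'n cmat \<Rightarrow> bool" where
  "lifts A S X g dg \<longleftrightarrow>
     g \<in> SL \<and> S = matrix_inv g ** A ** g \<and> trace (dg ** matrix_inv g) = 0 \<and>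
     X = matrix_inv g ** A ** dg - matrix_inv g ** dg ** matrix_inv g ** A ** g"

definition T_rot :: "'n::finite cmat \<Rightarrow> 'n cmat \<Rightarrow> 'n cmat set" where
  "T_rot A S = {X. \<exists>g dg. lifts A S X g dg}"

text \<open>The Kirillov--Kostant form \<open>tr (A Dg g\<^sup>-\<^sup>1 Dg g\<^sup>-\<^sup>1)\<close> on tangent vectors of the orbit
  of \<open>A\<close>, evaluated on lifts to \<open>SL\<close>; the value does not depend on the lifts.\<close>

definition omega_rot :: "'n::finite cmat \<Rightarrow> 'n cmat \<Rightarrow> 'n cmat \<Rightarrow> 'n cmat \<Rightarrow> complex" where
  "omega_rot A S X Y = (THE w. \<exists>g dg1 dg2. lifts A S X g dg1 \<and> lifts A S Y g dg2 \<and>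
     w = trace (A ** (dg1 ** matrix_inv g ** dg2 ** matrix_inv g
                      - dg2 ** matrix_inv g ** dg1 ** matrix_inv g)))"


section \<open>The gauge transformation and symplectic maps\<close>

definition Xi_tilde :: "complex \<Rightarrow> 'n::{finite,linorder} cvec \<Rightarrow> complex \<Rightarrow> 'n cmat" where
  "Xi_tilde \<tau> u z = (\<chi> i j.
     theta (of_nat (idx i) / of_nat CARD('n) - 1/2) (of_nat CARD('n) / 2)
           (z - of_nat CARD('n) * u $ j) (of_nat CARD('n) * \<tau>))"

definition Xi :: "complex \<Rightarrow> 'n::{finite,linorder} cvec \<Rightarrow> complex \<Rightarrow> 'n cmat" where
  "Xi \<tau> u z = Xi_tilde \<tau> u z ** diag (\<lambda>l. (- 1) ^ idx l *
     (\<Prod>(j, k)\<in>{(j, k). j < k \<and> j \<noteq> l \<and> k \<noteq> l}. vtheta (u $ k - u $ j) \<tau>))"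

text \<open>Symplectic maps in the holomorphic category. The phase space \<open>R_CM \<tau>\<close> is open in
  the linear space \<open>T_CM\<close>, so a derivative within \<open>R_CM \<tau>\<close> is determined on \<open>T_CM\<close>.\<close>

definition symplectic_CM_rot ::
    "complex \<Rightarrow> 'n::finite cmat \<Rightarrow> ('n cvec \<times> 'n cvec \<Rightarrow> 'n cmat) \<Rightarrow> bool" where
  "symplectic_CM_rot \<tau> A F \<longleftrightarrow>
     (\<forall>p\<in>R_CM \<tau>. F p \<in> R_rot A \<and>
       (\<exists>D. (F has_derivative D) (at p within R_CM \<tau>) \<and>
            (\<forall>c. \<forall>\<xi>\<in>T_CM. D (c *s fst \<xi>, c *s snd \<xi>) = mscale c (D \<xi>)) \<and>
            (\<forall>\<xi>\<in>T_CM. D \<xi> \<in> T_rot A (F p)) \<and>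
            (\<forall>\<xi>\<in>T_CM. \<forall>\<eta>\<in>T_CM. omega_rot A (F p) (D \<xi>) (D \<eta>) = omega_CM \<xi> \<eta>)))"

end

(* The i-th row of Xi_tilde consists of the values at the points y = u_j - z/N of one theta function
   psi_i(y) of order N. A theta function of order N with N prescribed zeros whose sum is not a zero
   modulo the lattice vanishes (Liouville, once the zeros of vtheta are known to be simple and to form
   the lattice), so the psi_i span these theta functions, and expanding Lagrange type products of
   vtheta in the psi_i gives an inverse of Xi(z) that has at most a simple pole on the lattice.

   As sum u_j = 0, the vector (1, ..., 1) spans the kernel of Xi(0). The residue of L_CM at 0 is
   nu (1 1^T - I), so the double pole of Xi L_CM Xi^-1 cancels and the residue at 0 is
   S = a w^T - nu I with w^T a = N nu, a point of the orbit of S0. The coefficient of E_mn in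
   Xi L_CM Xi^-1 and the one in L_rot have the same multipliers and the same residue, and Liouville
   gives their equality.

   On matrices a w^T - nu I the Kirillov-Kostant form is the exterior derivative of the one-form
   sum a_i dw_i, and this one-form pulls back to sum v_l du_l plus a closed form. *)
theory Submission
  imports Defs
begin

text \<open>Otherwise every component \<open>x $ i\<close> is also parsed as a coefficient of a power series, and the
  parses multiply.\<close>

no_notation fps_nth (infixl "$" 75)

section \<open>Entire functions with multipliers\<close>

text \<open>All comparisons of functions take one shape: multiply by powers of \<open>vtheta\<close>
  until everything is entire, divide by a function with simple zeros, and apply Liouville to a
  quotient with two constant multipliers. The zeros of \<open>vtheta\<close> are located beforehand
  through an infinite product.

  The obstacle is z = 0, where the gauge matrix degenerates although the residue has to be computed
  there. Its inverse is therefore replaced by an entire matrix B with A B = \<open>vtheta z\<close>,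
  and the residue becomes, up to a constant, the derivative at 0 of an entire matrix that vanishes
  at 0.

  The residue determines (a, w) only up to (a/c, c w) with c nowhere zero. Such a change adds N
  \<nu> d log c, a closed form, to sum a_i dw_i; this is why a one-form on pairs can compute the
  form of the orbit. Exterior derivatives are evaluated along complex lines in directions of sum
  zero, where they reduce to the symmetry of mixed second derivatives.\<close>

lemma ee_add: "ee (x + y) = ee x * ee y"
  by (simp add: ee_def exp_add ring_distribs)

lemma ee_0 [simp]: "ee 0 = 1"
  by (simp add: ee_def)

lemma ee_nonzero [simp]: "ee x \<noteq> 0"
  by (simp add: ee_def)

lemma ee_minus: "ee (- x) = inverse (ee x)"
  by (simp add: ee_def exp_minus)

lemma ee_diff: "ee (x - y) = ee x / ee y"
  using ee_add[of x "- y"] by (simp add: ee_minus field_simps)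

lemma ee_of_int [simp]: "ee (of_int n) = 1"
  unfolding ee_def exp_eq_1 by (auto intro!: exI[of _ n])

lemma ee_1 [simp]: "ee 1 = 1"
  using ee_of_int[of 1] by simp

lemma ee_of_nat [simp]: "ee (of_nat n) = 1"
  using ee_of_int[of "int n"] by simp

lemma ee_eq_1_iff: "ee z = 1 \<longleftrightarrow> z \<in> \<int>"
proof
  assume "ee z = 1"
  then obtain n :: int where "Re (2 * of_real pi * \<i> * z) = 0" "Im (2 * of_real pi * \<i> * z) = of_int (2 * n) * pi"
    unfolding ee_def exp_eq_1 by auto
  then have "z = of_int n" by (auto simp: complex_eq_iff)
  then show "z \<in> \<int>" by simp
qed (auto elim: Ints_cases)

lemma norm_ee: "norm (ee z) = exp (- 2 * pi * Im z)"
  by (simp add: ee_def norm_exp_eq_Re)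

lemma ee_power: "ee z ^ n = ee (of_nat n * z)"
  by (induction n) (auto simp: ee_add ring_distribs)

lemma ee_half [simp]: "ee (1/2) = - 1"
  by (simp add: ee_def exp_eq_polar[symmetric])

lemma ee_half_of_nat: "ee (of_nat n / 2) = (- 1) ^ n"
  using ee_power[of "1/2" n] by simp

lemma ee_has_field_derivative [derivative_intros]:
  assumes "(f has_field_derivative f') (at x within A)"
  shows "((\<lambda>x. ee (f x)) has_field_derivative (2 * of_real pi * \<i> * f' * ee (f x))) (at x within A)"
  unfolding ee_def using assms by (auto intro!: derivative_eq_intros)

lemma ee_holomorphic [holomorphic_intros]:
  "f holomorphic_on A \<Longrightarrow> (\<lambda>x. ee (f x)) holomorphic_on A"
  unfolding ee_def by (intro holomorphic_intros)

lemma entire_compose: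
  assumes "f holomorphic_on UNIV" "g holomorphic_on A"
  shows "(\<lambda>x. f (g x)) holomorphic_on A"
  using holomorphic_on_compose_gen[OF assms(2,1)] by (simp add: o_def)

lemma holomorphic_prod_eq_zero:
  assumes "f holomorphic_on UNIV" "g holomorphic_on UNIV" "\<And>z. f z * g z = 0" "g z0 \<noteq> 0"
  shows "f z = 0"
proof -
  have "open (g -` (- {0}))"
    using assms(2) by (intro open_vimage holomorphic_on_imp_continuous_on) auto
  then show ?thesis
    using analytic_continuation_open[of "g -` (- {0})" UNIV f "\<lambda>_. 0" z] assms by force
qed

text \<open>Identities are verified where a nonzero function such as \<open>vtheta\<close> may be
  divided by, and then extended over its zeros.\<close>

lemma entire_eqI:
  assumes "f holomorphic_on UNIV" "h holomorphic_on UNIV" "g holomorphic_on UNIV"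
    "g z0 \<noteq> 0" "\<And>z. g z \<noteq> 0 \<Longrightarrow> f z = h z"
  shows "f z = h z"
  using holomorphic_prod_eq_zero[of "\<lambda>z. f z - h z" g z0 z] assms
  by (force intro: holomorphic_intros)

section \<open>Quotients of entire functions\<close>

lemma field_differentiable_cong_ev:
  assumes "f field_differentiable (at z)" "eventually (\<lambda>w. f w = g w) (nhds z)"
  shows "g field_differentiable (at z)"
  using assms DERIV_cong_ev[OF refl assms(2) refl] by (auto simp: field_differentiable_def)

text \<open>For f = h g the multiplier of \<open>h\<close> is that of f divided by that of
  \<open>g\<close>. Here \<open>e\<close> is the multiplier of \<open>g\<close>, and the one of f is
  written as \<open>m\<close> times \<open>e\<close> so that \<open>e\<close> cancels; the zeros of
  \<open>g\<close> are filled in by continuation.\<close>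

lemma quotient_multiplier:
  assumes h: "h holomorphic_on UNIV" and g: "g holomorphic_on UNIV" "g z0 \<noteq> 0"
    and m: "m holomorphic_on UNIV" "\<And>z. e z \<noteq> 0"
    and eq: "\<And>z. g z \<noteq> 0 \<Longrightarrow> h (z + t) * (e z * g z) = m z * e z * (h z * g z)"
  shows "h (z + t) = m z * h z"
proof (rule entire_eqI[OF _ _ g, of "\<lambda>z. h (z + t)"])
  show "h (z + t) = m z * h z" if "g z \<noteq> 0" for z
    using eq[OF that] m(2)[of z] that by (simp add: mult_ac)
qed (intro holomorphic_intros entire_compose[OF h] h m)+

text \<open>The zero function fails this condition, its derivative being 0 at its zeros. This is how
  products of theta functions are later seen not to vanish identically.\<close>

definition simple_zeros :: "(complex \<Rightarrow> complex) \<Rightarrow> bool" where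
  "simple_zeros g \<longleftrightarrow> g holomorphic_on UNIV \<and> (\<forall>z. g z = 0 \<longrightarrow> deriv g z \<noteq> 0)"

text \<open>At a zero of \<open>g\<close> both functions split off a linear factor. The cofactor of
  \<open>g\<close> has the nonzero value \<open>deriv g z\<close> there, so the quotient extends
  with the value given by l'Hospital's rule.\<close>

lemma entire_divide:
  assumes f: "f holomorphic_on UNIV" and g: "simple_zeros g"
    and fg: "\<And>z. g z = 0 \<Longrightarrow> f z = 0"
  obtains h where "h holomorphic_on UNIV" "\<And>z. f z = h z * g z"
proof
  define h where "h = (\<lambda>z. if g z = 0 then deriv f z / deriv g z else f z / g z)"
  have gh: "g holomorphic_on UNIV" and g': "\<And>z. g z = 0 \<Longrightarrow> deriv g z \<noteq> 0"
    using g by (auto simp: simple_zeros_def)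
  show "f z = h z * g z" for z
    using fg by (simp add: h_def)
  have contg: "continuous_on UNIV g" by (rule holomorphic_on_imp_continuous_on[OF gh])
  have op: "open (g -` (- {0}))" by (intro open_vimage contg) auto
  have "h field_differentiable at z" for z
  proof (cases "g z = 0")
    case False
    have "(\<lambda>z. f z / g z) holomorphic_on g -` (- {0})"
      by (intro holomorphic_on_divide holomorphic_on_subset[OF f] holomorphic_on_subset[OF gh]) auto
    then have "(\<lambda>z. f z / g z) field_differentiable at z"
      using holomorphic_on_imp_differentiable_at[OF _ op] False by blast
    moreover have "eventually (\<lambda>w. w \<in> g -` (- {0})) (nhds z)"
      using op False eventually_nhds_in_open by blast
    then have "\<forall>\<^sub>F w in nhds z. (\<lambda>z. f z / g z) w = h w"
      by eventually_elim (auto simp: h_def)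
    ultimately show ?thesis
      by (rule field_differentiable_cong_ev)
  next
    case True
    define f1 where "f1 = (\<lambda>w. if w = z then deriv f z else (f w - f z)/(w - z))"
    define g1 where "g1 = (\<lambda>w. if w = z then deriv g z else (g w - g z)/(w - z))"
    have f1: "f1 holomorphic_on UNIV" and g1: "g1 holomorphic_on UNIV"
      unfolding f1_def g1_def by (intro pole_lemma_open f gh open_UNIV)+
    have ff: "f w = (w - z) * f1 w" and gg: "g w = (w - z) * g1 w" for w
      using True fg[OF True] by (auto simp: f1_def g1_def)
    have op1: "open (g1 -` (- {0}))"
      by (intro open_vimage holomorphic_on_imp_continuous_on[OF g1]) auto
    have z: "z \<in> g1 -` (- {0})" using g'[OF True] by (simp add: g1_def)
    have "(\<lambda>z. f1 z / g1 z) holomorphic_on g1 -` (- {0})"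
      by (intro holomorphic_on_divide holomorphic_on_subset[OF f1] holomorphic_on_subset[OF g1]) auto
    then have "(\<lambda>z. f1 z / g1 z) field_differentiable at z"
      using holomorphic_on_imp_differentiable_at[OF _ op1] z by blast
    moreover have "eventually (\<lambda>w. w \<in> g1 -` (- {0})) (nhds z)"
      using op1 z eventually_nhds_in_open by blast
    then have "\<forall>\<^sub>F w in nhds z. (\<lambda>z. f1 z / g1 z) w = h w"
    proof eventually_elim
      case (elim w)
      show ?case
      proof (cases "w = z")
        case True then show ?thesis using \<open>g z = 0\<close> by (simp add: h_def f1_def g1_def)
      next
        case False
        then have "g w \<noteq> 0" using elim by (simp add: gg)
        then show ?thesis using False by (simp add: h_def ff gg)
      qed
    qed
    ultimately show ?thesis
      by (rule field_differentiable_cong_ev)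
  qed
  then show "h holomorphic_on UNIV"
    by (auto simp: holomorphic_on_def)
qed

section \<open>Shifts by the lattice and Liouville's theorem\<close>

lemma int_combination:
  fixes y \<tau> :: complex
  assumes "Im \<tau> > 0"
  obtains m n :: int and s t :: real where "y = of_real s + of_real t * \<tau> + of_int m + of_int n * \<tau>"
    "s \<in> {0..1}" "t \<in> {0..1}"
proof
  let ?T = "Im y / Im \<tau>" let ?S = "Re y - ?T * Re \<tau>"
  show "y = of_real (frac ?S) + of_real (frac ?T) * \<tau> + of_int \<lfloor>?S\<rfloor> + of_int \<lfloor>?T\<rfloor> * \<tau>"
    using assms by (simp add: complex_eq_iff frac_def field_simps)
  show "frac ?S \<in> {0..1}" "frac ?T \<in> {0..1}"
    by (auto simp: less_imp_le frac_lt_1)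
qed

lemma invariant_int_shift:
  assumes "\<And>y. P y \<longleftrightarrow> P (y + t)"
  shows "P y \<longleftrightarrow> P (y + of_int m * (t::complex))"
proof (induction m arbitrary: y rule: int_induct[of _ 0])
  case (step1 i)
  have "P y \<longleftrightarrow> P (y + of_int i * t)" by (rule step1)
  also have "\<dots> \<longleftrightarrow> P (y + of_int i * t + t)" by (rule assms)
  finally show ?case by (simp add: algebra_simps)
next
  case (step2 i)
  have "P y \<longleftrightarrow> P (y + of_int i * t)" by (rule step2)
  also have "\<dots> \<longleftrightarrow> P (y + of_int i * t - t)" using assms[of "y + of_int i * t - t"] by simp
  finally show ?case by (simp add: algebra_simps)
qed simp

text \<open>Stated for a predicate because quite different properties are moved along the lattice: a
  bound on a norm, vanishing at a point, having a simple zero there.\<close>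

lemma invariant_lattice_shift:
  assumes "\<And>y. P y \<longleftrightarrow> P (y + 1)" "\<And>y. P y \<longleftrightarrow> P (y + \<tau>)" "l \<in> lattice \<tau>"
  shows "P (y + l) \<longleftrightarrow> P y"
proof -
  obtain m n :: int where l: "l = of_int m + of_int n * \<tau>" using assms(3) by (auto simp: lattice_def)
  show ?thesis
    using invariant_int_shift[of P 1 y m, OF assms(1)] invariant_int_shift[of P \<tau> "y + of_int m" n, OF assms(2)]
    by (simp add: l add.assoc)
qed

text \<open>Multiplying by an exponential makes the multipliers unimodular; Liouville's theorem then
  applies because the modulus is doubly periodic.\<close>

lemma entire_multipliers:
  assumes \<tau>: "Im \<tau> > 0" and g: "g holomorphic_on UNIV"
    and 1: "\<And>y. g (y + 1) = \<alpha> * g y" and 2: "\<And>y. g (y + \<tau>) = \<beta> * g y"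
    and nz: "\<alpha> \<noteq> 0" "\<beta> \<noteq> 0"
  obtains c where "\<And>y. g y = g 0 * ee (c * y)"
proof -
  define A where "A = - ln (norm \<alpha>) / (2 * pi)"
  define B where "B = - ln (norm \<beta>) / (2 * pi)"
  \<comment> \<open>\<open>Im c = A\<close> and \<open>Im (c * \<tau>) = B\<close> are, by
    \<open>norm_ee\<close>, the two real conditions under which \<open>ee (c * y)\<close> changes in
    modulus by the same factors as \<open>g\<close>.\<close>
  define c where "c = Complex ((B - A * Re \<tau>) / Im \<tau>) A"
  have A: "norm (ee c) = norm \<alpha>" using nz by (simp add: norm_ee c_def A_def)
  have "Im (c * \<tau>) = B" using \<tau> by (simp add: c_def)
  then have B: "norm (ee (c * \<tau>)) = norm \<beta>" using nz by (simp add: norm_ee B_def)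
  define k where "k = (\<lambda>y. g y * ee (- (c * y)))"
  have kh: "k holomorphic_on UNIV" unfolding k_def by (intro holomorphic_intros g)
  have n1: "norm (k (y + 1)) = norm (k y)" for y
    using nz by (simp add: k_def 1 ring_distribs ee_add ee_minus norm_mult norm_inverse A ee_diff norm_divide)
  have n2: "norm (k (y + \<tau>)) = norm (k y)" for y
    using nz by (simp add: k_def 2 ring_distribs ee_add ee_minus norm_mult norm_inverse B ee_diff norm_divide)
  define K where "K = (\<lambda>(s,t). of_real s + of_real t * \<tau>) ` ({0..1::real} \<times> {0..1::real})"
  have "compact K" unfolding K_def
    by (intro compact_continuous_image compact_Times) (auto intro!: continuous_intros simp: case_prod_unfold)
  then have "compact (k ` K)"
    by (intro compact_continuous_image holomorphic_on_imp_continuous_on[OF holomorphic_on_subset[OF kh]]) auto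
  then have "bounded (k ` K)" by (rule compact_imp_bounded)
  then obtain C where C: "\<And>x. x \<in> K \<Longrightarrow> norm (k x) \<le> C" by (metis bounded_iff imageI)
  have "norm (k y) \<le> C" for y
  proof -
    obtain m n :: int and s t :: real where y: "y = of_real s + of_real t * \<tau> + of_int m + of_int n * \<tau>"
      "s \<in> {0..1}" "t \<in> {0..1}"
      by (rule int_combination[OF \<tau>, of y])
    have "norm (k (of_real s + of_real t * \<tau>)) \<le> C"
      using y by (intro C) (auto simp: K_def)
    moreover have "of_int m + of_int n * \<tau> \<in> lattice \<tau>" by (auto simp: lattice_def)
    moreover have "norm (k (w + l)) \<le> C \<longleftrightarrow> norm (k w) \<le> C" if "l \<in> lattice \<tau>" for w l
      using that by (rule invariant_lattice_shift[rotated 2]) (simp_all add: n1 n2)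
    ultimately show ?thesis
      by (metis y(1) add.assoc)
  qed
  then have "bounded (range k)" by (auto simp: bounded_iff)
  then have "k constant_on UNIV" using Liouville_theorem[OF kh] by blast
  then have "k y = k 0" for y by (auto simp: constant_on_def)
  then have "g y * ee (- (c * y)) = g 0 * ee (- (c * 0))" for y
    unfolding k_def .
  then have "g y * (ee (- (c * y)) * ee (c * y)) = g 0 * ee (c * y)" for y
    by (metis ee_0 mult.assoc mult_1_right mult_zero_right neg_0_equal_iff_equal)
  then have "g y = g 0 * ee (c * y)" for y
    using ee_add[of "- (c * y)" "c * y"] by (metis add.left_inverse ee_0 mult_1_right)
  then show ?thesis using that by blast
qed

text \<open>The function is an exponential, which ties the two multipliers together.\<close>

lemma entire_multipliers_nonzero:
  assumes "Im \<tau> > 0" "g holomorphic_on UNIV"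
    "\<And>y. g (y + 1) = ee a * g y" "\<And>y. g (y + \<tau>) = ee b * g y" "g z \<noteq> 0"
  obtains m :: int where "b - a * \<tau> - of_int m * \<tau> \<in> \<int>"
proof -
  obtain c where c: "\<And>y. g y = g 0 * ee (c * y)"
    using entire_multipliers[OF assms(1-4)] by auto
  have g0: "g 0 \<noteq> 0" using c[of z] assms(5) by auto
  have "ee a = ee c" "ee b = ee (c * \<tau>)"
    using assms(3)[of 0] assms(4)[of 0] c[of 1] c[of \<tau>] g0 by auto
  then have "ee (c - a) = 1" "ee (b - c * \<tau>) = 1" by (auto simp: ee_diff)
  then obtain m where m: "c - a = of_int m" "b - c * \<tau> \<in> \<int>" by (auto simp: ee_eq_1_iff elim: Ints_cases)
  have "c = a + of_int m" using m(1) by (simp add: algebra_simps)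
  with m(2) show ?thesis by (intro that[of m]) (simp add: algebra_simps)
qed

lemma lattice_add: "x \<in> lattice \<tau> \<Longrightarrow> y \<in> lattice \<tau> \<Longrightarrow> x + y \<in> lattice \<tau>"
  unfolding lattice_def
  by (clarsimp, rule_tac x="m + ma" in exI, rule_tac x="n + na" in exI) (simp add: algebra_simps)

lemma lattice_minus: "x \<in> lattice \<tau> \<Longrightarrow> - x \<in> lattice \<tau>"
  unfolding lattice_def
  by (clarsimp, rule_tac x="- m" in exI, rule_tac x="- n" in exI) (simp add: algebra_simps)

lemma lattice_diff: "x \<in> lattice \<tau> \<Longrightarrow> y \<in> lattice \<tau> \<Longrightarrow> x - y \<in> lattice \<tau>"
  using lattice_add[of x \<tau> "- y"] lattice_minus[of y] by simp

lemma lattice_minus_iff: "- x \<in> lattice \<tau> \<longleftrightarrow> x \<in> lattice \<tau>"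
  using lattice_minus[of x] lattice_minus[of "- x"] by auto

text \<open>At a zero of \<open>f\<close> the term with the derivative of the multiplier drops out
  of the product rule, so the two derivatives differ by the factor \<open>E z\<close>.\<close>

lemma simple_zero_transport:
  assumes f: "f holomorphic_on UNIV" and E: "E holomorphic_on UNIV" "E z \<noteq> 0"
    and fE: "\<And>x. f (x + t) = E x * f x"
  shows "f z = 0 \<and> deriv f z \<noteq> 0 \<longleftrightarrow> f (z + t) = 0 \<and> deriv f (z + t) \<noteq> 0"
proof -
  have df: "(f has_field_derivative deriv f x) (at x)" for x
    by (rule holomorphic_derivI[OF f]) auto
  have dE: "(E has_field_derivative deriv E x) (at x)" for x
    by (rule holomorphic_derivI[OF E(1)]) auto
  have "((\<lambda>x. f (x + t)) has_field_derivative deriv f (z + t)) (at z)"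
    using df[of "z + t"] by (simp add: DERIV_shift)
  moreover have "((\<lambda>x. E x * f x) has_field_derivative deriv E z * f z + E z * deriv f z) (at z)"
    by (auto intro!: derivative_eq_intros df dE)
  ultimately have "deriv f (z + t) = deriv E z * f z + E z * deriv f z"
    using DERIV_unique unfolding fE by blast
  then show ?thesis using E(2) by (auto simp: fE)
qed

section \<open>Theta series\<close>

lemma int_exp_summable: "(\<lambda>j::int. exp (- (\<bar>of_int j\<bar> / 2) :: real)) summable_on UNIV"
proof -
  have "summable (\<lambda>n. exp (- 1 / 2 :: real) ^ n)" by (rule summable_geometric) simp
  then have "(\<lambda>n. exp (- 1 / 2 :: real) ^ n) summable_on UNIV"
    by (rule summable_nonneg_imp_summable_on) simp
  then have n: "(\<lambda>n::nat. exp (- (real n / 2))) summable_on UNIV"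
    by (simp add: exp_of_nat_mult[symmetric])
  have UN: "UNIV = range int \<union> range (\<lambda>n. - int n)"
    using int_cases2 by blast
  show ?thesis unfolding UN
  proof (rule summable_on_union)
    show "(\<lambda>j::int. exp (- (\<bar>of_int j\<bar> / 2) :: real)) summable_on range int"
      using n by (subst summable_on_reindex) (auto simp: o_def)
    show "(\<lambda>j::int. exp (- (\<bar>of_int j\<bar> / 2) :: real)) summable_on range (\<lambda>n. - int n)"
      using n by (subst summable_on_reindex) (auto simp: o_def inj_on_def)
  qed
qed

text \<open>Completing the square: with a real characteristic the modulus is a Gaussian in the
  shifted index, and its quadratic decay beats the linear term uniformly for \<open>z\<close> in a
  disc.\<close>

lemma theta_term_bound:
  assumes \<tau>: "Im \<tau> > 0"
  obtains C where "C \<ge> 0" and "\<And>(j::int) z. norm z \<le> R \<Longrightarrow>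
    norm (ee ((of_int j + of_real a)^2 * (\<tau> / 2) + (of_int j + of_real a) * (z + b))) \<le> C * exp (- \<bar>of_int j\<bar>)"
proof
  define B where "B = R + norm b"
  define p where "p = pi * Im \<tau>"
  \<comment> \<open>The summand 1 reserves a decay exp (- |x|) once the parabola
    \<open>r * x - p * x^2\<close> has been bounded by its maximum
    \<open>r^2 / (4 * p)\<close>.\<close>
  define r where "r = 2 * pi * B + 1"
  let ?C = "exp (r^2 / (4 * p) + \<bar>a\<bar>)"
  have p: "p > 0" using \<tau> by (simp add: p_def)
  show "?C \<ge> 0" by simp
  fix j :: int and z :: complex assume z: "norm z \<le> R"
  define x where "x = of_int j + a"
  have x: "of_int j + complex_of_real a = of_real x" by (simp add: x_def)
  have "norm (z + b) \<le> B" using z norm_triangle_ineq[of z b] by (simp add: B_def)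
  then have "\<bar>Im (z + b)\<bar> \<le> B" using abs_Im_le_cmod[of "z + b"] by linarith
  then have "\<bar>x * Im (z + b)\<bar> \<le> \<bar>x\<bar> * B" by (simp add: abs_mult mult_left_mono)
  then have "- 2 * pi * (x * Im (z + b)) \<le> 2 * pi * (\<bar>x\<bar> * B)"
    using mult_left_mono[of "- (x * Im (z + b))" "\<bar>x\<bar> * B" "2 * pi"] by (simp add: abs_le_iff mult.assoc del: Im_divide_numeral plus_complex.sel)
  then have 1: "- 2 * pi * (x^2 * Im \<tau> / 2 + x * Im (z + b)) \<le> - p * \<bar>x\<bar>^2 + (r - 1) * \<bar>x\<bar>"
    by (simp add: p_def r_def algebra_simps)
  have "0 \<le> (p * \<bar>x\<bar> - r / 2)^2 / p" using p by simp
  also have "\<dots> = p * \<bar>x\<bar>^2 - r * \<bar>x\<bar> + r^2 / (4 * p)"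
    using p by (simp add: power2_eq_square field_simps)
  finally have 2: "- p * \<bar>x\<bar>^2 + (r - 1) * \<bar>x\<bar> \<le> r^2 / (4 * p) - \<bar>x\<bar>" by (simp add: algebra_simps)
  have 3: "- \<bar>x\<bar> \<le> \<bar>a\<bar> - \<bar>of_int j\<bar>" unfolding x_def by linarith
  have "norm (ee (of_real x ^2 * (\<tau> / 2) + of_real x * (z + b))) = exp (- 2 * pi * (x^2 * Im \<tau> / 2 + x * Im (z + b)))"
    by (simp add: norm_ee flip: of_real_power)
  also have "\<dots> \<le> exp (r^2 / (4 * p) + \<bar>a\<bar> - \<bar>of_int j\<bar>)"
    using 1 2 3 by (subst exp_le_cancel_iff) linarith
  also have "\<dots> = ?C * exp (- \<bar>of_int j\<bar>)" by (simp add: exp_add[symmetric])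
  finally show "norm (ee ((of_int j + of_real a)^2 * (\<tau> / 2) + (of_int j + of_real a) * (z + b))) \<le> ?C * exp (- \<bar>of_int j\<bar>)"
    unfolding x .
qed

lemma exp_minus_abs_summable: "(\<lambda>j::int. C * exp (- \<bar>of_int j\<bar> :: real)) summable_on UNIV"
proof (rule summable_on_cmult_right, rule summable_on_comparison_test[OF int_exp_summable])
qed auto

lemma theta_has_sum:
  assumes "Im \<tau> > 0"
  shows "((\<lambda>j::int. ee ((of_int j + of_real a)^2 * (\<tau> / 2) + (of_int j + of_real a) * (z + b)))
           has_sum theta (of_real a) b z \<tau>) UNIV"
proof -
  obtain C where C: "\<And>(j::int) w. norm w \<le> norm z \<Longrightarrow>
    norm (ee ((of_int j + of_real a)^2 * (\<tau> / 2) + (of_int j + of_real a) * (w + b))) \<le> C * exp (- \<bar>of_int j\<bar>)"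
    using theta_term_bound[OF assms] by metis
  have "(\<lambda>j::int. norm (ee ((of_int j + of_real a)^2 * (\<tau> / 2) + (of_int j + of_real a) * (z + b)))) summable_on UNIV"
    by (rule summable_on_comparison_test[OF exp_minus_abs_summable[of C]]) (use C in auto)
  then show ?thesis unfolding theta_def
    by (intro has_sum_infsum) (rule abs_summable_summable)
qed

lemma theta_entire:
  assumes "Im \<tau> > 0"
  shows "(\<lambda>z. theta (of_real a) b z \<tau>) holomorphic_on UNIV"
proof -
  have "(\<lambda>z. theta (of_real a) b z \<tau>) holomorphic_on ball 0 R" for R
  proof -
    obtain C where C: "\<And>(j::int) w. norm w \<le> R \<Longrightarrow>
      norm (ee ((of_int j + of_real a)^2 * (\<tau> / 2) + (of_int j + of_real a) * (w + b))) \<le> C * exp (- \<bar>of_int j\<bar>)"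
      using theta_term_bound[OF assms] by metis
    have "uniform_limit (cball 0 R) (\<lambda>X z. \<Sum>j\<in>X. ee ((of_int j + of_real a)^2 * (\<tau> / 2) + (of_int j + of_real a) * (z + b)))
       (\<lambda>z. theta (of_real a) b z \<tau>) (finite_subsets_at_top UNIV)"
      unfolding theta_def
      by (rule Weierstrass_m_test_general[OF _ exp_minus_abs_summable[of C]]) (use C in auto)
    then show ?thesis
      by (rule holomorphic_uniform_limit[rotated])
        (auto intro!: always_eventually conjI holomorphic_on_imp_continuous_on holomorphic_intros)
  qed
  then have "(\<lambda>z. theta (of_real a) b z \<tau>) field_differentiable at z" for z
    by (rule holomorphic_on_imp_differentiable_at[of _ "ball 0 (norm z + 1)"]) auto
  then show ?thesis by (auto simp: holomorphic_on_def)
qed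

text \<open>Completing the square in the index turns a translation by \<open>s * \<tau>\<close> into
  a shift of the characteristic by \<open>s\<close>. The values 1 and -1 yield quasi-periods, 1/N
  the cyclic permutation of the rows of the gauge matrix.\<close>

lemma theta_shift:
  "theta a b (z + s * \<tau>) \<tau> = ee (- (s^2 * (\<tau> / 2)) - s * (z + b)) * theta (a + s) b z \<tau>"
  unfolding theta_def infsum_cmult_right'[symmetric] ee_add[symmetric]
  by (rule infsum_cong, rule arg_cong[where f = ee]) (simp add: field_simps power2_eq_square)

lemma theta_char_add_1: "theta (a + 1) b z \<tau> = theta a b z \<tau>"
  unfolding theta_def
  by (rule infsum_reindex_bij_witness[of _ "\<lambda>j. j - 1" "\<lambda>j. j + 1"]) (auto simp: algebra_simps)

lemma theta_add_1: "theta a b (z + 1) \<tau> = ee a * theta a b z \<tau>"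
proof -
  have "ee ((of_int j + a)^2 * (\<tau> / 2) + (of_int j + a) * (z + 1 + b)) =
     ee a * ee ((of_int j + a)^2 * (\<tau> / 2) + (of_int j + a) * (z + b))" for j :: int
    using ee_of_int[of j] by (simp add: ring_distribs ee_add)
  then show ?thesis unfolding theta_def by (simp add: infsum_cmult_right')
qed

lemma sum_ee_roots:
  assumes "n > 0"
  shows "(\<Sum>k<n. ee (of_int j * of_nat k / of_nat n)) = (if int n dvd j then of_nat n else 0)"
proof (cases "int n dvd j")
  case True
  then obtain l where "j = int n * l" by auto
  then have "ee (of_int j * of_nat k / of_nat n) = 1" for k
    using assms ee_of_int[of "l * int k"] by simp
  then show ?thesis using True by simp
next
  case False
  let ?x = "ee (of_int j / of_nat n)"
  have "?x \<noteq> 1"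
  proof
    assume "?x = 1"
    then obtain l :: int where "of_int j / of_nat n = (of_int l :: complex)" by (auto simp: ee_eq_1_iff elim: Ints_cases)
    then have "of_int j = (of_int (l * int n) :: complex)" using assms by (simp add: field_simps)
    then show False using False unfolding of_int_eq_iff by simp
  qed
  moreover have "ee (of_int j * of_nat k / of_nat n) = ?x ^ k" for k
    by (simp add: ee_power mult.commute)
  moreover have "?x ^ n = 1" using assms by (simp add: ee_power)
  ultimately show ?thesis using False by (simp add: geometric_sum)
qed

text \<open>Averaging over the translates by \<open>k/n\<close> isolates the coefficients whose index is divisible
  by \<open>n\<close>; all of these except the one of index 0 tend to 0.\<close>

lemma theta_not_identically_zero:
  assumes \<tau>: "Im \<tau> > 0"
  shows "\<exists>z. theta (of_real a) b z \<tau> \<noteq> 0"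
proof (rule ccontr)
  assume "\<not> ?thesis"
  then have zero: "theta (of_real a) b z \<tau> = 0" for z by auto
  define c where "c = (\<lambda>j::int. ee ((of_int j + of_real a)^2 * (\<tau> / 2) + (of_int j + of_real a) * b))"
  obtain C where C0: "C \<ge> 0" and C: "\<And>j. norm (c j) \<le> C * exp (- \<bar>of_int j\<bar>)"
    using theta_term_bound[OF \<tau>, of 0 a b thesis] by (auto simp: c_def)
  \<comment> \<open>Half of the exponent keeps the series summable. The other half gives the factor
    exp (- n / 2), because a nonzero index divisible by \<open>n\<close> has modulus at least
    \<open>n\<close>.\<close>
  define D where "D = (\<Sum>\<^sub>\<infinity>j::int. exp (- (\<bar>of_int j\<bar> / 2) :: real))"
  have bound: "norm (c 0) \<le> C * D * exp (- 1 / 2) ^ n" if n: "n > 0" for n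
  proof -
    have "((\<lambda>j. c j * ee (of_int j * of_nat k / of_nat n)) has_sum 0) UNIV" for k
    proof -
      have "((\<lambda>j. ee (- (of_real a * (of_nat k / of_nat n))) *
          ee ((of_int j + of_real a)^2 * (\<tau> / 2) + (of_int j + of_real a) * (of_nat k / of_nat n + b)))
          has_sum (ee (- (of_real a * (of_nat k / of_nat n))) * 0)) UNIV"
        using theta_has_sum[OF \<tau>, of a "of_nat k / of_nat n" b] zero
        by (intro has_sum_cmult_right) simp
      then show ?thesis
        unfolding c_def ee_add[symmetric] by (simp add: algebra_simps add_divide_distrib)
    qed
    then have "((\<lambda>j. \<Sum>k<n. c j * ee (of_int j * of_nat k / of_nat n)) has_sum 0) UNIV"
    proof -
      assume *: "((\<lambda>j. c j * ee (of_int j * of_nat k / of_nat n)) has_sum 0) UNIV" for k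
      have "((\<lambda>j. \<Sum>k<m. c j * ee (of_int j * of_nat k / of_nat n)) has_sum 0) UNIV" for m
        by (induction m) (use * has_sum_add[where a = 0 and b = 0] in fastforce)+
      then show ?thesis by simp
    qed
    then have "((\<lambda>j. c j * (if int n dvd j then of_nat n else 0)) has_sum 0) UNIV"
      unfolding sum_distrib_left[symmetric] sum_ee_roots[OF n] by simp
    then have "((\<lambda>j. inverse (of_nat n) * (c j * (if int n dvd j then of_nat n else 0))) has_sum (inverse (of_nat n) * 0)) UNIV"
      by (rule has_sum_cmult_right)
    also have "(\<lambda>j. inverse (of_nat n) * (c j * (if int n dvd j then of_nat n else 0))) = (\<lambda>j. if int n dvd j then c j else 0)"
      using n by auto
    finally have s0: "((\<lambda>j. if int n dvd j then c j else 0) has_sum 0) UNIV" by simp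
    \<comment> \<open>Removing the coefficient of index 0 leaves a series with sum
      \<open>- c 0\<close> all of whose terms are small.\<close>
    have "((\<lambda>j::int. if j = 0 then - c 0 else 0) has_sum (- c 0)) UNIV"
      by (rule has_sum_finite_neutralI[of "{0}"]) auto
    from has_sum_add[OF s0 this]
    have "((\<lambda>j. (if int n dvd j then c j else 0) + (if j = 0 then - c 0 else 0)) has_sum (- c 0)) UNIV"
      by simp
    moreover have ss: "((\<lambda>j::int. C * exp (- (real n / 2)) * exp (- (\<bar>of_int j\<bar> / 2))) has_sum (C * exp (- (real n / 2)) * D)) UNIV"
      unfolding D_def by (intro has_sum_cmult_right has_sum_infsum int_exp_summable)
    moreover have "norm ((if int n dvd j then c j else 0) + (if j = 0 then - c 0 else 0)) \<le> C * exp (- (real n / 2)) * exp (- (\<bar>of_int j\<bar> / 2))" for j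
    proof (cases "int n dvd j \<and> j \<noteq> 0")
      case True
      then have "int n \<le> \<bar>j\<bar>" using dvd_imp_le_int[of j "int n"] by simp
      then have "real n \<le> \<bar>of_int j\<bar>" by linarith
      then have "exp (- \<bar>of_int j\<bar>) \<le> exp (- (real n / 2)) * exp (- (\<bar>of_int j\<bar> / 2))"
        by (simp add: exp_add[symmetric])
      then have "C * exp (- \<bar>of_int j\<bar>) \<le> C * (exp (- (real n / 2)) * exp (- (\<bar>of_int j\<bar> / 2)))"
        using C0 by (rule mult_left_mono)
      with C[of j] True show ?thesis by (simp add: mult.assoc)
    qed (use C0 in auto)
    ultimately have "norm (- c 0) \<le> C * exp (- (real n / 2)) * D"
      by (rule norm_infsum_le)
    also have "exp (- (real n / 2)) = exp (- 1 / 2) ^ n" by (simp add: exp_of_nat_mult[symmetric])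
    finally show ?thesis by (simp add: mult_ac)
  qed
  have "(\<lambda>n. C * D * exp (- 1 / 2) ^ n) \<longlonglongrightarrow> C * D * 0"
    by (intro tendsto_mult tendsto_const LIMSEQ_power_zero) simp
  then have "norm (c 0) \<le> C * D * 0"
    by (rule tendsto_lowerbound) (intro eventually_sequentiallyI[of 1] bound, simp_all)
  then show False by (simp add: c_def)
qed

section \<open>The odd theta function\<close>

lemma vtheta_entire: "Im \<tau> > 0 \<Longrightarrow> (\<lambda>z. vtheta z \<tau>) holomorphic_on UNIV"
  unfolding vtheta_def using theta_entire[of \<tau> "1/2" "1/2"] by simp

lemma vtheta_add_1: "vtheta (z + 1) \<tau> = - vtheta z \<tau>"
  by (simp add: vtheta_def theta_add_1)

lemma vtheta_add_tau: "vtheta (z + \<tau>) \<tau> = - (ee (- (\<tau> / 2) - z) * vtheta z \<tau>)"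
proof -
  have "ee (- (\<tau> / 2) - (z + 1/2)) = - ee (- (\<tau> / 2) - z)"
    by (simp add: ee_diff ee_add)
  then show ?thesis
    using theta_shift[of "1/2" "1/2" z 1 \<tau>] theta_char_add_1[of "1/2" "1/2" z \<tau>]
    by (simp add: vtheta_def)
qed

lemma vtheta_minus: "vtheta (- z) \<tau> = - vtheta z \<tau>"
proof -
  have "vtheta (- z) \<tau> = (\<Sum>\<^sub>\<infinity>j::int. - ee ((of_int j + 1/2)^2 * (\<tau> / 2) + (of_int j + 1/2) * (z + 1/2)))"
    unfolding vtheta_def theta_def
  proof (rule infsum_reindex_bij_witness[of _ "\<lambda>j. - 1 - j" "\<lambda>j. - 1 - j"])
    fix j :: int
    \<comment> \<open>The reflection j -> -1 - j changes the sign of j + 1/2. The exponents then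
      differ by an integer plus 1/2, and the 1/2 gives the minus sign.\<close>
    have "(of_int (- 1 - j) + 1/2)^2 * (\<tau> / 2) + (of_int (- 1 - j) + 1/2) * (z + 1/2) =
       (of_int j + 1/2)^2 * (\<tau> / 2) + (of_int j + 1/2) * (- z + 1/2) - of_int j - (1/2 :: complex)"
      by (simp add: field_simps power2_eq_square)
    then show "- ee ((of_int (- 1 - j) + 1/2)^2 * (\<tau> / 2) + (of_int (- 1 - j) + 1/2) * (z + 1/2)) =
      ee ((of_int j + 1/2)^2 * (\<tau> / 2) + (of_int j + 1/2) * (- z + 1/2))"
      by (simp only: ee_diff ee_of_int ee_half) simp
  qed auto
  then show ?thesis by (simp add: vtheta_def theta_def infsum_uminus)
qed

lemma vtheta_0 [simp]: "vtheta 0 \<tau> = 0"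
  using vtheta_minus[of 0 \<tau>] by simp

section \<open>The Jacobi product, built from the q-Pochhammer symbol (w; q)\<close>

definition qprod :: "complex \<Rightarrow> complex \<Rightarrow> complex" where
  "qprod q w = (\<Prod>n. 1 - q ^ n * w)"

lemma qprod_convergent: "norm (q::complex) < 1 \<Longrightarrow> convergent_prod (\<lambda>n. 1 - q ^ n * w)"
  by (rule abs_convergent_prod_imp_convergent_prod, rule summable_imp_abs_convergent_prod)
    (simp add: norm_mult norm_power summable_mult2)

lemma qprod_LIMSEQ: "norm q < 1 \<Longrightarrow> (\<lambda>N. \<Prod>n<N. 1 - q ^ n * w) \<longlonglongrightarrow> qprod q w"
  using convergent_prod_LIMSEQ[OF qprod_convergent[of q w]]
  unfolding qprod_def lessThan_Suc_atMost[symmetric] by (subst (asm) filterlim_sequentially_Suc)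

lemma qprod_nonzero: "norm q < 1 \<Longrightarrow> (\<And>n. q ^ n * w \<noteq> 1) \<Longrightarrow> qprod q w \<noteq> 0"
  unfolding qprod_def by (rule prodinf_nonzero[OF qprod_convergent], assumption) (metis right_minus_eq)

lemma qprod_step: "norm q < 1 \<Longrightarrow> qprod q w = (1 - w) * qprod q (q * w)"
proof -
  assume q: "norm q < 1"
  have "(\<Prod>n<Suc N. 1 - q ^ n * w) = (1 - w) * (\<Prod>n<N. 1 - q ^ n * (q * w))" for N
    unfolding prod.lessThan_Suc_shift by (simp add: mult_ac)
  moreover have "(\<lambda>N. \<Prod>n<Suc N. 1 - q ^ n * w) \<longlonglongrightarrow> qprod q w"
    using qprod_LIMSEQ[OF q] by (rule LIMSEQ_Suc)
  moreover have "(\<lambda>N. (1 - w) * (\<Prod>n<N. 1 - q ^ n * (q * w))) \<longlonglongrightarrow> (1 - w) * qprod q (q * w)"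
    by (intro tendsto_mult tendsto_const qprod_LIMSEQ q)
  ultimately show ?thesis by (simp add: LIMSEQ_unique)
qed

lemma qprod_entire:
  assumes q: "norm q < 1"
  shows "qprod q holomorphic_on UNIV"
proof (rule holomorphic_uniform_sequence)
  fix z :: complex
  let ?P = "\<lambda>N w. \<Prod>n<N. 1 - q ^ n * w"
  have "uniformly_convergent_on (cball z 1) ?P"
  proof (rule uniformly_convergent_on_prod')
    show "uniformly_convergent_on (cball z 1) (\<lambda>N w. \<Sum>n<N. norm (1 - q ^ n * w - 1))"
    proof (rule Weierstrass_m_test')
      fix n and w assume "w \<in> cball z 1"
      then have "norm w \<le> norm z + 1" using norm_triangle_ineq2[of w z] by (simp add: dist_norm norm_minus_commute)
      then show "norm (norm (1 - q ^ n * w - 1)) \<le> norm q ^ n * (norm z + 1)"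
        by (simp add: norm_mult norm_power mult_left_mono)
    qed (use q in \<open>auto intro!: summable_mult2\<close>)
  qed (auto intro!: continuous_intros)
  then obtain g where g: "uniform_limit (cball z 1) ?P g sequentially"
    by (auto simp: uniformly_convergent_on_def)
  have "uniform_limit (cball z 1) ?P (qprod q) sequentially"
  proof (rule uniform_limit_cong'[THEN iffD1, OF _ _ g])
    fix w assume "w \<in> cball z 1"
    from tendsto_uniform_limitI[OF g this] show "g w = qprod q w"
      using qprod_LIMSEQ[OF q] LIMSEQ_unique by blast
  qed auto
  then show "\<exists>d>0. cball z d \<subseteq> UNIV \<and> uniform_limit (cball z d) ?P (qprod q) sequentially"
    by (intro exI[of _ 1]) auto
qed (auto intro!: holomorphic_intros)

lemma norm_ee_less_1: "Im \<tau> > 0 \<Longrightarrow> norm (ee \<tau>) < 1"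
  by (simp add: norm_ee)

text \<open>The Jacobi product has the same multipliers as \<open>\<vartheta>\<close> up to constants and visibly has its
  zeros in the lattice only; so \<open>\<vartheta>\<close> is a multiple of it by an exponential.\<close>

definition jprod :: "complex \<Rightarrow> complex \<Rightarrow> complex" where
  "jprod \<tau> z = qprod (ee \<tau>) (ee z) * qprod (ee \<tau>) (ee \<tau> * ee (- z))"

context
  fixes \<tau> :: complex
  assumes \<tau>: "Im \<tau> > 0"
begin

lemma jprod_entire: "jprod \<tau> holomorphic_on UNIV"
  unfolding jprod_def[abs_def]
  by (intro holomorphic_intros entire_compose[OF qprod_entire[OF norm_ee_less_1[OF \<tau>]]])

lemma jprod_add_1: "jprod \<tau> (z + 1) = jprod \<tau> z"
  by (simp add: jprod_def ee_add ee_minus ee_diff)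

lemma jprod_add_tau: "jprod \<tau> (z + \<tau>) = - (ee (- z) * jprod \<tau> z)"
proof -
  have 1: "qprod (ee \<tau>) (ee z) = (1 - ee z) * qprod (ee \<tau>) (ee \<tau> * ee z)"
    and 2: "qprod (ee \<tau>) (ee (- z)) = (1 - ee (- z)) * qprod (ee \<tau>) (ee \<tau> * ee (- z))"
    by (rule qprod_step[OF norm_ee_less_1[OF \<tau>]])+
  have "1 - ee (- z) = - (ee (- z) * (1 - ee z))"
    by (simp add: ee_minus right_diff_distrib)
  moreover have "ee (z + \<tau>) = ee \<tau> * ee z" "ee \<tau> * ee (- (z + \<tau>)) = ee (- z)"
    by (simp_all add: ee_add ee_minus ee_diff)
  ultimately show ?thesis by (simp add: jprod_def 1 2)
qed

lemma jprod_zero: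
  assumes "jprod \<tau> z = 0"
  shows "z \<in> lattice \<tau>"
proof -
  have *: "x + of_nat n * \<tau> \<in> \<int>" if "ee \<tau> ^ n * ee x = 1" for n x
    using that by (simp add: ee_power ee_add[symmetric] ee_eq_1_iff add.commute)
  from assms have "qprod (ee \<tau>) (ee z) = 0 \<or> qprod (ee \<tau>) (ee \<tau> * ee (- z)) = 0"
    by (simp add: jprod_def)
  then show ?thesis
  proof
    assume "qprod (ee \<tau>) (ee z) = 0"
    then obtain n where "ee \<tau> ^ n * ee z = 1" using qprod_nonzero[OF norm_ee_less_1[OF \<tau>]] by blast
    from *[OF this] obtain m where "z + of_nat n * \<tau> = of_int m" by (auto elim: Ints_cases)
    then have "z = of_int m + of_int (- int n) * \<tau>" by (simp add: algebra_simps)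
    then show ?thesis unfolding lattice_def by blast
  next
    assume "qprod (ee \<tau>) (ee \<tau> * ee (- z)) = 0"
    then obtain n where "ee \<tau> ^ n * (ee \<tau> * ee (- z)) = 1" using qprod_nonzero[OF norm_ee_less_1[OF \<tau>]] by blast
    then have "ee \<tau> ^ Suc n * ee (- z) = 1" by (simp add: mult_ac)
    from *[OF this] obtain m where "- z + of_nat (Suc n) * \<tau> = of_int m" by (auto elim: Ints_cases)
    then have "z = of_int (- m) + of_int (int (Suc n)) * \<tau>" by (simp add: algebra_simps)
    then show ?thesis unfolding lattice_def by blast
  qed
qed

text \<open>The factor \<open>1 - ee z\<close>, split off from the first product, carries the zero.
  The two remaining products agree at 0 and are nonzero there because |q|^(n+1) < 1.\<close>

lemma jprod_0: "jprod \<tau> 0 = 0 \<and> deriv (jprod \<tau>) 0 \<noteq> 0"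
proof -
  let ?G = "\<lambda>z. qprod (ee \<tau>) (ee \<tau> * ee z)"
  have G: "?G holomorphic_on UNIV"
    by (intro holomorphic_intros entire_compose[OF qprod_entire[OF norm_ee_less_1[OF \<tau>]]])
  have nz: "?G 0 \<noteq> 0"
  proof (rule qprod_nonzero[OF norm_ee_less_1[OF \<tau>]])
    fix n
    have "norm (ee \<tau> ^ n * (ee \<tau> * ee 0)) < 1"
      using power_Suc_less_one[of "norm (ee \<tau>)" n] norm_ee_less_1[OF \<tau>] by (simp add: norm_mult norm_power mult.commute)
    then show "ee \<tau> ^ n * (ee \<tau> * ee 0) \<noteq> 1" by auto
  qed
  have j: "jprod \<tau> = (\<lambda>z. (1 - ee z) * ?G z * ?G (- z))"
    unfolding jprod_def[abs_def] by (subst qprod_step[OF norm_ee_less_1[OF \<tau>]]) (rule refl)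
  have d1: "(?G has_field_derivative deriv ?G 0) (at 0)"
    by (rule holomorphic_derivI[OF G]) auto
  have d2: "((\<lambda>z. ?G (- z)) has_field_derivative - deriv ?G 0) (at 0)"
    using DERIV_chain2[of ?G "deriv ?G 0" uminus 0 "- 1" UNIV] d1 by (simp add: DERIV_minus DERIV_ident)
  have "(jprod \<tau> has_field_derivative (- (2 * of_real pi * \<i>) * ?G 0 * ?G 0)) (at 0)"
    unfolding j by (rule derivative_eq_intros d1 d2 refl)+ simp
  then have "deriv (jprod \<tau>) 0 = - (2 * of_real pi * \<i>) * ?G 0 * ?G 0" by (rule DERIV_imp_deriv)
  moreover have "jprod \<tau> 0 = 0" unfolding j by simp
  ultimately show ?thesis using nz by simp
qed

lemma jprod_simple_zeros: "simple_zeros (jprod \<tau>)"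
proof -
  have "jprod \<tau> z = 0 \<and> deriv (jprod \<tau>) z \<noteq> 0" if z: "z \<in> lattice \<tau>" for z
  proof -
    have "jprod \<tau> (0 + z) = 0 \<and> deriv (jprod \<tau>) (0 + z) \<noteq> 0 \<longleftrightarrow> jprod \<tau> 0 = 0 \<and> deriv (jprod \<tau>) 0 \<noteq> 0"
    proof (rule invariant_lattice_shift[OF _ _ z])
      show "jprod \<tau> y = 0 \<and> deriv (jprod \<tau>) y \<noteq> 0 \<longleftrightarrow> jprod \<tau> (y + 1) = 0 \<and> deriv (jprod \<tau>) (y + 1) \<noteq> 0" for y
        by (rule simple_zero_transport[OF jprod_entire, of "\<lambda>_. 1"]) (auto simp: jprod_add_1)
      show "jprod \<tau> y = 0 \<and> deriv (jprod \<tau>) y \<noteq> 0 \<longleftrightarrow> jprod \<tau> (y + \<tau>) = 0 \<and> deriv (jprod \<tau>) (y + \<tau>) \<noteq> 0" for y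
        by (rule simple_zero_transport[OF jprod_entire, of "\<lambda>x. - ee (- x)"])
          (auto simp: jprod_add_tau intro!: holomorphic_intros)
    qed
    then show ?thesis using jprod_0 by simp
  qed
  then show ?thesis unfolding simple_zeros_def using jprod_zero jprod_entire by blast
qed

lemma vtheta_lattice:
  assumes "z \<in> lattice \<tau>"
  shows "vtheta z \<tau> = 0"
proof -
  have "vtheta (0 + z) \<tau> = 0 \<longleftrightarrow> vtheta 0 \<tau> = 0"
    by (rule invariant_lattice_shift[OF _ _ assms]) (simp_all add: vtheta_add_1 vtheta_add_tau)
  then show ?thesis by simp
qed

text \<open>The division uses only the easy inclusion, that \<open>vtheta\<close> vanishes on the
  lattice. Both multipliers of the quotient are constants, so it is an exponential, and the hard
  inclusion is then inherited from the product.\<close>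

lemma vtheta_jprod:
  obtains k c where "k \<noteq> 0" "\<And>z. vtheta z \<tau> = k * ee (c * z) * jprod \<tau> z"
proof -
  obtain h where h: "h holomorphic_on UNIV" "\<And>z. vtheta z \<tau> = h z * jprod \<tau> z"
    using entire_divide[OF vtheta_entire[OF \<tau>] jprod_simple_zeros] jprod_zero vtheta_lattice by metis
  have half: "1/2 \<notin> lattice \<tau>"
  proof
    assume "1/2 \<in> lattice \<tau>"
    then obtain m n :: int where mn: "1/2 = of_int m + of_int n * \<tau>" by (auto simp: lattice_def)
    from arg_cong[OF this, of Im] have "n = 0" using \<tau> by simp
    with arg_cong[OF mn, of Re] have "1 = 2 * real_of_int m" by simp
    then have "1 = 2 * m" by linarith
    then show False by presburger
  qed
  then have nz: "jprod \<tau> (1/2) \<noteq> 0" using jprod_zero by blast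
  note h_multiplier = quotient_multiplier[OF h(1) jprod_entire nz]
  have 1: "h (z + 1) = - 1 * h z" for z
  proof (rule h_multiplier[where e = "\<lambda>_. 1"])
    show "h (z + 1) * (1 * jprod \<tau> z) = - 1 * 1 * (h z * jprod \<tau> z)" for z
      using h(2)[of "z + 1"] h(2)[of z] by (simp add: vtheta_add_1 jprod_add_1)
  qed simp_all
  have 2: "h (z + \<tau>) = ee (- (\<tau> / 2)) * h z" for z
  proof (rule h_multiplier[where e = "\<lambda>z. - ee (- z)"])
    show "h (z + \<tau>) * (- ee (- z) * jprod \<tau> z) = ee (- (\<tau> / 2)) * - ee (- z) * (h z * jprod \<tau> z)" for z
      using vtheta_add_tau[of z \<tau>] ee_add[of "- (\<tau> / 2)" "- z"] by (simp add: h(2) jprod_add_tau mult.assoc)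
  qed simp_all
  obtain c where c: "\<And>y. h y = h 0 * ee (c * y)"
    using entire_multipliers[OF \<tau> h(1) 1 2] by auto
  have "h 0 \<noteq> 0"
  proof
    assume "h 0 = 0"
    then have "vtheta z \<tau> = 0" for z using h(2) c[of z] by simp
    then show False using theta_not_identically_zero[OF \<tau>, of "1/2" "1/2"] by (simp add: vtheta_def)
  qed
  then show ?thesis using that[of "h 0" c] h(2) c by metis
qed

lemma vtheta_eq_0_iff: "vtheta z \<tau> = 0 \<longleftrightarrow> z \<in> lattice \<tau>"
proof -
  obtain k c where "k \<noteq> 0" "\<And>z. vtheta z \<tau> = k * ee (c * z) * jprod \<tau> z" using vtheta_jprod by metis
  then show ?thesis using jprod_zero vtheta_lattice by auto
qed

lemma vtheta_simple_zeros: "simple_zeros (\<lambda>z. vtheta z \<tau>)"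
  unfolding simple_zeros_def
proof (intro conjI allI impI vtheta_entire[OF \<tau>])
  fix z assume "vtheta z \<tau> = 0"
  obtain k c where kc: "k \<noteq> 0" "\<And>z. vtheta z \<tau> = k * ee (c * z) * jprod \<tau> z" using vtheta_jprod by metis
  then have z: "jprod \<tau> z = 0" using \<open>vtheta z \<tau> = 0\<close> by simp
  have "((\<lambda>z. k * ee (c * z) * jprod \<tau> z) has_field_derivative k * ee (c * z) * deriv (jprod \<tau>) z) (at z)"
    by (rule derivative_eq_intros refl holomorphic_derivI[OF jprod_entire] UNIV_I open_UNIV)+ (simp add: z)
  then show "deriv (\<lambda>z. vtheta z \<tau>) z \<noteq> 0"
    using kc z jprod_simple_zeros by (auto simp: simple_zeros_def kc(2) dest!: DERIV_imp_deriv)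
qed

end

section \<open>Theta functions of higher order\<close>

lemma matrix_inv_right:
  assumes "invertible (A :: 'a::field^'n^'n)"
  shows "A ** matrix_inv A = mat 1"
  using someI_ex[OF assms[unfolded invertible_def]] by (simp add: matrix_inv_def)

lemma matrix_inv_left:
  assumes "invertible (A :: 'a::field^'n^'n)"
  shows "matrix_inv A ** A = mat 1"
  using someI_ex[OF assms[unfolded invertible_def]] by (simp add: matrix_inv_def)

lemma matrix_inv_unique:
  assumes "A ** B = mat 1"
  shows "matrix_inv (A :: 'a::field^'n^'n) = B"
proof -
  have "invertible A" using assms invertible_right_inverse by blast
  then have "matrix_inv A = matrix_inv A ** (A ** B)" by (simp add: assms)
  also have "\<dots> = B" by (simp add: matrix_mul_assoc matrix_inv_left[OF \<open>invertible A\<close>])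
  finally show ?thesis .
qed

lemma idx_bij: "bij_betw idx (UNIV :: 'n::{finite,linorder} set) {1..CARD('n)}"
proof -
  have mono: "idx i < idx j" if "i < j" for i j :: 'n
    unfolding idx_def using that by (intro psubset_card_mono) auto
  then have inj: "inj (idx :: 'n \<Rightarrow> nat)"
    by (metis injI linorder_neqE_nat linorder_neq_iff order_less_irrefl)
  have "idx i \<in> {1..CARD('n)}" for i :: 'n
    unfolding idx_def by (auto simp: Suc_le_eq card_gt_0_iff intro!: card_mono)
  then have "idx ` (UNIV :: 'n set) = {1..CARD('n)}"
    by (intro card_subset_eq) (auto simp: card_image inj)
  with inj show ?thesis by (simp add: bij_betw_def)
qed

lemma idx_inj: "idx i = idx j \<longleftrightarrow> i = j"
  using idx_bij[where 'n = 'a] by (auto simp: bij_betw_def inj_on_def)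

lemma idx_range: "1 \<le> idx (i :: 'n::{finite,linorder})" "idx i \<le> CARD('n)"
  using idx_bij[where 'n = 'n] by (auto simp: bij_betw_def)

lemma sum_idx: "(\<Sum>i\<in>(UNIV :: 'n::{finite,linorder} set). f (idx i)) = (\<Sum>k=1..CARD('n). f k)"
  by (rule sum.reindex_bij_betw[OF idx_bij])

lemma idx_dvd_iff: "int CARD('n) dvd int (idx i) - int (idx (j :: 'n::{finite,linorder})) \<longleftrightarrow> i = j"
proof
  assume d: "int CARD('n) dvd int (idx i) - int (idx j)"
  have "\<bar>int (idx i) - int (idx j)\<bar> < int CARD('n)"
    using idx_range[of i] idx_range[of j] by linarith
  with d have "int (idx i) - int (idx j) = 0" by (metis dvd_imp_le_int abs_of_nat not_le)
  then have "idx i = idx j" by simp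
  then show "i = j" by (simp only: idx_inj)
qed simp

text \<open>The multipliers are normalized so that a product of N translates of
  \<open>vtheta\<close> belongs to this space as soon as its zeros add up to 0;
  \<open>thprod_add_tau\<close> shows the extra factor in general.\<close>

definition theta_space :: "complex \<Rightarrow> nat \<Rightarrow> (complex \<Rightarrow> complex) \<Rightarrow> bool" where
  "theta_space \<tau> N f \<longleftrightarrow> f holomorphic_on UNIV \<and> (\<forall>y. f (y + 1) = (- 1) ^ N * f y) \<and>
     (\<forall>y. f (y + \<tau>) = (- 1) ^ N * ee (- (of_nat N * (\<tau> / 2)) - of_nat N * y) * f y)"

definition psi :: "complex \<Rightarrow> 'n::{finite,linorder} \<Rightarrow> complex \<Rightarrow> complex" where
  "psi \<tau> i y = theta (of_nat (idx i) / of_nat CARD('n) - 1/2) (of_nat CARD('n) / 2)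
     (- (of_nat CARD('n) * y)) (of_nat CARD('n) * \<tau>)"

definition thprod :: "complex \<Rightarrow> ('n::finite \<Rightarrow> complex) \<Rightarrow> complex \<Rightarrow> complex" where
  "thprod \<tau> p y = (\<Prod>k\<in>UNIV. vtheta (y - p k) \<tau>)"

lemma theta_add_of_nat: "theta a b (z + of_nat m) \<tau> = ee (of_nat m * a) * theta a b z \<tau>"
proof (induction m)
  case (Suc m)
  have "theta a b (z + of_nat (Suc m)) \<tau> = theta a b ((z + of_nat m) + 1) \<tau>" by (simp add: add_ac)
  also have "\<dots> = ee a * (ee (of_nat m * a) * theta a b z \<tau>)" unfolding theta_add_1 Suc ..
  finally show ?case by (simp add: ring_distribs ee_add)
qed simp

text \<open>The functions \<open>psi \<tau> i\<close> are eigenfunctions of translation by 1/N with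
  distinct eigenvalues. This separates them in \<open>psi_independent\<close> and is the origin of
  the conjugation by \<open>Qmat\<close> under z -> z + 1.\<close>

lemma psi_shift: "psi \<tau> (i :: 'n::{finite,linorder}) (y - of_nat m / of_nat CARD('n)) =
   ee (of_nat m * (of_nat (idx i) / of_nat CARD('n) - 1/2)) * psi \<tau> i y"
proof -
  have "- (of_nat CARD('n) * (y - of_nat m / of_nat CARD('n))) = - (of_nat CARD('n) * y) + of_nat m"
    by (simp add: field_simps)
  then show ?thesis unfolding psi_def by (simp only: theta_add_of_nat)
qed

lemma Im_card_mult_pos: "Im \<tau> > 0 \<Longrightarrow> Im (of_nat CARD('n::finite) * \<tau>) > 0"
  by (simp add: zero_less_mult_iff)

lemma psi_char: "of_nat (idx i) / of_nat CARD('n) - 1/2 = complex_of_real (real (idx (i::'n::{finite,linorder})) / real CARD('n) - 1/2)"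
  by simp

lemma psi_space:
  assumes "Im \<tau> > 0"
  shows "theta_space \<tau> CARD('n) (psi \<tau> (i :: 'n::{finite,linorder}))"
  unfolding theta_space_def
proof (intro conjI allI)
  let ?N = "CARD('n)"
  let ?a = "of_nat (idx i) / of_nat ?N - 1/2 :: complex"
  show "psi \<tau> i holomorphic_on UNIV"
    unfolding psi_def[abs_def] psi_char
    by (intro entire_compose[OF theta_entire[OF Im_card_mult_pos[OF assms]]] holomorphic_intros)
  fix y
  have pm: "inverse ((- 1) ^ ?N) = (- 1 :: complex) ^ ?N" by (simp add: uminus_power_if)
  have "of_nat ?N * ?a = of_nat (idx i) - of_nat ?N / 2" by (simp add: right_diff_distrib)
  then have "ee (of_nat ?N * ?a) = (- 1) ^ ?N"
    using pm by (simp add: ee_diff ee_half_of_nat inverse_eq_divide)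
  then have "psi \<tau> i y = (- 1) ^ ?N * psi \<tau> i (y + 1)"
    using psi_shift[of \<tau> i "y + 1" ?N] by simp
  then have "(- 1) ^ ?N * psi \<tau> i y = ((- 1) ^ ?N * (- 1) ^ ?N) * psi \<tau> i (y + 1)" by simp
  then show "psi \<tau> i (y + 1) = (- 1) ^ ?N * psi \<tau> i y"
    by (simp add: power_mult_distrib[symmetric])
  have arg: "- (of_nat ?N * (y + \<tau>)) = - (of_nat ?N * y) + (- 1) * (of_nat ?N * \<tau>)"
    by (simp add: algebra_simps)
  have "psi \<tau> i (y + \<tau>) = ee (- (of_nat ?N * \<tau> / 2) + (- (of_nat ?N * y) + of_nat ?N / 2)) * theta (?a + - 1) (of_nat ?N / 2) (- (of_nat ?N * y)) (of_nat ?N * \<tau>)"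
    unfolding psi_def arg theta_shift
    by (intro arg_cong2[where f = "(*)"] arg_cong[where f = ee] refl) simp
  also have "theta (?a + - 1) (of_nat ?N / 2) (- (of_nat ?N * y)) (of_nat ?N * \<tau>) = psi \<tau> i y"
    using theta_char_add_1[of "?a + - 1"] by (simp add: psi_def)
  also have "ee (- (of_nat ?N * \<tau> / 2) + (- (of_nat ?N * y) + of_nat ?N / 2)) = (- 1) ^ ?N * ee (- (of_nat ?N * (\<tau> / 2)) - of_nat ?N * y)"
    unfolding add.assoc[symmetric] by (subst ee_add) (simp add: ee_half_of_nat)
  finally show "psi \<tau> i (y + \<tau>) = (- 1) ^ ?N * ee (- (of_nat ?N * (\<tau> / 2)) - of_nat ?N * y) * psi \<tau> i y" .
qed

lemma psi_entire: "Im \<tau> > 0 \<Longrightarrow> psi \<tau> i holomorphic_on UNIV"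
  using psi_space[of \<tau> i] by (simp add: theta_space_def)

lemma theta_space_sum:
  assumes "\<And>i. i \<in> A \<Longrightarrow> theta_space \<tau> N (f i)"
  shows "theta_space \<tau> N (\<lambda>y. \<Sum>i\<in>A. w i * f i y)"
  using assms unfolding theta_space_def
  by (auto intro!: holomorphic_intros sum.cong simp: sum_distrib_left)

lemma theta_space_diff:
  assumes "theta_space \<tau> N f" "theta_space \<tau> N g"
  shows "theta_space \<tau> N (\<lambda>y. f y - g y)"
  using assms unfolding theta_space_def
  by (auto intro!: holomorphic_intros simp: right_diff_distrib)

lemma theta_space_lattice:
  assumes "theta_space \<tau> N f" "l \<in> lattice \<tau>"
  shows "f (y + l) = 0 \<longleftrightarrow> f y = 0"
  using assms(1) by (intro invariant_lattice_shift[OF _ _ assms(2)]) (auto simp: theta_space_def)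

lemma ee_sum: "ee (\<Sum>k\<in>A. f k) = (\<Prod>k\<in>A. ee (f k))"
  by (induction A rule: infinite_finite_induct) (auto simp: ee_add)

lemma simple_zeros_mult:
  assumes "simple_zeros f" "simple_zeros g" "\<And>z. f z = 0 \<Longrightarrow> g z \<noteq> 0"
  shows "simple_zeros (\<lambda>z. f z * g z)"
  unfolding simple_zeros_def
proof (intro conjI allI impI)
  have f: "f holomorphic_on UNIV" "\<And>z. f z = 0 \<Longrightarrow> deriv f z \<noteq> 0"
    and g: "g holomorphic_on UNIV" "\<And>z. g z = 0 \<Longrightarrow> deriv g z \<noteq> 0"
    using assms(1,2) by (auto simp: simple_zeros_def)
  show "(\<lambda>z. f z * g z) holomorphic_on UNIV" by (intro holomorphic_intros f g)
  fix z assume z: "f z * g z = 0"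
  have "deriv (\<lambda>z. f z * g z) z = f z * deriv g z + deriv f z * g z"
    by (intro DERIV_imp_deriv DERIV_mult' holomorphic_derivI[OF f(1)] holomorphic_derivI[OF g(1)]) auto
  then show "deriv (\<lambda>z. f z * g z) z \<noteq> 0" using z f(2)[of z] g(2)[of z] assms(3)[of z] by auto
qed

lemma sum_ee_idx:
  "(\<Sum>m<CARD('n). ee (of_nat m * (of_nat (idx i) / of_nat CARD('n) - of_nat (idx (k :: 'n::{finite,linorder})) / of_nat CARD('n)))) =
     (if i = k then of_nat CARD('n) else 0)"
proof -
  have "of_nat m * (of_nat (idx i) / of_nat CARD('n) - of_nat (idx k) / of_nat CARD('n)) =
    (of_int (int (idx i) - int (idx k)) * of_nat m / of_nat CARD('n) :: complex)" for m
    by (simp add: field_simps)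
  then show ?thesis using sum_ee_roots[of "CARD('n)" "int (idx i) - int (idx k)"]
    by (simp add: idx_dvd_iff)
qed

section \<open>Complex multiples of matrices\<close>

lemma mat_mult_left: "mat c ** A = mscale c A"
  by (simp add: vec_eq_iff mat_def matrix_matrix_mult_def mscale_def if_distrib[where f = "\<lambda>x. x * _"] cong: if_cong)

lemma mat_mult_right: "A ** mat c = mscale c A"
  by (simp add: vec_eq_iff mat_def matrix_matrix_mult_def mscale_def if_distrib[where f = "\<lambda>x. _ * x"] cong: if_cong)

lemma mscale_mult_left: "mscale c A ** B = mscale c (A ** B)"
  unfolding mat_mult_left[symmetric] by (simp add: matrix_mul_assoc)

lemma mscale_mult_right: "A ** mscale c B = mscale c (A ** B)"
  unfolding mat_mult_right[symmetric] by (simp add: matrix_mul_assoc)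

lemma mscale_mscale: "mscale c (mscale d A) = mscale (c * d) A"
  by (simp add: mscale_def vec_eq_iff mult.assoc)

lemma mscale_1: "mscale 1 A = A"
  by (simp add: mscale_def vec_eq_iff)

lemma mscale_mat: "mscale c (mat d) = mat (c * d)"
  by (simp add: mscale_def mat_def vec_eq_iff)

lemma invertible_mscale: "c \<noteq> 0 \<Longrightarrow> invertible (mscale c (A :: 'n::finite cmat)) \<longleftrightarrow> invertible A"
proof -
  have *: "invertible (mscale d B)" if "d \<noteq> 0" "invertible B" for d and B :: "'n cmat"
  proof -
    have "mscale d B ** mscale (inverse d) (matrix_inv B) = B ** matrix_inv B"
      using that(1) by (simp add: mscale_mult_left mscale_mult_right mscale_mscale mscale_1)
    then show ?thesis using matrix_inv_right[OF that(2)] invertible_right_inverse by metis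
  qed
  assume c: "c \<noteq> 0"
  then have "mscale (inverse c) (mscale c A) = A" by (simp add: mscale_def vec_eq_iff)
  then show ?thesis using *[of c A] *[of "inverse c" "mscale c A"] c by auto
qed

lemma thprod_split: "thprod \<tau> p y = vtheta (y - p j) \<tau> * (\<Prod>k\<in>UNIV - {j}. vtheta (y - p k) \<tau>)"
  unfolding thprod_def by (rule prod.remove) auto

section \<open>Interpolation and the inverse of the gauge matrix\<close>

lemma Xi_tilde_nth:
  fixes u :: "'n::{finite,linorder} cvec"
  shows "Xi_tilde \<tau> u z $ i $ j = psi \<tau> i (u $ j - z / of_nat CARD('n))"
proof -
  have "z - of_nat CARD('n) * u $ j = - (of_nat CARD('n) * (u $ j - z / of_nat CARD('n)))"
    by (simp add: field_simps)
  then show ?thesis unfolding Xi_tilde_def psi_def by (simp only: vec_lambda_beta)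
qed

text \<open>Sample points, distinct modulo the lattice. The offset puts their sum at (N + 1) / 2 +
  1/4, never an integer. Without it the sum would be an integer for odd N, and a nonzero theta
  function of order N could vanish at all of them.\<close>

definition ypt :: "'n::{finite,linorder} \<Rightarrow> complex" where
  "ypt m = (of_nat (idx m) + 1/4) / of_nat CARD('n)"

definition Gmat :: "complex \<Rightarrow> 'n::{finite,linorder} cmat" where
  "Gmat \<tau> = (\<chi> m i. psi \<tau> i (ypt m))"

text \<open>Interpolation at fixed points makes the coefficients linear in the values of
  \<open>f\<close>, with constants independent of \<open>u\<close> and \<open>z\<close>. Holomorphy
  and derivatives in these parameters therefore pass from \<open>f\<close> to its
  coefficients.\<close>

definition coef :: "complex \<Rightarrow> (complex \<Rightarrow> complex) \<Rightarrow> 'n::{finite,linorder} cvec" where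
  "coef \<tau> f = matrix_inv (Gmat \<tau>) *v (\<chi> m. f (ypt m))"

text \<open>Proportional to the diagonal factor of \<open>Xi\<close>, by a constant that does not
  depend on \<open>j\<close>. The sign and the derivative at 0 normalize the product with
  \<open>Bmat\<close> to exactly \<open>vtheta z \<tau>\<close>.\<close>

definition cc :: "complex \<Rightarrow> 'n::finite cvec \<Rightarrow> 'n \<Rightarrow> complex" where
  "cc \<tau> u j = - 1 / (deriv (\<lambda>z. vtheta z \<tau>) 0 * (\<Prod>k\<in>UNIV - {j}. vtheta (u $ j - u $ k) \<tau>))"

text \<open>The zeros of a Lagrange type product: all column points u_k - z/N, except that the j-th
  is displaced by \<open>z\<close>. The displacement makes up for the N shifts by z/N, so the zeros
  still add up to sum u_k.\<close>

definition lagp :: "'n::finite cvec \<Rightarrow> 'n \<Rightarrow> complex \<Rightarrow> 'n \<Rightarrow> complex" where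
  "lagp u j z k = u $ k - z / of_nat CARD('n) + (if k = j then z else 0)"

definition Amat :: "complex \<Rightarrow> 'n::{finite,linorder} cvec \<Rightarrow> complex \<Rightarrow> 'n cmat" where
  "Amat \<tau> u z = (\<chi> i j. psi \<tau> i (u $ j - z / of_nat CARD('n)) * cc \<tau> u j)"

definition Bmat :: "complex \<Rightarrow> 'n::{finite,linorder} cvec \<Rightarrow> complex \<Rightarrow> 'n cmat" where
  "Bmat \<tau> u z = (\<chi> j i. deriv (\<lambda>z. vtheta z \<tau>) 0 * coef \<tau> (thprod \<tau> (lagp u j z)) $ i)"

definition wvec :: "complex \<Rightarrow> 'n::{finite,linorder} cvec \<Rightarrow> 'n cvec" where
  "wvec \<tau> u = coef \<tau> (thprod \<tau> (\<lambda>k. u $ k))"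

definition admissible :: "complex \<Rightarrow> 'n::finite cvec \<Rightarrow> bool" where
  "admissible \<tau> u \<longleftrightarrow> (\<Sum>j\<in>UNIV. u $ j) = 0 \<and> (\<forall>j k. j \<noteq> k \<longrightarrow> u $ j - u $ k \<notin> lattice \<tau>)"

context
  fixes \<tau> :: complex
  assumes \<tau>: "Im \<tau> > 0"
begin

lemma thprod_entire: "thprod \<tau> p holomorphic_on UNIV"
  unfolding thprod_def[abs_def] by (intro holomorphic_intros entire_compose[OF vtheta_entire[OF \<tau>]])

lemma thprod_add_1: "thprod \<tau> (p :: 'n::finite \<Rightarrow> complex) (y + 1) = (- 1) ^ CARD('n) * thprod \<tau> p y"
proof -
  have "vtheta (y + 1 - c) \<tau> = (- 1) * vtheta (y - c) \<tau>" for c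
    using vtheta_add_1[of "y - c" \<tau>] by (simp add: algebra_simps)
  then show ?thesis unfolding thprod_def by (simp add: prod.distrib[symmetric] flip: prod_constant)
qed

lemma thprod_add_tau: "thprod \<tau> (p :: 'n::finite \<Rightarrow> complex) (y + \<tau>) =
   (- 1) ^ CARD('n) * ee (- (of_nat CARD('n) * (\<tau> / 2)) - of_nat CARD('n) * y) * ee (\<Sum>k\<in>UNIV. p k) * thprod \<tau> p y"
proof -
  have *: "vtheta (y + \<tau> - c) \<tau> = (- 1) * (ee (- (\<tau> / 2) - (y - c)) * vtheta (y - c) \<tau>)" for c
    using vtheta_add_tau[of "y - c" \<tau>] by (simp add: algebra_simps)
  have "ee (- (of_nat CARD('n) * (\<tau> / 2)) - of_nat CARD('n) * y) * ee (\<Sum>k\<in>UNIV. p k) = (\<Prod>k\<in>UNIV. ee (- (\<tau> / 2) - (y - p k)))"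
    unfolding ee_sum[symmetric] ee_add[symmetric] by (simp add: sum_subtractf sum.distrib algebra_simps)
  then show ?thesis
    unfolding thprod_def * prod.distrib by (simp add: mult.assoc)
qed

lemma thprod_space: "(\<Sum>k\<in>UNIV. p k) = 0 \<Longrightarrow> theta_space \<tau> CARD('n) (thprod \<tau> (p :: 'n::finite \<Rightarrow> complex))"
  unfolding theta_space_def by (simp add: thprod_entire thprod_add_1 thprod_add_tau)

lemma simple_zeros_vtheta_shift: "simple_zeros (\<lambda>y. vtheta (y - c) \<tau>)"
proof -
  have v: "((\<lambda>z. vtheta z \<tau>) has_field_derivative deriv (\<lambda>z. vtheta z \<tau>) y) (at y)" for y
    by (rule holomorphic_derivI[OF vtheta_entire[OF \<tau>]]) auto
  have "deriv (\<lambda>y. vtheta (y - c) \<tau>) y = deriv (\<lambda>z. vtheta z \<tau>) (y - c)" for y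
    using v[of "y - c"] DERIV_shift[of "\<lambda>z. vtheta z \<tau>" _ y "- c"] by (intro DERIV_imp_deriv) simp
  then show ?thesis using vtheta_simple_zeros[OF \<tau>]
    by (auto simp: simple_zeros_def intro!: entire_compose[OF vtheta_entire[OF \<tau>]] holomorphic_intros)
qed

lemma thprod_simple_zeros:
  assumes "\<And>j k. j \<noteq> k \<Longrightarrow> p j - p k \<notin> lattice \<tau>"
  shows "simple_zeros (thprod \<tau> (p :: 'n::finite \<Rightarrow> complex))"
proof -
  have "simple_zeros (\<lambda>y. \<Prod>k\<in>A. vtheta (y - p k) \<tau>)" if "finite A" for A :: "'n set"
    using that
  proof (induction A)
    case empty
    then show ?case by (simp add: simple_zeros_def)
  next
    case (insert a A)
    have "simple_zeros (\<lambda>y. vtheta (y - p a) \<tau> * (\<Prod>k\<in>A. vtheta (y - p k) \<tau>))"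
    proof (rule simple_zeros_mult[OF simple_zeros_vtheta_shift insert(3)])
      fix y assume y: "vtheta (y - p a) \<tau> = 0"
      show "(\<Prod>k\<in>A. vtheta (y - p k) \<tau>) \<noteq> 0"
      proof
        assume "(\<Prod>k\<in>A. vtheta (y - p k) \<tau>) = 0"
        then obtain k where k: "k \<in> A" "vtheta (y - p k) \<tau> = 0" using insert(1) by auto
        then have "(y - p a) - (y - p k) \<in> lattice \<tau>"
          using y lattice_diff[of "y - p a" \<tau> "y - p k"] by (simp only: vtheta_eq_0_iff[OF \<tau>])
        moreover have "(y - p a) - (y - p k) = p k - p a" by simp
        ultimately show False using assms[of k a] insert(2) k(1) by metis
      qed
    qed
    then show ?case using insert by simp
  qed
  then show ?thesis unfolding thprod_def[abs_def] by simp
qed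

text \<open>The quotient of \<open>f\<close> by the product with these zeros has multipliers 1 and
  \<open>ee (- (\<Sum>k\<in>UNIV. p k))\<close>. If it were nonzero it would be an exponential,
  which forces the sum into the lattice.\<close>

lemma theta_space_zero:
  assumes f: "theta_space \<tau> CARD('n) f" and p: "\<And>j k. j \<noteq> k \<Longrightarrow> p j - p k \<notin> lattice \<tau>"
    and s: "(\<Sum>k\<in>UNIV. p k) \<notin> lattice \<tau>" and z: "\<And>k. f (p (k :: 'n::finite)) = 0"
  shows "f y = 0"
proof -
  have fh: "f holomorphic_on UNIV" using f by (simp add: theta_space_def)
  have "f y = 0" if y: "thprod \<tau> p y = 0" for y
  proof -
    obtain k where "vtheta (y - p k) \<tau> = 0" using y by (auto simp: thprod_def)
    then have "y - p k \<in> lattice \<tau>" by (simp add: vtheta_eq_0_iff[OF \<tau>])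
    from theta_space_lattice[OF f this, of "p k"] z show ?thesis by simp
  qed
  then obtain h where h: "h holomorphic_on UNIV" "\<And>z. f z = h z * thprod \<tau> p z"
    using entire_divide[OF fh thprod_simple_zeros[of p, OF p]] by metis
  have nz: "\<exists>z0. thprod \<tau> p z0 \<noteq> 0"
  proof (rule ccontr)
    assume "\<not> ?thesis"
    then have "thprod \<tau> p = (\<lambda>_. 0)" by auto
    then show False using thprod_simple_zeros[of p, OF p] by (auto simp: simple_zeros_def)
  qed
  then obtain z0 where nz: "thprod \<tau> p z0 \<noteq> 0" by blast
  note h_multiplier = quotient_multiplier[OF h(1) thprod_entire nz]
  have 1: "h (y + 1) = ee 0 * h y" for y
  proof (rule h_multiplier[where e = "\<lambda>_. (- 1) ^ CARD('n)"])
    show "h (y + 1) * ((- 1) ^ CARD('n) * thprod \<tau> p y) = ee 0 * (- 1) ^ CARD('n) * (h y * thprod \<tau> p y)" for y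
      using f h(2)[of "y + 1"] h(2)[of y] unfolding theta_space_def thprod_add_1 ee_0 mult_1_left by metis
  qed simp_all
  have 2: "h (y + \<tau>) = ee (- (\<Sum>k\<in>UNIV. p k)) * h y" for y
  proof (rule h_multiplier)
    let ?e = "\<lambda>y. (- 1) ^ CARD('n) * ee (- (of_nat CARD('n) * (\<tau> / 2)) - of_nat CARD('n) * y)"
    show "?e y * ee (\<Sum>k\<in>UNIV. p k) \<noteq> 0" for y by simp
    show "h (y + \<tau>) * (?e y * ee (\<Sum>k\<in>UNIV. p k) * thprod \<tau> p y) =
      ee (- (\<Sum>k\<in>UNIV. p k)) * (?e y * ee (\<Sum>k\<in>UNIV. p k)) * (h y * thprod \<tau> p y)" for y
    proof -
      have "h (y + \<tau>) * (?e y * ee (\<Sum>k\<in>UNIV. p k) * thprod \<tau> p y) = ?e y * (h y * thprod \<tau> p y)"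
        using f h(2)[of "y + \<tau>"] h(2)[of y] unfolding theta_space_def thprod_add_tau by metis
      then show ?thesis by (simp add: ee_minus field_simps)
    qed
  qed simp
  have "h y = 0"
  proof (rule ccontr)
    assume "h y \<noteq> 0"
    then obtain m :: int where "- (\<Sum>k\<in>UNIV. p k) - 0 * \<tau> - of_int m * \<tau> \<in> \<int>"
      using entire_multipliers_nonzero[OF \<tau> h(1) 1 2] by blast
    then obtain l where "- (\<Sum>k\<in>UNIV. p k) - of_int m * \<tau> = of_int l" by (auto elim: Ints_cases)
    then have "(\<Sum>k\<in>UNIV. p k) = - of_int l - of_int m * \<tau>"
      by (metis add.inverse_inverse diff_add_cancel minus_add_distrib uminus_add_conv_diff diff_minus_eq_add)
    then have "(\<Sum>k\<in>UNIV. p k) = of_int (- l) + of_int (- m) * \<tau>" by simp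
    then show False using s unfolding lattice_def by blast
  qed
  then show ?thesis using h(2) by simp
qed

text \<open>Up to a common factor the eigenvalues under translation by 1/N are distinct N-th roots
  of unity, so a discrete Fourier sum over N translates isolates the k-th term at a point where
  \<open>psi \<tau> k\<close> is nonzero.\<close>

lemma psi_independent:
  assumes "\<And>y. (\<Sum>i\<in>UNIV. w i * psi \<tau> (i :: 'n::{finite,linorder}) y) = 0"
  shows "w k = 0"
proof -
  let ?N = "of_nat CARD('n) :: complex"
  obtain z where z: "theta (of_nat (idx k) / ?N - 1/2) (?N / 2) z (?N * \<tau>) \<noteq> 0"
    using theta_not_identically_zero[OF Im_card_mult_pos[OF \<tau>]] unfolding psi_char by blast
  define y where "y = - (z / ?N)"
  have nz: "psi \<tau> k y \<noteq> 0" using z by (simp add: psi_def y_def)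
  have "0 = (\<Sum>m<CARD('n). ee (- (of_nat m * (of_nat (idx k) / ?N - 1/2))) * (\<Sum>i\<in>UNIV. w i * psi \<tau> i (y - of_nat m / ?N)))"
    using assms by simp
  also have "\<dots> = (\<Sum>m<CARD('n). \<Sum>i\<in>UNIV. w i * psi \<tau> i y * ee (of_nat m * (of_nat (idx i) / ?N - of_nat (idx k) / ?N)))"
    unfolding psi_shift sum_distrib_left
    by (intro sum.cong refl) (simp add: ee_diff ee_add ee_minus right_diff_distrib)
  also have "\<dots> = (\<Sum>i\<in>UNIV. w i * psi \<tau> i y * (if i = k then ?N else 0))"
    unfolding sum_ee_idx[symmetric] sum_distrib_left by (rule sum.swap)
  also have "\<dots> = (\<Sum>i\<in>UNIV. if i = k then w i * psi \<tau> i y * ?N else 0)" by (intro sum.cong) auto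
  also have "\<dots> = w k * psi \<tau> k y * ?N" by simp
  finally show ?thesis using nz by simp
qed

lemma lattice_of_real: "complex_of_real r \<in> lattice \<tau> \<Longrightarrow> r \<in> \<int>"
proof -
  assume "complex_of_real r \<in> lattice \<tau>"
  then obtain m n :: int where mn: "complex_of_real r = of_int m + of_int n * \<tau>" by (auto simp: lattice_def)
  from arg_cong[OF this, of Im] have "n = 0" using \<tau> by simp
  with arg_cong[OF mn, of Re] show ?thesis by simp
qed

lemma ypt_distinct: "j \<noteq> k \<Longrightarrow> ypt j - ypt (k :: 'n::{finite,linorder}) \<notin> lattice \<tau>"
proof
  assume jk: "j \<noteq> k" and l: "ypt j - ypt k \<in> lattice \<tau>"
  have "ypt j - ypt k = complex_of_real ((real (idx j) - real (idx k)) / real CARD('n))"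
    by (simp add: ypt_def field_simps)
  from lattice_of_real[OF l[unfolded this]] obtain m :: int
    where "(real (idx j) - real (idx k)) / real CARD('n) = of_int m" by (auto elim: Ints_cases)
  then have "real (idx j) - real (idx k) = of_int (int CARD('n) * m)" by (simp add: field_simps)
  then have "int (idx j) - int (idx k) = int CARD('n) * m" by linarith
  then show False using jk idx_dvd_iff[of j k] by simp
qed

lemma ypt_sum: "(\<Sum>k\<in>UNIV. ypt (k :: 'n::{finite,linorder})) \<notin> lattice \<tau>"
proof
  let ?N = "CARD('n)"
  assume l: "(\<Sum>k\<in>UNIV. ypt (k :: 'n)) \<in> lattice \<tau>"
  have "2 * (\<Sum>k=1..?N. real k) = real ?N * (real ?N + 1)"
    using double_gauss_sum_from_Suc_0[of ?N, where 'a = real] by simp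
  then have "(\<Sum>k\<in>(UNIV::'n set). real (idx k)) = real ?N * (real ?N + 1) / 2"
    using sum_idx[of real, where 'n = 'n] by simp
  then have "(\<Sum>k\<in>(UNIV::'n set). (real (idx k) + 1/4) / real ?N) = (real ?N + 1) / 2 + 1/4"
    unfolding sum_divide_distrib[symmetric] sum.distrib by (simp add: field_simps)
  moreover have "(\<Sum>k\<in>UNIV. ypt (k :: 'n)) = complex_of_real (\<Sum>k\<in>(UNIV::'n set). (real (idx k) + 1/4) / real ?N)"
    by (simp add: ypt_def)
  ultimately have "(real ?N + 1) / 2 + 1/4 \<in> \<int>" using l lattice_of_real by metis
  then obtain m :: int where "(real ?N + 1) / 2 + 1/4 = of_int m" by (auto elim: Ints_cases)
  then have "real_of_int (2 * (int ?N + 1) + 1) = real_of_int (4 * m)" by (simp add: field_simps)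
  then have "2 * (int ?N + 1) + 1 = 4 * m" by (simp only: of_int_eq_iff)
  then show False by presburger
qed

lemma Gmat_invertible: "invertible (Gmat \<tau> :: 'n::{finite,linorder} cmat)"
proof -
  have "x = 0" if x: "(Gmat \<tau> :: 'n cmat) *v x = 0" for x
  proof -
    let ?f = "\<lambda>y. \<Sum>i\<in>(UNIV::'n set). x $ i * psi \<tau> i y"
    have f: "theta_space \<tau> CARD('n) ?f" by (rule theta_space_sum) (rule psi_space[OF \<tau>])
    have z: "?f (ypt k) = 0" for k :: 'n
      using arg_cong[OF x, of "\<lambda>v. v $ k"] by (simp add: Gmat_def matrix_vector_mult_def mult.commute)
    have "?f y = 0" for y
      by (rule theta_space_zero[OF f _ ypt_sum z]) (rule ypt_distinct)
    then have "x $ i = 0" for i by (rule psi_independent)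
    then show ?thesis by (simp add: vec_eq_iff)
  qed
  then show ?thesis by (metis invertible_left_inverse matrix_left_invertible_ker)
qed

text \<open>A theta function of order \<open>N\<close> is determined by its values at the \<open>N\<close> points \<open>ypt m\<close>.\<close>

lemma theta_space_rep:
  assumes f: "theta_space \<tau> CARD('n) f"
  shows "f y = (\<Sum>i\<in>UNIV. coef \<tau> f $ i * psi \<tau> (i :: 'n::{finite,linorder}) y)"
proof -
  let ?g = "\<lambda>y. f y - (\<Sum>i\<in>(UNIV::'n set). coef \<tau> f $ i * psi \<tau> i y)"
  have g: "theta_space \<tau> CARD('n) ?g"
    by (intro theta_space_diff f theta_space_sum psi_space[OF \<tau>])
  have z: "?g (ypt k) = 0" for k :: 'n
  proof -
    have "Gmat \<tau> *v coef \<tau> f = (\<chi> m::'n. f (ypt m))"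
      unfolding coef_def matrix_vector_mul_assoc matrix_inv_right[OF Gmat_invertible] by simp
    from arg_cong[OF this, of "\<lambda>v. v $ k"] show ?thesis
      by (simp add: Gmat_def matrix_vector_mult_def mult.commute)
  qed
  have "?g y = 0" by (rule theta_space_zero[OF g _ ypt_sum z]) (rule ypt_distinct)
  then show ?thesis by simp
qed

lemma lagp_holomorphic: "(\<lambda>z. lagp u j z k) holomorphic_on A"
  by (cases "k = j") (auto simp: lagp_def intro!: holomorphic_intros)

lemma vtheta_deriv_0: "deriv (\<lambda>z. vtheta z \<tau>) 0 \<noteq> 0"
  using vtheta_simple_zeros[OF \<tau>] by (auto simp: simple_zeros_def)

lemma vtheta_diff_nonzero: "admissible \<tau> u \<Longrightarrow> j \<noteq> k \<Longrightarrow> vtheta (u $ j - u $ k) \<tau> \<noteq> 0"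
  by (simp add: admissible_def vtheta_eq_0_iff[OF \<tau>])

lemma vtheta_prod_nonzero: "admissible \<tau> u \<Longrightarrow> (\<Prod>k\<in>UNIV - {j}. vtheta (u $ j - u $ k) \<tau>) \<noteq> 0"
  using vtheta_diff_nonzero[of u j] by (subst prod_zero_iff) (simp, metis DiffD2 insertI1)

lemma thprod_lagp_space:
  "admissible \<tau> u \<Longrightarrow> theta_space \<tau> CARD('n) (thprod \<tau> (lagp u (j :: 'n::finite) z))"
  by (rule thprod_space) (simp add: lagp_def[abs_def] sum.distrib sum_subtractf admissible_def)

lemma thprod_u_space:
  "admissible \<tau> u \<Longrightarrow> theta_space \<tau> CARD('n) (thprod \<tau> (\<lambda>k::'n::finite. u $ k))"
  by (rule thprod_space) (simp add: admissible_def)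

lemma thprod_lagp:
  "thprod \<tau> (lagp u j z) (u $ k - z / of_nat CARD('n)) =
     (if j = (k::'n::finite) then - vtheta z \<tau> * (\<Prod>l\<in>UNIV - {j}. vtheta (u $ j - u $ l) \<tau>) else 0)"
proof (cases "j = k")
  case True
  have "(\<Prod>l\<in>UNIV - {j}. vtheta (u $ k - z / of_nat CARD('n) - lagp u j z l) \<tau>) = (\<Prod>l\<in>UNIV - {j}. vtheta (u $ j - u $ l) \<tau>)"
    using True by (intro prod.cong refl arg_cong2[where f = vtheta]) (auto simp: lagp_def)
  moreover have "u $ k - z / of_nat CARD('n) - lagp u j z j = - z" using True by (simp add: lagp_def)
  ultimately show ?thesis using True by (simp only: thprod_split[of _ _ _ j] vtheta_minus if_True simp_thms)
next
  case False
  then have "u $ k - z / of_nat CARD('n) - lagp u j z k = 0" by (simp add: lagp_def)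
  then show ?thesis using False by (simp add: thprod_split[of _ _ _ k])
qed

lemma Bmat_Amat:
  fixes u :: "'n::{finite,linorder} cvec"
  assumes u: "admissible \<tau> u"
  shows "Bmat \<tau> u z ** Amat \<tau> u z = mat (vtheta z \<tau>)"
proof -
  have "(Bmat \<tau> u z ** Amat \<tau> u z) $ j $ k = (if j = k then vtheta z \<tau> else 0)" for j k
  proof -
    have "(Bmat \<tau> u z ** Amat \<tau> u z) $ j $ k = deriv (\<lambda>z. vtheta z \<tau>) 0 * cc \<tau> u k *
      (\<Sum>i\<in>(UNIV :: 'n set). coef \<tau> (thprod \<tau> (lagp u j z)) $ i * psi \<tau> i (u $ k - z / of_nat CARD('n)))"
      unfolding matrix_matrix_mult_def Bmat_def Amat_def sum_distrib_left
      by (simp only: vec_lambda_beta) (intro sum.cong refl, simp add: mult_ac)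
    also have "\<dots> = deriv (\<lambda>z. vtheta z \<tau>) 0 * cc \<tau> u k * thprod \<tau> (lagp u j z) (u $ k - z / of_nat CARD('n))"
      using theta_space_rep[OF thprod_lagp_space[OF u]] by simp
    also have "\<dots> = (if j = k then vtheta z \<tau> else 0)"
      using vtheta_prod_nonzero[OF u, of j] vtheta_deriv_0 by (auto simp: thprod_lagp cc_def)
    finally show ?thesis .
  qed
  then show ?thesis by (simp add: vec_eq_iff mat_def)
qed

lemma Amat_holomorphic: "(\<lambda>z. Amat \<tau> u z $ i $ j) holomorphic_on UNIV"
  unfolding Amat_def by (simp, intro holomorphic_intros entire_compose[OF psi_entire[OF \<tau>]]) auto

lemma Bmat_holomorphic: "(\<lambda>z. Bmat \<tau> u z $ j $ i) holomorphic_on UNIV"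
  unfolding Bmat_def coef_def thprod_def matrix_vector_mult_def
  by (simp, intro holomorphic_intros entire_compose[OF vtheta_entire[OF \<tau>]] lagp_holomorphic)

lemma half_notin_lattice: "1/2 \<notin> lattice \<tau>"
proof
  assume "1/2 \<in> lattice \<tau>"
  then have "complex_of_real (1/2) \<in> lattice \<tau>" by simp
  from lattice_of_real[OF this] obtain m :: int where "1/2 = real_of_int m" by (auto elim: Ints_cases)
  then have "real_of_int 1 = real_of_int (2 * m)" by simp
  then have "1 = 2 * m" by (simp only: of_int_eq_iff)
  then show False by presburger
qed

lemma vtheta_half_nonzero: "vtheta (1/2) \<tau> \<noteq> 0"
  using half_notin_lattice by (simp add: vtheta_eq_0_iff[OF \<tau>])

lemma Amat_invertible_off:
  assumes u: "admissible \<tau> u" and z: "vtheta z \<tau> \<noteq> 0"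
  shows "Amat \<tau> u z ** mscale (inverse (vtheta z \<tau>)) (Bmat \<tau> u z) = mat 1"
proof -
  have "mscale (inverse (vtheta z \<tau>)) (Bmat \<tau> u z) ** Amat \<tau> u z = mat 1"
    using z by (simp add: mscale_mult_left Bmat_Amat[OF u] mscale_mat)
  then show ?thesis by (simp add: matrix_left_right_inverse)
qed

text \<open>Off the lattice a left inverse is a right inverse. The decisive point z = 0 is reached
  by continuation, and there the identity says A(0) B(0) = 0.\<close>

lemma Amat_Bmat:
  assumes u: "admissible \<tau> u"
  shows "Amat \<tau> u z ** Bmat \<tau> u z = mat (vtheta z \<tau>)"
proof -
  have "(Amat \<tau> u z ** Bmat \<tau> u z) $ i $ k = mat (vtheta z \<tau>) $ i $ k" for i k
  proof (rule entire_eqI[OF _ _ vtheta_entire[OF \<tau>] vtheta_half_nonzero, of "\<lambda>z. (Amat \<tau> u z ** Bmat \<tau> u z) $ i $ k"])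
    show "(\<lambda>z. (Amat \<tau> u z ** Bmat \<tau> u z) $ i $ k) holomorphic_on UNIV"
      unfolding matrix_matrix_mult_def by (simp, intro holomorphic_intros Amat_holomorphic Bmat_holomorphic)
    show "(\<lambda>z. mat (vtheta z \<tau>) $ i $ k) holomorphic_on UNIV"
      by (cases "i = k") (simp_all add: mat_def vtheta_entire[OF \<tau>])
    fix z assume z: "vtheta z \<tau> \<noteq> 0"
    have "Amat \<tau> u z ** Bmat \<tau> u z = mscale (vtheta z \<tau>) (Amat \<tau> u z ** mscale (inverse (vtheta z \<tau>)) (Bmat \<tau> u z))"
      using z by (simp add: mscale_mult_right mscale_mscale mscale_1)
    also have "\<dots> = mat (vtheta z \<tau>)" using Amat_invertible_off[OF u z] by (simp add: mscale_mat)
    finally show "(Amat \<tau> u z ** Bmat \<tau> u z) $ i $ k = mat (vtheta z \<tau>) $ i $ k" by simp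
  qed
  then show ?thesis by (simp add: vec_eq_iff)
qed

text \<open>At z = 0 the displacement in \<open>lagp\<close> disappears, so all rows of B coincide.
  Together with A(0) B(0) = 0 this yields the kernel vector of A(0), and later the rank one part of
  the residue.\<close>

lemma Bmat_0: "Bmat \<tau> u 0 $ j $ i = deriv (\<lambda>z. vtheta z \<tau>) 0 * wvec \<tau> u $ i"
  by (simp add: Bmat_def wvec_def lagp_def[abs_def])

lemma wvec_rep: "admissible \<tau> u \<Longrightarrow> thprod \<tau> (\<lambda>k. u $ k) y = (\<Sum>i\<in>UNIV. wvec \<tau> u $ i * psi \<tau> i y)"
  unfolding wvec_def by (rule theta_space_rep[OF thprod_u_space])

lemma wvec_nonzero:
  assumes u: "admissible \<tau> u"
  shows "wvec \<tau> u \<noteq> 0"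
proof
  assume "wvec \<tau> u = 0"
  then have "thprod \<tau> (\<lambda>k. u $ k) y = 0" for y by (simp add: wvec_rep[OF u])
  then have "thprod \<tau> (\<lambda>k. u $ k) = (\<lambda>_. 0)" by auto
  moreover have "simple_zeros (thprod \<tau> (\<lambda>k. u $ k))"
    by (rule thprod_simple_zeros) (use u in \<open>auto simp: admissible_def\<close>)
  ultimately show False by (auto simp: simple_zeros_def)
qed

lemma Amat_0_row_sum:
  assumes u: "admissible \<tau> u"
  shows "(\<Sum>j\<in>UNIV. Amat \<tau> u 0 $ i $ j) = 0"
proof -
  obtain k where k: "wvec \<tau> u $ k \<noteq> 0" using wvec_nonzero[OF u] by (auto simp: vec_eq_iff)
  have "(Amat \<tau> u 0 ** Bmat \<tau> u 0) $ i $ k = 0" by (simp add: Amat_Bmat[OF u] mat_def)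
  then have "(\<Sum>j\<in>UNIV. Amat \<tau> u 0 $ i $ j) * (deriv (\<lambda>z. vtheta z \<tau>) 0 * wvec \<tau> u $ k) = 0"
    by (simp add: matrix_matrix_mult_def Bmat_0 sum_distrib_right)
  then show ?thesis using k vtheta_deriv_0 by simp
qed

text \<open>This is the left kernel of A(0): the product whose coefficients are \<open>wvec\<close>
  vanishes at every column point.\<close>

lemma wvec_kernel:
  assumes u: "admissible \<tau> u"
  shows "(\<Sum>i\<in>UNIV. wvec \<tau> u $ i * psi \<tau> i (u $ j)) = 0"
  unfolding wvec_rep[OF u, symmetric] by (simp add: thprod_split[of _ _ _ j])

section \<open>The prescribed normalization of the gauge matrix\<close>

lemma Xi_eq_Amat:
  fixes u :: "'n::{finite,linorder} cvec"
  assumes u: "admissible \<tau> u"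
  obtains c where "c \<noteq> 0" "\<And>z. Xi \<tau> u z = mscale c (Amat \<tau> u z)"
proof
  let ?v = "\<lambda>j k. vtheta (u $ k - u $ j) \<tau>"
  let ?V = "\<Prod>(j, k)\<in>{(j, k). j < k}. ?v j k"
  let ?c = "- deriv (\<lambda>z. vtheta z \<tau>) 0 * (- 1) ^ CARD('n) * ?V"
  have "?V \<noteq> 0" using vtheta_diff_nonzero[OF u] by (subst prod_zero_iff) (auto dest: less_imp_neq)
  then show "?c \<noteq> 0" using vtheta_deriv_0 by simp
  have chi: "(- 1) ^ idx l * (\<Prod>(j, k)\<in>{(j, k). j < k \<and> j \<noteq> l \<and> k \<noteq> l}. ?v j k) = ?c * cc \<tau> u l" for l
  proof -
    \<comment> \<open>Pairs are split according to whether they contain \<open>l\<close>. Reversing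
      the differences for the pairs (l, k) with l < k costs (-1)^(N - idx l), which the factor
      (-1)^N of the constant turns into the prescribed sign. The constant itself cancels in the
      conjugation.\<close>
    have S: "{(j, k). j < k} = {(j, k). j < k \<and> j \<noteq> l \<and> k \<noteq> l} \<union> ((\<lambda>j. (j, l)) ` {..<l} \<union> Pair l ` {l<..})"
      by auto
    have "?V = (\<Prod>(j, k)\<in>{(j, k). j < k \<and> j \<noteq> l \<and> k \<noteq> l}. ?v j k) *
       ((\<Prod>(j, k)\<in>(\<lambda>j. (j, l)) ` {..<l}. ?v j k) * (\<Prod>(j, k)\<in>Pair l ` {l<..}. ?v j k))"
      unfolding S by (subst prod.union_disjoint, (auto)[3], subst prod.union_disjoint) auto
    also have "(\<Prod>(j, k)\<in>(\<lambda>j. (j, l)) ` {..<l}. ?v j k) = (\<Prod>j\<in>{..<l}. ?v j l)"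
      by (subst prod.reindex) (auto simp: inj_on_def)
    also have "(\<Prod>(j, k)\<in>Pair l ` {l<..}. ?v j k) = (\<Prod>k\<in>{l<..}. ?v l k)"
      by (subst prod.reindex) (auto simp: inj_on_def)
    also have "(\<Prod>k\<in>{l<..}. ?v l k) = (\<Prod>k\<in>{l<..}. - 1 * ?v k l)"
      by (intro prod.cong refl) (metis minus_diff_eq mult_minus1 vtheta_minus)
    also have "\<dots> = (- 1) ^ card {l<..} * (\<Prod>k\<in>{l<..}. ?v k l)"
      by (simp only: prod.distrib prod_constant)
    finally have V: "?V = (\<Prod>(j, k)\<in>{(j, k). j < k \<and> j \<noteq> l \<and> k \<noteq> l}. ?v j k) *
       ((- 1) ^ card {l<..} * ((\<Prod>k\<in>{..<l}. ?v k l) * (\<Prod>k\<in>{l<..}. ?v k l)))" by (simp only: mult_ac)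
    have split: "UNIV - {l} = {..<l} \<union> {l<..}" by auto
    have P: "(\<Prod>k\<in>UNIV - {l}. ?v k l) = (\<Prod>k\<in>{..<l}. ?v k l) * (\<Prod>k\<in>{l<..}. ?v k l)"
      unfolding split by (rule prod.union_disjoint) auto
    have "UNIV = {..l} \<union> {l<..}" by auto
    then have "CARD('n) = idx l + card {l<..}"
      unfolding idx_def by (metis card_Un_disjoint finite greaterThan_iff atMost_iff disjoint_iff linorder_not_less)
    then have sgn: "(- 1) ^ CARD('n) * (- 1) ^ card {l<..} = ((- 1) ^ idx l :: complex)"
      by (simp add: power_add power_mult_distrib[symmetric])
    have "?c * cc \<tau> u l = (- 1) ^ CARD('n) * ?V / (\<Prod>k\<in>UNIV - {l}. ?v k l)"
      using vtheta_deriv_0 by (simp add: cc_def)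
    also have "\<dots> = ((- 1) ^ CARD('n) * (- 1) ^ card {l<..}) * (\<Prod>(j, k)\<in>{(j, k). j < k \<and> j \<noteq> l \<and> k \<noteq> l}. ?v j k)"
      unfolding V P[symmetric] using vtheta_prod_nonzero[OF u, of l] by simp
    finally show ?thesis unfolding sgn by simp
  qed
  have mul: "(M ** diag d) $ i $ j = M $ i $ j * d j" for M :: "'n cmat" and d i j
    by (simp add: matrix_matrix_mult_def diag_def if_distrib[where f = "\<lambda>x. _ * x"] cong: if_cong)
  show "Xi \<tau> u z = mscale ?c (Amat \<tau> u z)" for z
    unfolding Xi_def vec_eq_iff mul chi
    by (simp add: Xi_tilde_nth mscale_def Amat_def mult_ac)
qed

lemma Xi_singular:
  fixes u :: "'n::{finite,linorder} cvec"
  assumes u: "admissible \<tau> u"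
  shows "\<not> invertible (Xi \<tau> u 0)"
proof
  obtain c where c: "c \<noteq> 0" "\<And>z. Xi \<tau> u z = mscale c (Amat \<tau> u z)" using Xi_eq_Amat[OF u] by blast
  assume "invertible (Xi \<tau> u 0)"
  then have inv: "invertible (Amat \<tau> u 0)" by (simp add: c invertible_mscale)
  have "Amat \<tau> u 0 *v 1 = 0"
    using Amat_0_row_sum[OF u] by (simp add: matrix_vector_mult_def vec_eq_iff)
  then have "1 = (0 :: complex ^ 'n::{finite,linorder})"
    using inv by (metis invertible_left_inverse matrix_left_invertible_ker)
  then show False by (simp add: vec_eq_iff)
qed

lemma Xi_invertible:
  assumes u: "admissible \<tau> u" and z: "z \<notin> lattice \<tau>"
  shows "invertible (Xi \<tau> u z)"
proof -
  obtain c where c: "c \<noteq> 0" "\<And>z. Xi \<tau> u z = mscale c (Amat \<tau> u z)" using Xi_eq_Amat[OF u] by blast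
  have "invertible (Amat \<tau> u z)"
    using Amat_invertible_off[OF u] z invertible_right_inverse by (auto simp: vtheta_eq_0_iff[OF \<tau>])
  then show ?thesis by (simp add: c invertible_mscale)
qed

lemma Xi_conjugate:
  assumes u: "admissible \<tau> u" and z: "z \<notin> lattice \<tau>"
  shows "Xi \<tau> u z ** L ** matrix_inv (Xi \<tau> u z) = mscale (inverse (vtheta z \<tau>)) (Amat \<tau> u z ** L ** Bmat \<tau> u z)"
proof -
  obtain c where c: "c \<noteq> 0" "\<And>z. Xi \<tau> u z = mscale c (Amat \<tau> u z)" using Xi_eq_Amat[OF u] by blast
  let ?B = "mscale (inverse (vtheta z \<tau>)) (Bmat \<tau> u z)"
  have "mscale c (Amat \<tau> u z) ** mscale (inverse c) ?B = Amat \<tau> u z ** ?B"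
    using c(1) by (simp add: mscale_mult_left mscale_mult_right mscale_mscale mscale_1 field_simps)
  then have "matrix_inv (Xi \<tau> u z) = mscale (inverse c) ?B"
    unfolding c(2) using Amat_invertible_off[OF u] z
    by (intro matrix_inv_unique) (auto simp: vtheta_eq_0_iff[OF \<tau>])
  then show ?thesis
    using c(1) by (simp add: c(2) mscale_mult_left mscale_mult_right mscale_mscale mscale_1 field_simps)
qed

end

section \<open>The basis \<open>E_mat\<close>\<close>

definition nxt :: "'n::{finite,linorder} \<Rightarrow> 'n" where
  "nxt i = inv_into UNIV idx (idx i mod CARD('n) + 1)"

lemma idx_nxt: "idx (nxt i) = idx (i :: 'n::{finite,linorder}) mod CARD('n) + 1"
proof -
  have "idx i mod CARD('n) + 1 \<in> {1..CARD('n)}" by (auto simp: Suc_le_eq)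
  then have "idx i mod CARD('n) + 1 \<in> range (idx :: 'n \<Rightarrow> nat)"
    using idx_bij[where 'n = 'n] by (simp add: bij_betw_def)
  then show ?thesis unfolding nxt_def by (rule f_inv_into_f)
qed

lemma idx_nxt_cong: "int CARD('n) dvd int (idx (nxt i)) - int (idx (i :: 'n::{finite,linorder})) - 1"
  by (simp add: idx_nxt zmod_int dvd_diff_commute[of _ "_ mod _"] flip: mod_eq_dvd_iff)

lemma idx_shift_unique:
  fixes i :: "'n::{finite,linorder}"
  shows "\<exists>!j :: 'n. int CARD('n) dvd int (idx j) - int (idx i) - n"
proof -
  let ?r = "nat ((int (idx i) + n - 1) mod int CARD('n)) + 1"
  have "(int (idx i) + n - 1) mod int CARD('n) < int CARD('n)" by simp
  then have "?r \<in> {1..CARD('n)}" by (simp add: nat_less_iff Suc_le_eq)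
  then obtain j :: 'n where j: "idx j = ?r" using idx_bij[where 'n = 'n] by (metis bij_betw_imp_surj_on imageE)
  have "int (idx j) - int (idx i) - n = (int (idx i) + n - 1) mod int CARD('n) - (int (idx i) + n - 1)"
    unfolding j by simp
  then have 1: "int CARD('n) dvd int (idx j) - int (idx i) - n"
    by (metis dvd_minus_mod dvd_diff_commute)
  show ?thesis
  proof (rule ex1I[where a = j])
    show "int CARD('n) dvd int (idx j) - int (idx i) - n" by (rule 1)
    fix k :: 'n assume "int CARD('n) dvd int (idx k) - int (idx i) - n"
    from dvd_diff[OF this 1] show "k = j" by (simp add: idx_dvd_iff)
  qed
qed

text \<open>Entries of the n-th power of \<open>Lam\<close>, encoded as a congruence modulo N so
  that powers compose by adding congruences.\<close>

definition cyc :: "nat \<Rightarrow> 'n::{finite,linorder} \<Rightarrow> 'n \<Rightarrow> complex" where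
  "cyc n i j = (if int CARD('n) dvd int (idx j) - int (idx i) - int n then 1 else 0)"

lemma sum_cyc: "cyc n i b = 1 \<Longrightarrow> (\<Sum>j\<in>UNIV. cyc n i j * f j) = f b"
proof -
  assume b: "cyc n i b = 1"
  have "cyc n i j = (if j = b then 1 else 0)" for j
    using b idx_shift_unique[of i "int n"] by (auto simp: cyc_def split: if_splits)
  then have "cyc n i j * f j = (if j = b then f j else 0)" for j by simp
  then show ?thesis by simp
qed

lemma cyc_exists: obtains b where "cyc n (i :: 'n::{finite,linorder}) b = 1"
proof -
  obtain b :: 'n where "int CARD('n) dvd int (idx b) - int (idx i) - int n" using idx_shift_unique[of i "int n"] by blast
  then show ?thesis by (intro that[of b]) (simp add: cyc_def)
qed

lemma mpow_Q: "mpow (Qmat :: 'n::{finite,linorder} cmat) m = diag (\<lambda>i. ee (of_nat m * of_nat (idx i) / of_nat CARD('n)))"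
proof (induction m)
  case 0
  then show ?case by (simp add: mpow_def mat_def diag_def)
next
  case (Suc m)
  have "mpow (Qmat :: 'n cmat) (Suc m) = Qmat ** mpow Qmat m" by (simp add: mpow_def)
  also have "\<dots> = diag (\<lambda>i. ee (of_nat (idx i) / of_nat CARD('n)) * ee (of_nat m * of_nat (idx i) / of_nat CARD('n)))"
    unfolding Suc by (simp add: Qmat_def diag_def matrix_matrix_mult_def vec_eq_iff if_distrib[where f = "\<lambda>x. x * _"] cong: if_cong)
  finally show ?case by (simp add: ee_add[symmetric] add_divide_distrib ring_distribs)
qed

lemma Lam_cyc: "Lam $ i $ j = cyc 1 i j"
proof -
  have "int CARD('a) dvd int (idx j) - int (idx i) - 1 \<longleftrightarrow> j = nxt i"
    using idx_shift_unique[of i 1] idx_nxt_cong[of i] by blast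
  moreover have "idx j = idx i mod CARD('a) + 1 \<longleftrightarrow> j = nxt i"
    using idx_nxt[of i] idx_inj by metis
  ultimately show ?thesis by (simp add: Lam_def cyc_def)
qed

lemma mpow_Lam: "mpow Lam n $ i $ j = cyc n i (j :: 'n::{finite,linorder})"
proof (induction n arbitrary: i)
  case 0
  have "int CARD('n) dvd int (idx j) - int (idx i) \<longleftrightarrow> i = j" by (simp add: idx_dvd_iff eq_commute)
  then show ?case by (simp add: mpow_def mat_def cyc_def)
next
  case (Suc n)
  obtain b where b: "cyc 1 i b = 1" by (rule cyc_exists)
  have "mpow Lam (Suc n) $ i $ j = (\<Sum>k\<in>UNIV. cyc 1 i k * cyc n k j)"
    by (simp add: mpow_def[of _ "Suc n"] matrix_matrix_mult_def Lam_cyc Suc mpow_def[of _ n, symmetric])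
  also have "\<dots> = cyc n b j" by (rule sum_cyc[OF b])
  also have "\<dots> = cyc (Suc n) i j"
  proof -
    have "int CARD('n) dvd int (idx b) - int (idx i) - 1" using b by (auto simp: cyc_def split: if_splits)
    moreover have "int (idx j) - int (idx i) - int (Suc n) = (int (idx j) - int (idx b) - int n) + (int (idx b) - int (idx i) - 1)"
      by simp
    ultimately show ?thesis unfolding cyc_def using dvd_add_left_iff by metis
  qed
  finally show ?case .
qed

lemma E_mat_nth: "E_mat m n $ i $ j = ee (of_nat (m * n) / (2 * of_nat CARD('n))) *
    (ee (of_nat m * of_nat (idx i) / of_nat CARD('n)) * cyc n i (j :: 'n::{finite,linorder}))"
  by (simp add: E_mat_def mscale_def matrix_matrix_mult_def mpow_Q mpow_Lam diag_def
     if_distrib[where f = "\<lambda>x. x * _"] cong: if_cong)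

text \<open>The trace of \<open>X\<close> against the inverse of \<open>E_mat m n\<close>, divided
  by N: the functional dual to the basis. Being an explicit sum it can be differentiated and
  continued in parameters.\<close>

definition E_coef :: "nat \<Rightarrow> nat \<Rightarrow> 'n::{finite,linorder} cmat \<Rightarrow> complex" where
  "E_coef m n X = ee (- (of_nat (m * n) / (2 * of_nat CARD('n)))) / of_nat CARD('n) *
     (\<Sum>i\<in>UNIV. \<Sum>j\<in>UNIV. ee (- (of_nat m * of_nat (idx i) / of_nat CARD('n))) * (cyc n i j * X $ i $ j))"

lemma E_coef_sum: "E_coef m n (\<Sum>x\<in>A. X x) = (\<Sum>x\<in>A. E_coef m n (X x))"
  by (induction A rule: infinite_finite_induct)
    (auto simp: E_coef_def ring_distribs sum.distrib)

lemma E_coef_mscale: "E_coef m n (mscale c X) = c * E_coef m n X"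
  by (simp add: E_coef_def mscale_def sum_distrib_left mult_ac)

lemma sum_ee_idx_all:
  "(\<Sum>i\<in>(UNIV::'n::{finite,linorder} set). ee (of_int j * of_nat (idx i) / of_nat CARD('n))) =
     (if int CARD('n) dvd j then of_nat CARD('n) else 0)"
proof -
  let ?f = "\<lambda>k. ee (of_int j * of_nat k / of_nat CARD('n))"
  have "(\<Sum>i\<in>(UNIV::'n set). ?f (idx i)) = (\<Sum>k=1..CARD('n). ?f k)" by (rule sum_idx)
  also have "\<dots> = (\<Sum>k<CARD('n). ?f (Suc k))"
    by (rule sum.reindex_bij_witness[of _ Suc "\<lambda>k. k - 1"]) auto
  also have "\<dots> = (\<Sum>k<CARD('n). ?f k)"
    using sum.lessThan_Suc_shift[of ?f "CARD('n)"] sum.lessThan_Suc[of ?f "CARD('n)"] by simp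
  finally show ?thesis using sum_ee_roots[of "CARD('n)" j] by simp
qed

lemma dvd_small_diff: "m < N \<Longrightarrow> m' < N \<Longrightarrow> int N dvd int m - int m' \<longleftrightarrow> m = m'"
  by (metis mod_eq_dvd_iff mod_less of_nat_eq_iff zmod_int)

lemma E_coef_E_mat:
  assumes "m < CARD('n)" "n < CARD('n)" "m' < CARD('n)" "n' < CARD('n)"
  shows "E_coef m n (E_mat m' n' :: 'n::{finite,linorder} cmat) = (if m = m' \<and> n = n' then 1 else 0)"
proof (cases "n = n'")
  case False
  have "cyc n i j * cyc n' i j = 0" for i j :: 'n
  proof -
    have "\<not> int CARD('n) dvd int n - int n'" using False assms by (simp add: dvd_small_diff)
    then have "\<not> (int CARD('n) dvd int (idx j) - int (idx i) - int n \<and> int CARD('n) dvd int (idx j) - int (idx i) - int n')"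
      using dvd_diff[of "int CARD('n)" "int (idx j) - int (idx i) - int n'" "int (idx j) - int (idx i) - int n"] by auto
    then show ?thesis by (auto simp: cyc_def)
  qed
  then have "cyc n i j * (E_mat m' n' :: 'n cmat) $ i $ j = 0" for i j :: 'n
    unfolding E_mat_nth by (metis mult.commute mult.left_commute mult_zero_right)
  then show ?thesis using False by (simp only: E_coef_def mult_zero_right sum.neutral_const) simp
next
  case True
  let ?N = "of_nat CARD('n) :: complex"
  have "(\<Sum>i\<in>UNIV. \<Sum>j\<in>UNIV. ee (- (of_nat m * of_nat (idx i) / ?N)) * (cyc n i j * (E_mat m' n' :: 'n cmat) $ i $ j)) =
     (\<Sum>i\<in>(UNIV :: 'n set). ee (of_nat (m' * n') / (2 * ?N)) * ee (of_int (int m' - int m) * of_nat (idx i) / ?N))"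
  proof (rule sum.cong[OF refl])
    fix i :: 'n
    obtain b where b: "cyc n i b = 1" by (rule cyc_exists)
    have "(\<Sum>j\<in>UNIV. ee (- (of_nat m * of_nat (idx i) / ?N)) * (cyc n i j * (E_mat m' n' :: 'n cmat) $ i $ j)) =
       ee (- (of_nat m * of_nat (idx i) / ?N)) * (E_mat m' n' :: 'n cmat) $ i $ b"
      unfolding sum_distrib_left[symmetric] sum_cyc[OF b] ..
    also have "\<dots> = ee (of_nat (m' * n') / (2 * ?N)) * (ee (- (of_nat m * of_nat (idx i) / ?N)) * ee (of_nat m' * of_nat (idx i) / ?N))"
      using b True by (simp add: E_mat_nth mult_ac)
    also have "ee (- (of_nat m * of_nat (idx i) / ?N)) * ee (of_nat m' * of_nat (idx i) / ?N) = ee (of_int (int m' - int m) * of_nat (idx i) / ?N)"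
      unfolding ee_add[symmetric] by (rule arg_cong[where f = ee]) (simp add: diff_divide_distrib left_diff_distrib)
    finally show "(\<Sum>j\<in>UNIV. ee (- (of_nat m * of_nat (idx i) / ?N)) * (cyc n i j * (E_mat m' n' :: 'n cmat) $ i $ j)) =
      ee (of_nat (m' * n') / (2 * ?N)) * ee (of_int (int m' - int m) * of_nat (idx i) / ?N)" .
  qed
  also have "\<dots> = ee (of_nat (m' * n') / (2 * ?N)) * (if m = m' then ?N else 0)"
    unfolding sum_distrib_left[symmetric] sum_ee_idx_all using assms by (simp add: dvd_small_diff eq_commute)
  finally show ?thesis using True by (auto simp: E_coef_def ee_minus)
qed

lemma sum_ee_idx_diff:
  "(\<Sum>m<CARD('n). ee (of_nat m * of_nat (idx a) / of_nat CARD('n)) * ee (- (of_nat m * of_nat (idx (i :: 'n::{finite,linorder})) / of_nat CARD('n)))) =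
     (if i = a then of_nat CARD('n) else 0)"
proof -
  have "ee (of_nat m * of_nat (idx a) / of_nat CARD('n)) * ee (- (of_nat m * of_nat (idx i) / of_nat CARD('n))) =
     ee (of_nat m * (of_nat (idx a) / of_nat CARD('n) - of_nat (idx i) / of_nat CARD('n)))" for m
    unfolding ee_add[symmetric] by (simp add: right_diff_distrib)
  then show ?thesis using sum_ee_idx[of a i] by (simp add: eq_commute)
qed

text \<open>The index \<open>n\<close> selects a cyclic diagonal and \<open>m\<close> a frequency
  along it, so this is discrete Fourier inversion on each diagonal.\<close>

lemma E_expand: "X = (\<Sum>(m, n)\<in>{0..<CARD('n)} \<times> {0..<CARD('n)}. mscale (E_coef m n X) (E_mat m n :: 'n::{finite,linorder} cmat))"
proof -
  let ?N = "of_nat CARD('n) :: complex"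
  have "(\<Sum>(m, n)\<in>{0..<CARD('n)} \<times> {0..<CARD('n)}. mscale (E_coef m n X) (E_mat m n :: 'n cmat)) $ a $ b = X $ a $ b" for a b
  proof -
    define n0 where "n0 = nat ((int (idx b) - int (idx a)) mod int CARD('n))"
    have n0: "n0 < CARD('n)" by (simp add: n0_def nat_less_iff)
    have c: "cyc n a b = (if n = n0 then 1 else 0)" if "n < CARD('n)" for n
    proof -
      have "int CARD('n) dvd int (idx b) - int (idx a) - int n \<longleftrightarrow> n = n0"
        using that by (auto simp: n0_def mod_eq_dvd_iff[symmetric])
      then show ?thesis by (simp add: cyc_def)
    qed
    then have b: "cyc n0 a b = 1" using n0 by simp
    have "(\<Sum>(m, n)\<in>{0..<CARD('n)} \<times> {0..<CARD('n)}. mscale (E_coef m n X) (E_mat m n :: 'n cmat)) $ a $ b =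
      (\<Sum>m<CARD('n). \<Sum>n<CARD('n). if n = n0 then E_coef m n X * (E_mat m n :: 'n cmat) $ a $ b else 0)"
      unfolding sum.cartesian_product lessThan_atLeast0
      by (simp add: mscale_def split_def) (intro sum.cong refl, auto simp: E_mat_nth c)
    also have "\<dots> = (\<Sum>m<CARD('n). E_coef m n0 X * (E_mat m n0 :: 'n cmat) $ a $ b)"
      using n0 by (intro sum.cong refl) simp
    also have "\<dots> = (\<Sum>m<CARD('n). \<Sum>i\<in>UNIV. (\<Sum>j\<in>UNIV. cyc n0 i j * X $ i $ j) / ?N *
        (ee (of_nat m * of_nat (idx a) / ?N) * ee (- (of_nat m * of_nat (idx i) / ?N))))"
      unfolding E_coef_def E_mat_nth b sum_distrib_left[symmetric]
      by (intro sum.cong refl) (simp add: ee_minus sum_distrib_left sum_distrib_right sum_divide_distrib mult_ac)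
    also have "\<dots> = (\<Sum>i\<in>UNIV. (\<Sum>j\<in>UNIV. cyc n0 i j * X $ i $ j) / ?N * (if i = a then ?N else 0))"
      unfolding sum_ee_idx_diff[symmetric] sum_distrib_left by (rule sum.swap)
    also have "\<dots> = (\<Sum>i\<in>UNIV. if i = a then (\<Sum>j\<in>UNIV. cyc n0 i j * X $ i $ j) else 0)"
      by (intro sum.cong refl) simp
    also have "\<dots> = X $ a $ b" by (simp add: sum_cyc[OF b])
    finally show ?thesis .
  qed
  then show ?thesis by (simp add: vec_eq_iff)
qed

lemma E_coef_eqI:
  assumes "\<And>m n. m < CARD('n) \<Longrightarrow> n < CARD('n) \<Longrightarrow> E_coef m n X = E_coef m n (Y :: 'n::{finite,linorder} cmat)"
  shows "X = Y"
  by (subst E_expand[of X], subst E_expand[of Y], rule sum.cong) (auto simp: assms)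

lemma E_coef_0_0: "E_coef 0 0 (X :: 'n::{finite,linorder} cmat) = trace X / of_nat CARD('n)"
proof -
  have "cyc 0 i i = 1" for i :: 'n by (simp add: cyc_def)
  then have "(\<Sum>j\<in>UNIV. cyc 0 i j * X $ i $ j) = X $ i $ i" for i by (rule sum_cyc)
  then show ?thesis by (simp add: E_coef_def trace_def)
qed

lemma E_coef_index_sum:
  assumes "m < CARD('n)" "n < CARD('n)"
  shows "E_coef m n (\<Sum>(k, l)\<in>E_index CARD('n). mscale (s (k, l)) (E_mat k l :: 'n::{finite,linorder} cmat)) =
    (if (m, n) = (0, 0) then 0 else s (m, n))"
proof -
  have "E_coef m n (\<Sum>(k, l)\<in>E_index CARD('n). mscale (s (k, l)) (E_mat k l :: 'n cmat)) =
    (\<Sum>x\<in>E_index CARD('n). if x = (m, n) then s x else 0)"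
    unfolding E_coef_sum split_def E_coef_mscale using assms
    by (intro sum.cong refl) (auto simp: E_index_def E_coef_E_mat split: if_splits)
  also have "\<dots> = (if (m, n) = (0, 0) then 0 else s (m, n))"
    using assms by (subst sum.delta) (auto simp: E_index_def)
  finally show ?thesis .
qed

text \<open>The choice in \<open>E_coords\<close> has a witness because the coefficient of index (0,
  0) is trace S / N = 0. Duality then pins every chosen value on the index set.\<close>

lemma E_coords_eq:
  assumes tr: "trace S = 0" and mn: "(m, n) \<in> E_index CARD('n)"
  shows "E_coords S (m, n) = E_coef m n (S :: 'n::{finite,linorder} cmat)"
proof -
  let ?P = "\<lambda>s. S = (\<Sum>(m, n)\<in>E_index CARD('n). mscale (s (m, n)) (E_mat m n))"
  define s where "s = (\<lambda>(m, n). E_coef m n S)"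
  have "?P s"
  proof (rule E_coef_eqI)
    fix k l assume "k < CARD('n)" "l < CARD('n)"
    then have "E_coef k l (\<Sum>(m, n)\<in>E_index CARD('n). mscale (s (m, n)) (E_mat m n :: 'n cmat)) = (if (k, l) = (0, 0) then 0 else s (k, l))"
      by (rule E_coef_index_sum)
    then show "E_coef k l S = E_coef k l (\<Sum>(m, n)\<in>E_index CARD('n). mscale (s (m, n)) (E_mat m n :: 'n cmat))"
      using tr by (simp only:) (auto simp: E_coef_0_0 s_def)
  qed
  then have "?P (E_coords S)" unfolding E_coords_def by (rule someI[of ?P])
  from arg_cong[OF this, of "E_coef m n"] show ?thesis
    using mn by (subst (asm) E_coef_index_sum) (auto simp: E_index_def)
qed

lemma L_rot_coef:
  assumes tr: "trace S = 0" and "m < CARD('n)" "n < CARD('n)"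
  shows "E_coef m n (L_rot \<tau> (S :: 'n::{finite,linorder} cmat) z) =
    (if (m, n) = (0, 0) then 0 else E_coef m n S * ee (- (of_nat n * z / of_nat CARD('n)))
               * phi \<tau> (- ((of_nat m + of_nat n * \<tau>) / of_nat CARD('n))) z)"
proof -
  have "E_coef m n (L_rot \<tau> S z) = (if (m, n) = (0, 0) then 0 else E_coords S (m, n) * ee (- (of_nat n * z / of_nat CARD('n)))
               * phi \<tau> (- ((of_nat m + of_nat n * \<tau>) / of_nat CARD('n))) z)"
    unfolding L_rot_def
    using E_coef_index_sum[OF assms(2,3), of "\<lambda>(m, n). E_coords S (m, n) * ee (- (of_nat n * z / of_nat CARD('n)))
               * phi \<tau> (- ((of_nat m + of_nat n * \<tau>) / of_nat CARD('n))) z"] by simp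
  moreover have "(m, n) \<noteq> (0, 0) \<Longrightarrow> E_coords S (m, n) = E_coef m n S"
    using assms by (intro E_coords_eq) (auto simp: E_index_def)
  ultimately show ?thesis by simp
qed

text \<open>Each \<open>E_mat m n\<close> is an eigenvector of conjugation by \<open>Qmat\<close>,
  because on the cyclic diagonal \<open>n\<close> the difference of positions is constant modulo
  N.\<close>

lemma E_coef_diag_conj:
  "E_coef m n (\<chi> i j. ee ((of_nat (idx i) - of_nat (idx j)) / of_nat CARD('n)) * M $ i $ j) =
     ee (- (of_nat n / of_nat CARD('n))) * E_coef m n (M :: 'n::{finite,linorder} cmat)"
proof -
  have "cyc n i j * ee ((of_nat (idx i) - of_nat (idx j)) / of_nat CARD('n)) = cyc n i j * ee (- (of_nat n / of_nat CARD('n)))" for i j :: 'n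
  proof (cases "int CARD('n) dvd int (idx j) - int (idx i) - int n")
    case True
    then obtain k where k: "int (idx j) - int (idx i) - int n = int CARD('n) * k" by auto
    then have "of_int (int (idx i) - int (idx j)) = (of_int (- int n - int CARD('n) * k) :: complex)" by (simp only: of_int_eq_iff)
    then have "(of_nat (idx i) - of_nat (idx j)) / of_nat CARD('n) = - (of_nat n / of_nat CARD('n)) - (of_int k :: complex)"
      by (simp add: field_simps)
    then show ?thesis by (simp add: ee_diff)
  qed (simp add: cyc_def)
  then have "cyc n i j * (ee ((of_nat (idx i) - of_nat (idx j)) / of_nat CARD('n)) * c) =
      ee (- (of_nat n / of_nat CARD('n))) * (cyc n i j * c)" for c and i j :: 'n
    by (simp only: mult.assoc[symmetric]) (simp only: mult.commute)
  then have "ee x * (cyc n i j * (ee ((of_nat (idx i) - of_nat (idx j)) / of_nat CARD('n)) * c)) =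
      ee (- (of_nat n / of_nat CARD('n))) * (ee x * (cyc n i j * c))" for c x and i j :: 'n
    by (simp only: mult.left_commute)
  then have "(\<Sum>i\<in>UNIV. \<Sum>j\<in>UNIV. ee (- (of_nat m * of_nat (idx i) / of_nat CARD('n))) *
      (cyc n i j * (ee ((of_nat (idx i) - of_nat (idx j)) / of_nat CARD('n)) * M $ i $ j))) =
    ee (- (of_nat n / of_nat CARD('n))) * (\<Sum>i\<in>UNIV. \<Sum>j\<in>UNIV. ee (- (of_nat m * of_nat (idx i) / of_nat CARD('n))) * (cyc n i j * M $ i $ j))"
    by (simp only: sum_distrib_left)
  then show ?thesis by (simp add: E_coef_def)
qed

lemma nxt_bij: "bij (nxt :: 'n::{finite,linorder} \<Rightarrow> 'n)"
proof -
  have "inj (nxt :: 'n \<Rightarrow> 'n)"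
  proof (rule injI)
    fix i j :: 'n assume e: "nxt i = nxt j"
    have "int CARD('n) dvd (int (idx (nxt i)) - int (idx j) - 1) - (int (idx (nxt i)) - int (idx i) - 1)"
      using idx_nxt_cong[of i] idx_nxt_cong[of j] e by (metis dvd_diff)
    then show "i = j" by (simp add: idx_dvd_iff)
  qed
  then show ?thesis by (simp add: bij_def finite_UNIV_inj_surj)
qed

text \<open>Conjugation by \<open>Lam\<close> moves each cyclic diagonal along itself and so
  multiplies the component of frequency \<open>m\<close> by a phase. These two eigenvalues become
  the multipliers of the coefficients of the Lax matrix.\<close>

lemma E_coef_nxt_conj:
  "E_coef m n (\<chi> i j. M $ nxt i $ nxt j) = ee (of_nat m / of_nat CARD('n)) * E_coef m n (M :: 'n::{finite,linorder} cmat)"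
proof -
  have 1: "cyc n i j = cyc n (nxt i) (nxt j)" for i j :: 'n
  proof -
    have "int CARD('n) dvd (int (idx (nxt j)) - int (idx j) - 1) - (int (idx (nxt i)) - int (idx i) - 1)"
      by (intro dvd_diff idx_nxt_cong)
    moreover have "int (idx (nxt j)) - int (idx (nxt i)) - int n = ((int (idx (nxt j)) - int (idx j) - 1) - (int (idx (nxt i)) - int (idx i) - 1)) + (int (idx j) - int (idx i) - int n)"
      by simp
    ultimately show ?thesis unfolding cyc_def using dvd_add_right_iff by metis
  qed
  have 2: "ee (- (of_nat m * of_nat (idx i) / of_nat CARD('n))) = ee (of_nat m / of_nat CARD('n)) * ee (- (of_nat m * of_nat (idx (nxt i)) / of_nat CARD('n)))" for i :: 'n
  proof -
    obtain k where k: "int (idx (nxt i)) - int (idx i) - 1 = int CARD('n) * k" using idx_nxt_cong[of i] by auto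
    then have "of_int (int (idx (nxt i))) = (of_int (int (idx i) + 1 + int CARD('n) * k) :: complex)" by (simp only: of_int_eq_iff)
    then have "of_nat m / of_nat CARD('n) + - (of_nat m * of_nat (idx (nxt i)) / of_nat CARD('n)) = - (of_nat m * of_nat (idx i) / of_nat CARD('n)) - (of_int (int m * k) :: complex)"
      by (simp add: field_simps)
    then show ?thesis unfolding ee_add[symmetric] by (simp only: ee_diff ee_of_int) simp
  qed
  have "(\<Sum>i\<in>UNIV. \<Sum>j\<in>UNIV. ee (- (of_nat m * of_nat (idx i) / of_nat CARD('n))) * (cyc n i j * M $ nxt i $ nxt j)) =
    (\<Sum>i\<in>UNIV. \<Sum>j\<in>UNIV. ee (of_nat m / of_nat CARD('n)) * ee (- (of_nat m * of_nat (idx (nxt i)) / of_nat CARD('n))) * (cyc n (nxt i) (nxt j) * M $ nxt i $ nxt j))"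
    by (simp only: 1[symmetric] 2[symmetric])
  also have "\<dots> = (\<Sum>i\<in>UNIV. \<Sum>j\<in>UNIV. ee (of_nat m / of_nat CARD('n)) * ee (- (of_nat m * of_nat (idx (nxt i)) / of_nat CARD('n))) * (cyc n (nxt i) j * M $ nxt i $ j))"
    by (intro sum.cong[OF refl] sum.reindex_bij_betw[OF nxt_bij])
  also have "\<dots> = (\<Sum>i\<in>UNIV. \<Sum>j\<in>UNIV. ee (of_nat m / of_nat CARD('n)) * ee (- (of_nat m * of_nat (idx i) / of_nat CARD('n))) * (cyc n i j * M $ i $ j))"
    by (rule sum.reindex_bij_betw[OF nxt_bij])
  finally show ?thesis by (simp add: E_coef_def sum_distrib_left mult_ac)
qed

section \<open>Coadjoint orbits of rank-one type\<close>

definition outer :: "'n::finite cvec \<Rightarrow> 'n cvec \<Rightarrow> 'n cmat" where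
  "outer a w = (\<chi> i j. a $ i * w $ j)"

text \<open>Bilinear rather than Hermitian, so that everything built from it stays
  holomorphic.\<close>

definition bdot :: "'n::finite cvec \<Rightarrow> 'n cvec \<Rightarrow> complex" where
  "bdot a w = (\<Sum>i\<in>UNIV. a $ i * w $ i)"

lemma bdot_commute: "bdot a w = bdot w a"
  by (simp add: bdot_def mult.commute)

lemma bdot_assoc: "bdot (x v* Y) z = bdot x (Y *v z)"
  unfolding bdot_def vector_matrix_mult_def matrix_vector_mult_def
  by (simp add: sum_distrib_left sum_distrib_right mult_ac) (rule sum.swap)

lemma bdot_minus: "bdot x (- y) = - bdot x y"
  by (simp add: bdot_def sum_negf)

lemma outer_mult: "outer a w ** Y = outer a (w v* Y)"
  by (simp add: outer_def matrix_matrix_mult_def vector_matrix_mult_def vec_eq_iff sum_distrib_left mult_ac)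

lemma mult_outer: "Y ** outer a w = outer (Y *v a) w"
  by (simp add: outer_def matrix_matrix_mult_def matrix_vector_mult_def vec_eq_iff sum_distrib_left sum_distrib_right mult_ac)

lemma outer_apply: "outer a w *v x = bdot w x *s a"
  by (simp add: outer_def bdot_def matrix_vector_mult_def vec_eq_iff sum_distrib_left mult_ac)

lemma apply_outer: "x v* outer a w = bdot x a *s w"
  by (simp add: outer_def bdot_def vector_matrix_mult_def vec_eq_iff sum_distrib_left mult_ac)

lemma outer_scale_right: "outer a (c *s w) = mscale c (outer a w)"
  by (simp add: outer_def mscale_def vec_eq_iff mult_ac)

lemma trace_outer: "trace (outer a w) = bdot a w"
  by (simp add: outer_def trace_def bdot_def)

lemma mat_distribs:
  fixes A B C :: "'n::finite cmat"
  shows "(A + B) ** C = A ** C + B ** C" "(A - B) ** C = A ** C - B ** C"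
    "C ** (A + B) = C ** A + C ** B" "C ** (A - B) = C ** A - C ** B"
  by (simp_all add: matrix_matrix_mult_def vec_eq_iff ring_distribs sum.distrib sum_subtractf)

lemma vec_distribs:
  fixes A B :: "'n::finite cmat" and x :: "'n cvec"
  shows "(A + B) *v x = A *v x + B *v x" "(A - B) *v x = A *v x - B *v x"
    "x v* (A + B) = x v* A + x v* B" "x v* (A - B) = x v* A - x v* B"
  by (simp_all add: matrix_vector_mult_def vector_matrix_mult_def vec_eq_iff ring_distribs sum.distrib sum_subtractf)

lemma mscale_apply:
  fixes x :: "'n::finite cvec"
  shows "x v* mscale c Y = c *s (x v* Y)" "mscale c Y *v x = c *s (Y *v x)" "x v* mat c = c *s x" "mat c *v x = c *s x"
  by (simp_all add: vector_matrix_mult_def matrix_vector_mult_def mscale_def vec_eq_iff sum_distrib_left mult_ac mat_def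
       if_distrib[where f = "\<lambda>x. x * _"] if_distrib[where f = "\<lambda>x. _ * x"] cong: if_cong)

text \<open>The Sherman-Morrison formula supplies the inverse.\<close>

lemma rank_one_update_invertible:
  assumes "1 + bdot q c \<noteq> 0"
  shows "invertible (mat 1 + outer c q)"
proof -
  let ?k = "inverse (1 + bdot q c)"
  have "(mat 1 + outer c q) ** (mat 1 - mscale ?k (outer c q)) = mat 1 + mscale (1 - ?k - ?k * bdot q c) (outer c q)"
    by (simp add: mat_distribs mscale_mult_right outer_mult apply_outer outer_scale_right)
       (simp add: vec_eq_iff mscale_def outer_def algebra_simps)
  also have "1 - ?k - ?k * bdot q c = 0" using assms by (simp add: field_simps)
  finally have "(mat 1 + outer c q) ** (mat 1 - mscale ?k (outer c q)) = mat 1" by (simp add: mscale_def vec_eq_iff)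
  then show ?thesis using invertible_right_inverse by blast
qed

lemma S0_outer: "S0 \<nu> = outer (\<nu> *s 1) 1 - mat \<nu>"
  by (simp add: S0_def outer_def mat_def vec_eq_iff)

lemma mscale_det: "det (mscale c (A :: 'n::finite cmat)) = c ^ CARD('n) * det A"
proof -
  have "mscale c A = (\<chi> i. c *s A $ i)" by (simp add: mscale_def vec_eq_iff)
  then show ?thesis by (simp add: det_rows_mul)
qed

text \<open>Conjugation ignores scalars, so an invertible \<open>g\<close> can be rescaled into
  \<open>SL\<close> by an N-th root of 1 / det g.\<close>

lemma R_rotI:
  assumes g: "invertible g" and S: "g ** S = A ** g"
  shows "S \<in> R_rot (A :: 'n::finite cmat)"
proof -
  have "det g \<noteq> 0" using g by (simp add: invertible_det_nz)
  obtain c where c: "c ^ CARD('n) = inverse (det g)"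
    using exists_complex_root[of "CARD('n)" "inverse (det g)"] by (metis zero_less_card_finite less_irrefl)
  have c0: "c \<noteq> 0" using c \<open>det g \<noteq> 0\<close> by (auto simp: power_0_left)
  let ?g = "mscale c g"
  have inv: "matrix_inv ?g = mscale (inverse c) (matrix_inv g)"
    using c0 matrix_inv_right[OF g]
    by (intro matrix_inv_unique) (simp add: mscale_mult_left mscale_mult_right mscale_mscale mscale_1)
  have "matrix_inv ?g ** A ** ?g = matrix_inv g ** (A ** g)"
    using c0 unfolding inv by (simp add: mscale_mult_left mscale_mult_right mscale_mscale mscale_1 matrix_mul_assoc)
  also have "\<dots> = S" unfolding S[symmetric] by (simp add: matrix_mul_assoc matrix_inv_left[OF g])
  finally have "S = matrix_inv ?g ** A ** ?g" ..
  moreover have "?g \<in> SL" using c \<open>det g \<noteq> 0\<close> by (simp add: SL_def mscale_det)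
  ultimately show ?thesis unfolding R_rot_def by blast
qed

text \<open>Two rank-one updates of the identity: the first moves \<open>a\<close> to \<open>\<nu> 1\<close>, the second
  fixes \<open>1\<close> and moves the covector to \<open>1\<close>.\<close>

lemma rank_one_orbit:
  assumes \<nu>: "\<nu> \<noteq> 0" and aw: "bdot w a = of_nat CARD('n) * \<nu>"
  shows "outer a w - mat \<nu> \<in> R_rot (S0 \<nu> :: 'n::finite cmat)"
proof -
  let ?N = "of_nat CARD('n) :: complex"
  have "bdot w a \<noteq> 0" using \<nu> aw by simp
  then obtain k where k: "a $ k \<noteq> 0" by (force simp: bdot_def)
  \<comment> \<open>Scaled so that \<open>bdot q a = 1\<close>; the update then adds exactly \<nu> 1
    - a to \<open>a\<close>.\<close>
  define q where "q = (1 / a $ k) *s axis k 1"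
  have qx: "bdot q x = x $ k / a $ k" for x
    by (simp add: bdot_def q_def axis_def if_distrib[where f = "\<lambda>x. x * _"] if_distrib[where f = "\<lambda>x. _ * x"] cong: if_cong)
  define g0 where "g0 = mat 1 + outer (\<nu> *s 1 - a) q"
  have "1 + bdot q (\<nu> *s 1 - a) = \<nu> / a $ k" using k by (simp add: qx diff_divide_distrib)
  then have g0: "invertible g0" unfolding g0_def using k \<nu> by (intro rank_one_update_invertible) simp
  have g0a: "g0 *v a = \<nu> *s 1"
    using k by (simp add: g0_def vec_distribs outer_apply qx vec_eq_iff)
  define w' where "w' = w v* matrix_inv g0"
  have w'g0: "w' v* g0 = w"
    by (simp add: w'_def vector_matrix_mul_assoc matrix_inv_left[OF g0])
  have "\<nu> * bdot w' 1 = bdot w' (g0 *v a)" unfolding g0a by (simp add: bdot_def sum_distrib_left mult_ac)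
  also have "\<dots> = bdot w a" by (simp add: bdot_assoc[symmetric] w'g0)
  finally have w'1: "bdot w' 1 = ?N" using aw \<nu> by simp
  \<comment> \<open>The covector w' - 1 annihilates the vector 1, hence \<open>h\<close> fixes that
    vector. The covector 1 pairs to 1 with the column (1/N) 1, hence \<open>h\<close> carries it to
    w'.\<close>
  define h where "h = mat 1 + outer ((1 / ?N) *s 1) (w' - 1)"
  have b1: "bdot (w' - 1) 1 = 0" using w'1 by (simp add: bdot_def sum_subtractf)
  have "bdot (w' - 1) ((1 / ?N) *s 1) = 0"
    using b1 by (simp add: bdot_def sum_distrib_right[symmetric] flip: sum_divide_distrib)
  then have h: "invertible h" unfolding h_def by (intro rank_one_update_invertible) simp
  have h1: "h *v 1 = 1" by (simp add: h_def vec_distribs outer_apply b1)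
  have "bdot 1 ((1 / ?N) *s (1 :: 'n cvec)) = 1" by (simp add: bdot_def)
  then have h1': "1 v* h = w'"
    by (simp add: h_def vec_distribs apply_outer vec_eq_iff)
  let ?g = "h ** g0"
  have ga: "?g *v a = \<nu> *s 1"
    by (simp add: matrix_vector_mul_assoc[symmetric] g0a h1 vector_scalar_commute)
  have wg: "1 v* ?g = w" by (simp add: vector_matrix_mul_assoc[symmetric] h1' w'g0)
  have "?g ** (outer a w - mat \<nu>) = S0 \<nu> ** ?g"
    by (simp add: mat_distribs S0_outer mult_outer outer_mult ga wg mat_mult_left mat_mult_right)
  then show ?thesis using invertible_mult[OF h g0] by (intro R_rotI) auto
qed

lemma R_rot_trace: "S \<in> R_rot A \<Longrightarrow> trace S = trace (A :: 'n::finite cmat)"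
proof -
  assume "S \<in> R_rot A"
  then obtain g where g: "det g = 1" "S = matrix_inv g ** A ** g" by (auto simp: R_rot_def SL_def)
  have "invertible g" using g(1) by (simp add: invertible_det_nz)
  then show ?thesis unfolding g(2)
    by (metis matrix_inv_right matrix_mul_assoc matrix_mul_lid trace_mul_sym)
qed

text \<open>With \<open>y = g\<^sup>-\<^sup>1 dg\<close> a lift of \<open>X\<close> solves \<open>[S, y] = X\<close>, and the form is \<open>tr (S [y1, y2])\<close>,
  which depends on each \<open>y\<close> only through its commutator with \<open>S\<close>.\<close>

lemma lifts_commutator:
  assumes "lifts A S X g dg"
  defines "y \<equiv> matrix_inv g ** dg"
  shows "S ** y - y ** S = X" "dg = g ** y"
proof -
  have g: "invertible g" "S = matrix_inv g ** A ** g"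
    using assms(1) by (auto simp: lifts_def SL_def invertible_det_nz)
  show "dg = g ** y" by (simp add: y_def matrix_mul_assoc matrix_inv_right[OF g(1)])
  have "matrix_inv g ** A ** (g ** matrix_inv g) ** dg = matrix_inv g ** A ** dg"
    by (simp add: matrix_inv_right[OF g(1)])
  then show "S ** y - y ** S = X"
    using assms(1) by (simp add: lifts_def g(2) y_def matrix_mul_assoc)
qed

text \<open>The result involves no lift: any solution \<open>z\<close> of the commutator equation
  for \<open>X\<close> computes the form. This gives the uniqueness behind the definite description
  in \<open>omega_rot\<close>, also across different \<open>g\<close>.\<close>

lemma lifts_value:
  assumes "lifts A S X g dg1" "lifts A S Y g dg2" and z: "S ** z - z ** S = X"
  shows "trace (A ** (dg1 ** matrix_inv g ** dg2 ** matrix_inv g - dg2 ** matrix_inv g ** dg1 ** matrix_inv g)) = - trace (Y ** z)"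
proof -
  define y1 where "y1 = matrix_inv g ** dg1"
  define y2 where "y2 = matrix_inv g ** dg2"
  have y1: "S ** y1 - y1 ** S = X" "dg1 = g ** y1" and y2: "S ** y2 - y2 ** S = Y" "dg2 = g ** y2"
    using lifts_commutator assms(1,2) by (auto simp: y1_def y2_def)
  have g: "invertible g" "S = matrix_inv g ** A ** g"
    using assms(1) by (auto simp: lifts_def SL_def invertible_det_nz)
  have *: "trace (A ** (g ** p ** matrix_inv g ** (g ** q) ** matrix_inv g)) = trace (S ** p ** q)" for p q
  proof -
    have "A ** (g ** p ** matrix_inv g ** (g ** q) ** matrix_inv g) = A ** g ** p ** (matrix_inv g ** g) ** q ** matrix_inv g"
      by (simp add: matrix_mul_assoc)
    also have "\<dots> = (A ** g ** p ** q) ** matrix_inv g" by (simp add: matrix_inv_left[OF g(1)])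
    finally have e: "A ** (g ** p ** matrix_inv g ** (g ** q) ** matrix_inv g) = (A ** g ** p ** q) ** matrix_inv g" .
    show ?thesis unfolding e by (subst trace_mul_sym) (simp add: g(2) matrix_mul_assoc)
  qed
  have cyc: "trace (P ** Q ** R) = trace (Q ** R ** P)" "trace (P ** Q ** R) = trace (R ** P ** Q)" for P Q R :: "'a cmat"
    by (metis matrix_mul_assoc trace_mul_sym)+
  have "trace (A ** (dg1 ** matrix_inv g ** dg2 ** matrix_inv g - dg2 ** matrix_inv g ** dg1 ** matrix_inv g)) = trace (S ** y1 ** y2) - trace (S ** y2 ** y1)"
    unfolding y1(2) y2(2) by (simp add: mat_distribs trace_sub *)
  also have "\<dots> = trace ((S ** y1 - y1 ** S) ** y2)"
    using cyc(2)[of S y2 y1] by (simp add: mat_distribs trace_sub)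
  also have "\<dots> = trace ((S ** z - z ** S) ** y2)" by (simp only: y1(1) z)
  also have "\<dots> = - trace ((S ** y2 - y2 ** S) ** z)"
    using cyc(1)[of S z y2] cyc(2)[of S y2 z] cyc(1)[of z S y2] cyc(1)[of S y2 z] cyc(2)[of y2 S z]
    by (simp add: mat_distribs trace_sub)
  finally show ?thesis by (simp only: y2(1))
qed

lemma rank_one_commutator:
  fixes a w da dw :: "'n::finite cvec"
  assumes \<kappa>: "bdot w a \<noteq> 0" and N: "CARD('n) \<ge> 2"
    and tan: "bdot dw a + bdot w da = 0"
  obtains y :: "'n cmat" where "w v* y = dw" "y *v a = - da" "trace y = 0"
proof
  let ?\<kappa> = "bdot w a"
  let ?s = "bdot w da"
  \<comment> \<open>The part t (1 - a w^T / \<kappa>) of \<open>?y\<close> annihilates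
    \<open>a\<close> on the right and \<open>w\<close> on the left. It leaves both equations alone
    and adds t (N - 1) to the trace, so \<open>t\<close> can be chosen to make \<open>?y\<close>
    traceless, as a lift to \<open>SL\<close> requires. The remaining multiple of a w^T corrects the
    overlap of da with \<open>w\<close>; by tangency one correction serves both equations.\<close>
  define t where "t = - (bdot dw a / ?\<kappa>) / (of_nat CARD('n) - 1)"
  let ?y = "mscale (1 / ?\<kappa>) (outer a dw) - mscale (1 / ?\<kappa>) (outer da w) + mscale (?s / ?\<kappa>^2 - t / ?\<kappa>) (outer a w) + mat t"
  have dwa: "bdot dw a = - ?s" using tan by (simp add: eq_neg_iff_add_eq_0)
  have dwa': "bdot a dw = - ?s" "bdot w a = bdot a w" using dwa by (simp_all add: bdot_commute)
  have "of_nat CARD('n) \<noteq> (of_nat 1 :: complex)" using N by (simp only: of_nat_eq_iff)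
  then have N1: "of_nat CARD('n) - 1 \<noteq> (0::complex)" by simp
  show "w v* ?y = dw"
    using \<kappa> by (simp add: vec_distribs mscale_apply apply_outer vec_eq_iff field_simps power2_eq_square)
  show "?y *v a = - da"
    using \<kappa> by (simp add: vec_distribs mscale_apply outer_apply dwa dwa' vec_eq_iff field_simps power2_eq_square)
  have tr: "trace (mscale c Y) = c * trace Y" "trace (mat c :: 'n cmat) = of_nat CARD('n) * c" for c and Y :: "'n cmat"
    by (simp_all add: trace_def mscale_def mat_def sum_distrib_left)
  have "trace ?y = bdot dw a / ?\<kappa> + t * (of_nat CARD('n) - 1)"
    using \<kappa> dwa by (simp add: trace_add trace_sub tr trace_outer bdot_commute[of a] bdot_commute[of da] field_simps power2_eq_square)
  then show "trace ?y = 0" using N1 \<kappa> by (simp add: t_def field_simps)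
qed

text \<open>The hypotheses \<open>tan\<close> are the derivative of the constraint w^T a = N \<nu>.
  A solution of w y = dw and y a = - da satisfies [S, y] = X, and the same two equations evaluate
  the trace of y against the other tangent vector.\<close>

lemma rank_one_omega:
  fixes a w da dw da' dw' :: "'n::finite cvec"
  assumes \<nu>: "\<nu> \<noteq> 0" and N: "CARD('n) \<ge> 2" and aw: "bdot w a = of_nat CARD('n) * \<nu>"
    and tan: "bdot dw a + bdot w da = 0" "bdot dw' a + bdot w da' = 0"
  defines "S \<equiv> outer a w - mat \<nu>"
  shows "outer da w + outer a dw \<in> T_rot (S0 \<nu>) S"
    and "omega_rot (S0 \<nu>) S (outer da w + outer a dw) (outer da' w + outer a dw') = bdot da dw' - bdot da' dw"
proof -
  let ?X = "\<lambda>da dw. outer da w + outer a dw"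
  have \<kappa>: "bdot w a \<noteq> 0" using aw \<nu> N by simp
  obtain g where g: "g \<in> SL" "S = matrix_inv g ** S0 \<nu> ** g"
    using rank_one_orbit[OF \<nu> aw] by (auto simp: R_rot_def S_def)
  have gi: "invertible g" using g(1) by (simp add: SL_def invertible_det_nz)
  have comm: "S ** y - y ** S = ?X da dw" if "w v* y = dw" "y *v a = - da" for y da dw
    using that by (simp add: S_def mat_distribs outer_mult mult_outer mat_mult_left mat_mult_right)
      (simp add: outer_def vec_eq_iff)
  have lift: "lifts (S0 \<nu>) S (?X da dw) g (g ** y)" if y: "w v* y = dw" "y *v a = - da" "trace y = 0" for y da dw
  proof -
    have "trace (g ** y ** matrix_inv g) = trace (matrix_inv g ** (g ** y))" by (rule trace_mul_sym)
    also have "\<dots> = 0" by (simp add: matrix_mul_assoc matrix_inv_left[OF gi] y(3))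
    finally have tr: "trace (g ** y ** matrix_inv g) = 0" .
    have "matrix_inv g ** S0 \<nu> ** (g ** y) - matrix_inv g ** (g ** y) ** matrix_inv g ** S0 \<nu> ** g = S ** y - (matrix_inv g ** g) ** y ** (matrix_inv g ** S0 \<nu> ** g)"
      by (simp add: g(2) matrix_mul_assoc)
    also have "\<dots> = ?X da dw"
      using comm[OF y(1,2)] by (simp add: matrix_inv_left[OF gi] g(2)[symmetric])
    finally show ?thesis using g tr by (simp add: lifts_def)
  qed
  obtain y where y: "w v* y = dw" "y *v a = - da" "trace y = 0"
    using rank_one_commutator[OF \<kappa> N tan(1)] by blast
  obtain y' where y': "w v* y' = dw'" "y' *v a = - da'" "trace y' = 0"
    using rank_one_commutator[OF \<kappa> N tan(2)] by blast
  show "?X da dw \<in> T_rot (S0 \<nu>) S" using lift[OF y] by (auto simp: T_rot_def)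
  have "trace (?X da' dw' ** y) = bdot da' dw - bdot da dw'"
    by (simp add: mat_distribs outer_mult trace_add trace_outer y(1))
      (simp add: bdot_commute[of a] bdot_assoc y(2) bdot_minus bdot_commute[of dw'])
  then have val: "trace (S0 \<nu> ** (dg1 ** matrix_inv g ** dg2 ** matrix_inv g - dg2 ** matrix_inv g ** dg1 ** matrix_inv g)) = bdot da dw' - bdot da' dw"
    if "lifts (S0 \<nu>) S (?X da dw) g dg1" "lifts (S0 \<nu>) S (?X da' dw') g dg2" for g dg1 dg2
    using lifts_value[OF that comm[OF y(1,2)]] by simp
  show "omega_rot (S0 \<nu>) S (?X da dw) (?X da' dw') = bdot da dw' - bdot da' dw"
    unfolding omega_rot_def
  proof (rule the_equality)
    show "\<exists>g dg1 dg2. lifts (S0 \<nu>) S (?X da dw) g dg1 \<and> lifts (S0 \<nu>) S (?X da' dw') g dg2 \<and>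
      bdot da dw' - bdot da' dw = trace (S0 \<nu> ** (dg1 ** matrix_inv g ** dg2 ** matrix_inv g - dg2 ** matrix_inv g ** dg1 ** matrix_inv g))"
      using lift[OF y] lift[OF y'] val by metis
  qed (use val in blast)
qed

section \<open>Complex differentials\<close>

lemma DERIV_finite_sum:
  assumes "\<And>n. n \<in> A \<Longrightarrow> (f n has_field_derivative f' n) F"
  shows "((\<lambda>x. \<Sum>n\<in>A. f n x) has_field_derivative (\<Sum>n\<in>A. f' n)) F"
  by (rule DERIV_sum) (rule assms)

lemma has_derivative_vec_componentwise:
  fixes f :: "'a::real_normed_vector \<Rightarrow> 'b::euclidean_space ^ 'n"
  assumes "\<And>i. ((\<lambda>x. f x $ i) has_derivative (\<lambda>h. f' h $ i)) (at x within S)"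
  shows "(f has_derivative f') (at x within S)"
proof (subst has_derivative_componentwise_within, intro ballI)
  fix b :: "'b ^ 'n" assume "b \<in> Basis"
  then obtain i u where b: "b = axis i u" by (auto simp: Basis_vec_def)
  show "((\<lambda>x. f x \<bullet> b) has_derivative (\<lambda>h. f' h \<bullet> b)) (at x within S)"
    unfolding b inner_axis by (intro has_derivative_inner_left assms)
qed

text \<open>Differentiability over the complex numbers at a point of the pair space, whose product type
  carries no complex scalar multiplication of its own.\<close>

definition cdiff :: "('n::finite cvec \<times> 'n cvec \<Rightarrow> complex) \<Rightarrow> 'n cvec \<times> 'n cvec \<Rightarrow> bool" where
  "cdiff f p \<longleftrightarrow> (\<exists>D. (f has_derivative D) (at p) \<and> (\<forall>c \<xi>. D (c *s fst \<xi>, c *s snd \<xi>) = c * D \<xi>))"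

lemma cdiff_const: "cdiff (\<lambda>_. c) p"
  unfolding cdiff_def by (rule exI[of _ "\<lambda>_. 0"]) auto

lemma cdiff_fst: "cdiff (\<lambda>p. fst p $ i) p"
  unfolding cdiff_def
  by (rule exI[of _ "\<lambda>\<xi>. fst \<xi> $ i"])
    (auto intro!: bounded_linear.has_derivative[OF bounded_linear_vec_nth] derivative_intros)

lemma cdiff_snd: "cdiff (\<lambda>p. snd p $ i) p"
  unfolding cdiff_def
  by (rule exI[of _ "\<lambda>\<xi>. snd \<xi> $ i"])
    (auto intro!: bounded_linear.has_derivative[OF bounded_linear_vec_nth] derivative_intros)

lemma cdiff_add:
  assumes "cdiff f p" "cdiff g p"
  shows "cdiff (\<lambda>p. f p + g p) p"
proof -
  obtain D E where "(f has_derivative D) (at p)" "\<And>c \<xi>. D (c *s fst \<xi>, c *s snd \<xi>) = c * D \<xi>"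
    "(g has_derivative E) (at p)" "\<And>c \<xi>. E (c *s fst \<xi>, c *s snd \<xi>) = c * E \<xi>"
    using assms unfolding cdiff_def by blast
  then show ?thesis unfolding cdiff_def
    by (intro exI[of _ "\<lambda>h. D h + E h"]) (auto intro!: has_derivative_add simp: distrib_left)
qed

lemma cdiff_mult:
  assumes "cdiff f p" "cdiff g p"
  shows "cdiff (\<lambda>p. f p * g p) p"
proof -
  obtain D E where "(f has_derivative D) (at p)" "\<And>c \<xi>. D (c *s fst \<xi>, c *s snd \<xi>) = c * D \<xi>"
    "(g has_derivative E) (at p)" "\<And>c \<xi>. E (c *s fst \<xi>, c *s snd \<xi>) = c * E \<xi>"
    using assms unfolding cdiff_def by blast
  then show ?thesis unfolding cdiff_def
    by (intro exI[of _ "\<lambda>h. f p * E h + D h * g p"] conjI has_derivative_mult allI) (auto simp: algebra_simps)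
qed

lemma cdiff_comp:
  assumes "(g has_field_derivative g') (at (f p))" "cdiff f p"
  shows "cdiff (\<lambda>p. g (f p)) p"
proof -
  obtain D where D: "(f has_derivative D) (at p)" "\<And>c \<xi>. D (c *s fst \<xi>, c *s snd \<xi>) = c * D \<xi>"
    using assms(2) unfolding cdiff_def by blast
  have "((\<lambda>p. g (f p)) has_derivative (\<lambda>h. g' * D h)) (at p)"
    using has_derivative_compose[OF D(1) assms(1)[unfolded has_field_derivative_def]] .
  then show ?thesis unfolding cdiff_def
    by (intro exI[of _ "\<lambda>h. g' * D h"]) (auto simp: D(2))
qed

lemma cdiff_minus: "cdiff f p \<Longrightarrow> cdiff (\<lambda>p. - f p) p"
  using cdiff_mult[OF cdiff_const[of "- 1"]] by simp

lemma cdiff_diff: "cdiff f p \<Longrightarrow> cdiff g p \<Longrightarrow> cdiff (\<lambda>p. f p - g p) p"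
  using cdiff_add[OF _ cdiff_minus, of f p g] by simp

lemma cdiff_sum: "(\<And>i. i \<in> A \<Longrightarrow> cdiff (f i) p) \<Longrightarrow> cdiff (\<lambda>p. \<Sum>i\<in>A. f i p) p"
  by (induction A rule: infinite_finite_induct) (auto intro: cdiff_const cdiff_add)

lemma cdiff_prod: "(\<And>i. i \<in> A \<Longrightarrow> cdiff (f i) p) \<Longrightarrow> cdiff (\<lambda>p. \<Prod>i\<in>A. f i p) p"
  by (induction A rule: infinite_finite_induct) (auto intro: cdiff_const cdiff_mult)

lemma cdiff_inverse: "cdiff f p \<Longrightarrow> f p \<noteq> 0 \<Longrightarrow> cdiff (\<lambda>p. inverse (f p)) p"
  by (rule cdiff_comp[OF DERIV_inverse])

text \<open>Homogeneity over the complex numbers upgrades the real derivative to a complex one along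
  each complex line, which opens the way to one-variable calculus.\<close>

lemma cdiff_line:
  fixes v u dv du :: "'n::finite cvec"
  assumes D: "(f has_derivative D) (at (v, u))" "\<And>c \<xi>. D (c *s fst \<xi>, c *s snd \<xi>) = c * D \<xi>"
  shows "((\<lambda>t. f (v + t *s dv, u + t *s du)) has_field_derivative D (dv, du)) (at 0)"
proof -
  have lin: "((\<lambda>t. a + t *s b) has_derivative (\<lambda>h. h *s b)) (at 0)" for a b :: "'n cvec"
    by (rule has_derivative_vec_componentwise) (auto intro!: derivative_eq_intros)
  have "((\<lambda>t. (v + t *s dv, u + t *s du)) has_derivative (\<lambda>h. (h *s dv, h *s du))) (at 0)"
    by (intro has_derivative_Pair lin)
  moreover have "(f has_derivative D) (at (v + 0 *s dv, u + 0 *s du))" using D(1) by simp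
  ultimately have "((\<lambda>t. f (v + t *s dv, u + t *s du)) has_derivative (\<lambda>h. D (h *s dv, h *s du))) (at 0)"
    by (rule has_derivative_compose)
  moreover have "D (h *s dv, h *s du) = D (dv, du) * h" for h using D(2)[of h "(dv, du)"] by simp
  ultimately show ?thesis by (simp add: has_field_derivative_def)
qed

lemma DERIV_finite_prod:
  assumes "\<And>k. k \<in> A \<Longrightarrow> (f k has_field_derivative f' k) (at (x::complex))" "finite A"
  shows "((\<lambda>x. \<Prod>k\<in>A. f k x) has_field_derivative (\<Sum>l\<in>A. f' l * (\<Prod>k\<in>A - {l}. f k x))) (at x)"
  using assms(2,1)
proof (induction A)
  case (insert a A)
  have "((\<lambda>x. f a x * (\<Prod>k\<in>A. f k x)) has_field_derivative
      f a x * (\<Sum>l\<in>A. f' l * (\<Prod>k\<in>A - {l}. f k x)) + f' a * (\<Prod>k\<in>A. f k x)) (at x)"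
    using insert by (intro DERIV_mult') auto
  moreover have "f a x * (\<Sum>l\<in>A. f' l * (\<Prod>k\<in>A - {l}. f k x)) = (\<Sum>l\<in>A. f' l * (\<Prod>k\<in>insert a A - {l}. f k x))"
    unfolding sum_distrib_left
  proof (intro sum.cong refl)
    fix l assume "l \<in> A"
    then have "insert a A - {l} = insert a (A - {l})" using insert(2) by auto
    then show "f a x * (f' l * (\<Prod>k\<in>A - {l}. f k x)) = f' l * (\<Prod>k\<in>insert a A - {l}. f k x)"
      using insert(1,2) by simp
  qed
  moreover have "insert a A - {a} = A" using insert(2) by auto
  ultimately show ?case using insert(1,2) by (simp add: add.commute)
qed simp

lemma sum_offdiag_swap:
  fixes f :: "'n::finite \<Rightarrow> 'n \<Rightarrow> complex"
  shows "(\<Sum>l\<in>UNIV. \<Sum>k\<in>UNIV - {l}. f l k) = (\<Sum>l\<in>UNIV. \<Sum>k\<in>UNIV - {l}. f k l)"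
proof -
  have *: "(\<Sum>k\<in>UNIV - {l}. g k) = (\<Sum>k\<in>UNIV. if k = l then 0 else g k)" for g :: "'n \<Rightarrow> complex" and l
    by (rule sum.mono_neutral_cong_left) auto
  show ?thesis unfolding * by (subst sum.swap) (intro sum.cong refl, auto)
qed

lemma DERIV_transform_ev:
  assumes "eventually (\<lambda>t. f t = g t) (nhds x)" "(f has_field_derivative a) (at x)" "(g has_field_derivative b) (at x)"
  shows "a = (b :: complex)"
  using DERIV_cong_ev[OF refl assms(1) refl] assms(2,3) DERIV_unique by blast

lemma DERIV_bdot:
  fixes f g :: "complex \<Rightarrow> 'n::finite cvec"
  assumes "\<And>i. ((\<lambda>t. f t $ i) has_field_derivative f' $ i) (at x)" "\<And>i. ((\<lambda>t. g t $ i) has_field_derivative g' $ i) (at x)"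
  shows "((\<lambda>t. bdot (f t) (g t)) has_field_derivative bdot (f x) g' + bdot f' (g x)) (at x)"
proof -
  have "((\<lambda>t. \<Sum>i\<in>UNIV. f t $ i * g t $ i) has_field_derivative (\<Sum>i\<in>UNIV. f x $ i * g' $ i + f' $ i * g x $ i)) (at x)"
    by (rule DERIV_finite_sum, rule DERIV_mult'[OF assms])
  then show ?thesis by (simp add: bdot_def sum.distrib)
qed

section \<open>The conjugated Lax matrix\<close>

text \<open>The second generator of the Heisenberg group: translation by \<tau>/N permutes the
  functions cyclically. At the last index the characteristic leaves its range by 1, and
  \<open>theta_char_add_1\<close> wraps it around.\<close>

lemma psi_tau_shift:
  "psi \<tau> i (y - \<tau> / of_nat CARD('n)) = ee (- (\<tau> / (2 * of_nat CARD('n))) + y - 1/2) * psi \<tau> (nxt (i :: 'n::{finite,linorder})) y"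
proof -
  let ?N = "of_nat CARD('n) :: complex"
  let ?a = "of_nat (idx i) / ?N - 1/2"
  have arg: "- (?N * (y - \<tau> / ?N)) = - (?N * y) + (1 / ?N) * (?N * \<tau>)" by (simp add: field_simps)
  have e: "- ((1 / ?N)^2 * (?N * \<tau> / 2)) - (1 / ?N) * (- (?N * y) + ?N / 2) = - (\<tau> / (2 * ?N)) + y - 1/2"
    by (simp add: field_simps power2_eq_square)
  have "theta (?a + 1 / ?N) (?N / 2) (- (?N * y)) (?N * \<tau>) = psi \<tau> (nxt i) y"
  proof (cases "idx i = CARD('n)")
    case True
    then have "?a + 1 / ?N = (of_nat (idx (nxt i)) / ?N - 1/2) + 1" by (simp add: idx_nxt)
    then show ?thesis unfolding psi_def by (simp only: theta_char_add_1)
  next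
    case False
    then have "idx i < CARD('n)" using idx_range(2)[of i] by simp
    then have "?a + 1 / ?N = of_nat (idx (nxt i)) / ?N - 1/2" by (simp add: idx_nxt add_divide_distrib)
    then show ?thesis unfolding psi_def by (simp only:)
  qed
  then show ?thesis unfolding psi_def[of \<tau> i] arg theta_shift e by simp
qed

text \<open>The logarithmic derivative of \<open>vtheta\<close>; it is the constant term of
  \<open>phi \<tau> x z\<close> in its expansion at z = 0.\<close>

definition E1 :: "complex \<Rightarrow> complex \<Rightarrow> complex" where
  "E1 \<tau> x = deriv (\<lambda>z. vtheta z \<tau>) x / vtheta x \<tau>"

text \<open>Read off from the first-order expansion at z = 0, as \<open>avec_dA\<close> shows. The
  sum of \<open>E1\<close> comes from the finite part of \<open>L_CM\<close>; the derivative of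
  \<open>psi\<close> comes from the motion of the column points u_j - z/N, whose factor 1/N cancels
  against N \<nu>.\<close>

definition avec :: "complex \<Rightarrow> complex \<Rightarrow> 'n::{finite,linorder} cvec \<Rightarrow> 'n cvec \<Rightarrow> 'n cvec" where
  "avec \<tau> \<nu> v u = (\<chi> i. \<Sum>j\<in>UNIV. cc \<tau> u j * (psi \<tau> i (u $ j) * (v $ j + \<nu> * (\<Sum>k\<in>UNIV - {j}. E1 \<tau> (u $ j - u $ k)))
      - \<nu> * deriv (psi \<tau> i) (u $ j)))"

text \<open>\<open>L_CM\<close> times \<open>vtheta z \<tau>\<close> with the division cancelled,
  hence entire in \<open>z\<close>.\<close>

definition Lhat :: "complex \<Rightarrow> complex \<Rightarrow> 'n::finite cvec \<Rightarrow> 'n cvec \<Rightarrow> complex \<Rightarrow> 'n cmat" where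
  "Lhat \<tau> \<nu> v u z = (\<chi> j k. if j = k then v $ j * vtheta z \<tau> else \<nu> * (vtheta (u $ j - u $ k + z) \<tau> * deriv (\<lambda>z. vtheta z \<tau>) 0 / vtheta (u $ j - u $ k) \<tau>))"

definition Smat :: "complex \<Rightarrow> complex \<Rightarrow> 'n::{finite,linorder} cvec \<Rightarrow> 'n cvec \<Rightarrow> 'n cmat" where
  "Smat \<tau> \<nu> v u = outer (avec \<tau> \<nu> v u) (wvec \<tau> u) - mat \<nu>"

definition Kmat :: "complex \<Rightarrow> complex \<Rightarrow> 'n::{finite,linorder} cvec \<Rightarrow> 'n cvec \<Rightarrow> complex \<Rightarrow> 'n cmat" where
  "Kmat \<tau> \<nu> v u z = Amat \<tau> u z ** Lhat \<tau> \<nu> v u z ** Bmat \<tau> u z"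

definition dA :: "complex \<Rightarrow> 'n::{finite,linorder} cvec \<Rightarrow> 'n cmat" where
  "dA \<tau> u = (\<chi> i j. deriv (\<lambda>z. Amat \<tau> u z $ i $ j) 0)"

definition dB :: "complex \<Rightarrow> 'n::{finite,linorder} cvec \<Rightarrow> 'n cmat" where
  "dB \<tau> u = (\<chi> i j. deriv (\<lambda>z. Bmat \<tau> u z $ i $ j) 0)"

definition Mmat :: "complex \<Rightarrow> complex \<Rightarrow> 'n::{finite,linorder} cvec \<Rightarrow> 'n cvec \<Rightarrow> complex \<Rightarrow> 'n cmat" where
  "Mmat \<tau> \<nu> v u z = mscale (inverse (vtheta z \<tau>)) (Amat \<tau> u z ** L_CM \<tau> \<nu> (v, u) z ** Bmat \<tau> u z)"

lemma trace_S0: "trace (S0 \<nu>) = 0"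
  by (simp add: S0_def trace_def)

lemma sum_not_eq: "(\<Sum>k\<in>UNIV. if j = k then 0 else f k) = (\<Sum>k\<in>UNIV. f k) - (f j :: complex)" for j :: "'n::finite"
proof -
  have "(\<Sum>k\<in>UNIV. if j = k then 0 else f k) = (\<Sum>k\<in>UNIV. f k - (if j = k then f k else 0))"
    by (intro sum.cong) auto
  then show ?thesis by (simp add: sum_subtractf)
qed

lemma E_coef_holomorphic:
  fixes X :: "complex \<Rightarrow> 'n::{finite,linorder} cmat"
  assumes "\<And>i j. (\<lambda>z. X z $ i $ j) holomorphic_on A"
  shows "(\<lambda>z. E_coef m n (X z)) holomorphic_on A"
  unfolding E_coef_def by (intro holomorphic_intros assms)

lemma E_coef_deriv:
  fixes X :: "complex \<Rightarrow> 'n::{finite,linorder} cmat"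
  assumes "\<And>i j. ((\<lambda>z. X z $ i $ j) has_field_derivative D $ i $ j) (at x)"
  shows "((\<lambda>z. E_coef m n (X z)) has_field_derivative E_coef m n D) (at x)"
  unfolding E_coef_def by (rule DERIV_cmult, rule DERIV_finite_sum, rule DERIV_finite_sum, rule DERIV_cmult, rule DERIV_cmult, rule assms)

lemma Kmat_nth: "Kmat \<tau> \<nu> v u z $ i $ l = (\<Sum>j\<in>UNIV. \<Sum>k\<in>UNIV. Amat \<tau> u z $ i $ j * Lhat \<tau> \<nu> v u z $ j $ k * Bmat \<tau> u z $ k $ l)"
  unfolding Kmat_def matrix_matrix_mult_def
  by (simp add: sum_distrib_right) (rule sum.swap)

text \<open>The variation of \<open>thprod\<close> when its zeros \<open>u\<close> move in direction
  \<open>\<delta>\<close>; \<open>gdd\<close> is a second variation.\<close>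

definition gd :: "complex \<Rightarrow> 'n::finite cvec \<Rightarrow> 'n cvec \<Rightarrow> complex \<Rightarrow> complex" where
  "gd \<tau> u \<delta> y = - (\<Sum>l\<in>UNIV. \<delta> $ l * deriv (\<lambda>z. vtheta z \<tau>) (y - u $ l) * (\<Prod>k\<in>UNIV - {l}. vtheta (y - u $ k) \<tau>))"

definition gdd :: "complex \<Rightarrow> 'n::finite cvec \<Rightarrow> 'n cvec \<Rightarrow> 'n cvec \<Rightarrow> complex \<Rightarrow> complex" where
  "gdd \<tau> u \<delta> \<epsilon> y = (\<Sum>l\<in>UNIV. \<delta> $ l * \<epsilon> $ l * deriv (deriv (\<lambda>z. vtheta z \<tau>)) (y - u $ l) * (\<Prod>k\<in>UNIV - {l}. vtheta (y - u $ k) \<tau>))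
     + (\<Sum>l\<in>UNIV. \<Sum>k\<in>UNIV - {l}. \<epsilon> $ l * deriv (\<lambda>z. vtheta z \<tau>) (y - u $ l) * (\<delta> $ k * deriv (\<lambda>z. vtheta z \<tau>) (y - u $ k)
         * (\<Prod>i\<in>UNIV - {l} - {k}. vtheta (y - u $ i) \<tau>)))"

text \<open>Mixed second derivatives of one product commute. In the symplectic computation this
  plays the role of d d = 0.\<close>

lemma gdd_sym: "gdd \<tau> u \<delta> \<epsilon> y = gdd \<tau> u \<epsilon> \<delta> y"
proof -
  let ?t = "deriv (\<lambda>z. vtheta z \<tau>)"
  have "(\<Sum>l\<in>UNIV. \<Sum>k\<in>UNIV - {l}. \<epsilon> $ l * ?t (y - u $ l) * (\<delta> $ k * ?t (y - u $ k) * (\<Prod>i\<in>UNIV - {l} - {k}. vtheta (y - u $ i) \<tau>))) =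
    (\<Sum>l\<in>UNIV. \<Sum>k\<in>UNIV - {l}. \<epsilon> $ k * ?t (y - u $ k) * (\<delta> $ l * ?t (y - u $ l) * (\<Prod>i\<in>UNIV - {k} - {l}. vtheta (y - u $ i) \<tau>)))"
    by (rule sum_offdiag_swap)
  also have "\<dots> = (\<Sum>l\<in>UNIV. \<Sum>k\<in>UNIV - {l}. \<delta> $ l * ?t (y - u $ l) * (\<epsilon> $ k * ?t (y - u $ k) * (\<Prod>i\<in>UNIV - {l} - {k}. vtheta (y - u $ i) \<tau>)))"
    by (intro sum.cong refl) (simp add: Diff_insert[symmetric] insert_commute mult_ac)
  finally show ?thesis by (simp add: gdd_def mult_ac)
qed

context
  fixes \<tau> :: complex
  assumes \<tau>: "Im \<tau> > 0"
begin

abbreviation "th \<equiv> \<lambda>z. vtheta z \<tau>"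

lemma th_deriv: "(th has_field_derivative deriv th x) (at x)"
  by (rule holomorphic_derivI[OF vtheta_entire[OF \<tau>]]) auto

lemma psi_deriv: "(psi \<tau> i has_field_derivative deriv (psi \<tau> i) x) (at x)"
  by (rule holomorphic_derivI[OF psi_entire[OF \<tau>]]) auto

text \<open>The multipliers of \<open>d\<close> are those of the square of \<open>vtheta\<close>
  times constants, and its double zero at 0 propagates to the lattice. Dividing by
  \<open>vtheta\<close> twice leaves multipliers \<open>ee a\<close> and \<open>ee b\<close>, which
  the last hypothesis denies to an exponential. The transformation laws are assumed off the lattice,
  where \<open>vtheta\<close> can be inverted.\<close>

lemma theta_multiple_vanishes:
  assumes d: "d holomorphic_on UNIV" "d 0 = 0" "deriv d 0 = 0"
    and 1: "\<And>z. z \<notin> lattice \<tau> \<Longrightarrow> d (z + 1) = ee a * d z"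
    and 2: "\<And>z. z \<notin> lattice \<tau> \<Longrightarrow> d (z + \<tau>) = ee b * ee (- (\<tau> / 2) - z)^2 * d z"
    and ab: "\<And>k::int. b - a * \<tau> - of_int k * \<tau> \<notin> \<int>"
  shows "d z = 0"
proof -
  have nl: "th z \<noteq> 0 \<longleftrightarrow> z \<notin> lattice \<tau>" for z by (simp add: vtheta_eq_0_iff[OF \<tau>])
  note nz = vtheta_half_nonzero[OF \<tau>]
  note thh = vtheta_entire[OF \<tau>]
  have d1: "d (z + 1) = ee a * d z" for z
    by (rule entire_eqI[OF _ _ thh nz, of "\<lambda>z. d (z + 1)"])
      (auto simp: nl 1 intro!: holomorphic_intros entire_compose[OF d(1)] d(1))
  have d2: "d (z + \<tau>) = ee b * ee (- (\<tau> / 2) - z)^2 * d z" for z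
    by (rule entire_eqI[OF _ _ thh nz, of "\<lambda>z. d (z + \<tau>)"])
      (auto simp: nl 2 intro!: holomorphic_intros entire_compose[OF d(1)] d(1))
  have dl: "d l = 0" if "th l = 0" for l
    using invariant_lattice_shift[of "\<lambda>z. d z = 0" \<tau> l 0] that d(2) by (simp add: d1 d2 nl[symmetric] vtheta_eq_0_iff[OF \<tau>])
  obtain h where h: "h holomorphic_on UNIV" "\<And>z. d z = h z * th z"
    using entire_divide[OF d(1) vtheta_simple_zeros[OF \<tau>] dl] by metis
  note h_multiplier = quotient_multiplier[OF h(1) thh nz]
  have h1: "h (z + 1) = - ee a * h z" for z
    using d1[unfolded h(2) vtheta_add_1] by (intro h_multiplier[where e = "\<lambda>_. - 1"]) simp_all
  have h2: "h (z + \<tau>) = - (ee b * ee (- (\<tau> / 2) - z)) * h z" for z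
    using d2[unfolded h(2) vtheta_add_tau]
    by (intro h_multiplier[where e = "\<lambda>z. - ee (- (\<tau> / 2) - z)"]) (auto simp: power2_eq_square mult_ac intro!: holomorphic_intros)
  have "((\<lambda>z. h z * th z) has_field_derivative h 0 * deriv th 0 + deriv h 0 * th 0) (at 0)"
    by (intro DERIV_mult' th_deriv holomorphic_derivI[OF h(1)]) auto
  moreover have "d = (\<lambda>z. h z * th z)" using h(2) by auto
  ultimately have "deriv d 0 = h 0 * deriv th 0" by (intro DERIV_imp_deriv) simp
  then have h0: "h 0 = 0" using d(3) vtheta_deriv_0[OF \<tau>] by simp
  have hl: "h l = 0" if "th l = 0" for l
    using invariant_lattice_shift[of "\<lambda>z. h z = 0" \<tau> l 0] that h0 by (simp add: h1 h2 vtheta_eq_0_iff[OF \<tau>])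
  obtain g where g: "g holomorphic_on UNIV" "\<And>z. h z = g z * th z"
    using entire_divide[OF h(1) vtheta_simple_zeros[OF \<tau>] hl] by metis
  note g_multiplier = quotient_multiplier[OF g(1) thh nz]
  have g1: "g (z + 1) = ee a * g z" for z
    using h1[unfolded g(2) vtheta_add_1] by (intro g_multiplier[where e = "\<lambda>_. - 1"]) auto
  have g2: "g (z + \<tau>) = ee b * g z" for z
    using h2[unfolded g(2) vtheta_add_tau]
    by (intro g_multiplier[where e = "\<lambda>z. - ee (- (\<tau> / 2) - z)"]) (auto simp: mult_ac)
  have "g z = 0"
    using entire_multipliers_nonzero[OF \<tau> g(1) g1 g2, of z] ab by metis
  then show ?thesis by (simp add: h(2) g(2))
qed

lemma L_CM_Lhat:
  assumes "z \<notin> lattice \<tau>"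
  shows "L_CM \<tau> \<nu> (v, u) z = mscale (inverse (th z)) (Lhat \<tau> \<nu> v u z)"
  using assms by (simp add: L_CM_def Lhat_def mscale_def vec_eq_iff phi_def vtheta_eq_0_iff[OF \<tau>] field_simps)

lemma Lhat_holomorphic: "(\<lambda>z. Lhat \<tau> \<nu> v u z $ j $ k) holomorphic_on UNIV"
  by (cases "j = k") (auto simp: Lhat_def intro!: holomorphic_intros entire_compose[OF vtheta_entire[OF \<tau>]] vtheta_entire[OF \<tau>])

lemma Kmat_holomorphic: "(\<lambda>z. Kmat \<tau> \<nu> v u z $ i $ l) holomorphic_on UNIV"
  unfolding Kmat_nth
  by (intro holomorphic_intros Lhat_holomorphic Amat_holomorphic[OF \<tau>] Bmat_holomorphic[OF \<tau>])

lemma thprod_u_deriv: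
  "deriv (thprod \<tau> (\<lambda>k. u $ k)) (u $ j) = deriv th 0 * (\<Prod>k\<in>UNIV - {j}. th (u $ j - u $ k))" for u :: "'n::finite cvec"
proof -
  let ?g = "\<lambda>y. \<Prod>k\<in>UNIV - {j}. th (y - u $ k)"
  have g: "?g holomorphic_on UNIV" by (intro holomorphic_intros entire_compose[OF vtheta_entire[OF \<tau>]])
  have "((\<lambda>y. th (y - u $ j)) has_field_derivative deriv th 0) (at (u $ j))"
    using th_deriv[of "u $ j - u $ j"] DERIV_shift[of th "deriv th 0" "u $ j" "- u $ j"] by simp
  then have "((\<lambda>y. th (y - u $ j) * ?g y) has_field_derivative th (u $ j - u $ j) * deriv ?g (u $ j) + deriv th 0 * ?g (u $ j)) (at (u $ j))"
    by (intro DERIV_mult' holomorphic_derivI[OF g]) auto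
  then show ?thesis
    unfolding thprod_split[of \<tau> "\<lambda>k. u $ k" _ j, abs_def] by (intro DERIV_imp_deriv) simp
qed

lemma psi_sum_deriv:
  fixes w :: "'n::{finite,linorder} cvec"
  shows "((\<lambda>y. \<Sum>i\<in>UNIV. w $ i * psi \<tau> i y) has_field_derivative (\<Sum>i\<in>UNIV. w $ i * deriv (psi \<tau> i) y)) (at y)"
  by (rule DERIV_finite_sum, rule DERIV_cmult, rule psi_deriv)

lemma wvec_deriv:
  fixes u :: "'n::{finite,linorder} cvec"
  assumes u: "admissible \<tau> u"
  shows "cc \<tau> u j * (\<Sum>i\<in>UNIV. wvec \<tau> u $ i * deriv (psi \<tau> i) (u $ j)) = - 1"
proof -
  have "(\<Sum>i\<in>UNIV. wvec \<tau> u $ i * deriv (psi \<tau> i) (u $ j)) = deriv (thprod \<tau> (\<lambda>k. u $ k)) (u $ j)"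
    using DERIV_imp_deriv[OF psi_sum_deriv, of "wvec \<tau> u" "u $ j"] unfolding wvec_rep[OF \<tau> u, symmetric] by simp
  then show ?thesis
    using vtheta_prod_nonzero[OF \<tau> u, of j] vtheta_deriv_0[OF \<tau>] by (simp add: thprod_u_deriv cc_def)
qed

text \<open>The terms of \<open>avec\<close> proportional to \<open>psi\<close> at a column point,
  among them the momenta, are annihilated by \<open>wvec\<close>. Each of the N derivative terms
  contributes \<nu> by \<open>wvec_deriv\<close>.\<close>

lemma bdot_wvec_avec:
  fixes u :: "'n::{finite,linorder} cvec"
  assumes u: "admissible \<tau> u"
  shows "bdot (wvec \<tau> u) (avec \<tau> \<nu> v u) = of_nat CARD('n) * \<nu>"
proof -
  let ?w = "wvec \<tau> u"
  have "bdot ?w (avec \<tau> \<nu> v u) = (\<Sum>i\<in>UNIV. \<Sum>j\<in>UNIV. cc \<tau> u j * (v $ j + \<nu> * (\<Sum>k\<in>UNIV - {j}. E1 \<tau> (u $ j - u $ k))) * (?w $ i * psi \<tau> i (u $ j))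
      - \<nu> * (cc \<tau> u j * (?w $ i * deriv (psi \<tau> i) (u $ j))))"
    unfolding bdot_def avec_def by (simp add: sum_distrib_left right_diff_distrib mult_ac)
  also have "\<dots> = (\<Sum>j\<in>UNIV. cc \<tau> u j * (v $ j + \<nu> * (\<Sum>k\<in>UNIV - {j}. E1 \<tau> (u $ j - u $ k))) * (\<Sum>i\<in>UNIV. ?w $ i * psi \<tau> i (u $ j))
      - \<nu> * (cc \<tau> u j * (\<Sum>i\<in>UNIV. ?w $ i * deriv (psi \<tau> i) (u $ j))))"
    unfolding sum_distrib_left sum_subtractf[symmetric] by (rule sum.swap)
  also have "\<dots> = of_nat CARD('n) * \<nu>"
    unfolding wvec_kernel[OF \<tau> u] wvec_deriv[OF u] by simp
  finally show ?thesis .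
qed

lemma Smat_orbit: "admissible \<tau> u \<Longrightarrow> \<nu> \<noteq> 0 \<Longrightarrow> Smat \<tau> \<nu> v u \<in> R_rot (S0 \<nu>)"
  unfolding Smat_def by (intro rank_one_orbit bdot_wvec_avec)

lemma Smat_trace: "admissible \<tau> u \<Longrightarrow> trace (Smat \<tau> \<nu> v (u :: 'n::{finite,linorder} cvec)) = 0"
  unfolding Smat_def trace_sub trace_outer
  by (simp add: bdot_commute[of "avec \<tau> \<nu> v u"] bdot_wvec_avec trace_def mat_def)

section \<open>Expansion of the conjugated matrix at its singular point\<close>

lemma Amat_deriv: "((\<lambda>z. Amat \<tau> u z $ i $ j) has_field_derivative dA \<tau> u $ i $ j) (at 0)"
  unfolding dA_def by (simp, rule holomorphic_derivI[OF Amat_holomorphic[OF \<tau>]]) auto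

lemma Bmat_deriv: "((\<lambda>z. Bmat \<tau> u z $ i $ j) has_field_derivative dB \<tau> u $ i $ j) (at 0)"
  unfolding dB_def by (simp, rule holomorphic_derivI[OF Bmat_holomorphic[OF \<tau>]]) auto

lemma dA_eq: "dA \<tau> u $ i $ j = - (cc \<tau> u j * deriv (psi \<tau> i) (u $ j)) / of_nat CARD('n)" for u :: "'n::{finite,linorder} cvec"
proof -
  have "((\<lambda>z. u $ j - z / of_nat CARD('n)) has_field_derivative (- 1 / of_nat CARD('n))) (at 0)"
    by (auto intro!: derivative_eq_intros)
  moreover have "(psi \<tau> i has_field_derivative deriv (psi \<tau> i) (u $ j)) (at (u $ j - 0 / of_nat CARD('n)))"
    using psi_deriv[of i "u $ j"] by simp
  ultimately have "((\<lambda>z. psi \<tau> i (u $ j - z / of_nat CARD('n))) has_field_derivative deriv (psi \<tau> i) (u $ j) * (- 1 / of_nat CARD('n))) (at 0)"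
    by (rule DERIV_chain2[rotated])
  then have "((\<lambda>z. Amat \<tau> u z $ i $ j) has_field_derivative deriv (psi \<tau> i) (u $ j) * (- 1 / of_nat CARD('n)) * cc \<tau> u j) (at 0)"
    unfolding Amat_def vec_lambda_beta by (rule DERIV_cmult_right)
  from DERIV_unique[OF Amat_deriv this] show ?thesis by simp
qed

lemma Lhat_deriv:
  "((\<lambda>z. Lhat \<tau> \<nu> v u z $ j $ k) has_field_derivative deriv th 0 * (if j = k then v $ j else \<nu> * E1 \<tau> (u $ j - u $ k))) (at 0)"
proof (cases "j = k")
  case True
  then show ?thesis using DERIV_cmult[OF th_deriv, of "v $ j" 0] by (simp add: Lhat_def mult.commute)
next
  case False
  have "((\<lambda>z. th (z + (u $ j - u $ k))) has_field_derivative deriv th (u $ j - u $ k)) (at 0)"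
    using th_deriv[of "0 + (u $ j - u $ k)"] DERIV_shift[of th _ 0 "u $ j - u $ k"] by simp
  from DERIV_cmult[OF this, of "\<nu> * deriv th 0 / th (u $ j - u $ k)"] False show ?thesis
    by (simp add: Lhat_def E1_def mult_ac add.commute)
qed

lemma Lhat_0: "admissible \<tau> u \<Longrightarrow> Lhat \<tau> \<nu> v u 0 $ j $ k = (if j = k then 0 else \<nu> * deriv th 0)"
  using vtheta_diff_nonzero[OF \<tau>, of u j k] by (simp add: Lhat_def)

lemma Lhat_0_sum:
  fixes u :: "'n::finite cvec"
  assumes "admissible \<tau> u"
  shows "(\<Sum>k\<in>UNIV. Lhat \<tau> \<nu> v u 0 $ j $ k) = (of_nat CARD('n) - 1) * (\<nu> * deriv th 0)"
  unfolding Lhat_0[OF assms] sum_not_eq by (simp add: algebra_simps)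

text \<open>B(0) has equal rows, the vector (1, ..., 1) is an eigenvector of the residue of the Lax
  matrix, and A(0) annihilates it. This removes the double pole.\<close>

lemma Kmat_0:
  fixes u :: "'n::{finite,linorder} cvec"
  assumes u: "admissible \<tau> u"
  shows "Kmat \<tau> \<nu> v u 0 = 0"
proof -
  have "Kmat \<tau> \<nu> v u 0 $ i $ l = (\<Sum>j\<in>UNIV. Amat \<tau> u 0 $ i $ j * ((\<Sum>k\<in>UNIV. Lhat \<tau> \<nu> v u 0 $ j $ k) * (deriv th 0 * wvec \<tau> u $ l)))" for i l
    unfolding Kmat_nth Bmat_0[OF \<tau>] by (simp add: sum_distrib_left sum_distrib_right mult_ac)
  then show ?thesis
    unfolding Lhat_0_sum[OF u] sum_distrib_right[symmetric] by (simp add: vec_eq_iff Amat_0_row_sum[OF \<tau> u])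
qed

text \<open>The derivative of A B = \<open>vtheta\<close> at 0; it stands in for the missing inverse
  of A(0).\<close>

lemma Amat_dB:
  fixes u :: "'n::{finite,linorder} cvec"
  assumes u: "admissible \<tau> u"
  shows "(\<Sum>j\<in>UNIV. Amat \<tau> u 0 $ i $ j * dB \<tau> u $ j $ l) = deriv th 0 * ((if i = l then 1 else 0) - (\<Sum>j\<in>UNIV. dA \<tau> u $ i $ j) * wvec \<tau> u $ l)"
proof -
  have 1: "((\<lambda>z. (\<Sum>j\<in>UNIV. Amat \<tau> u z $ i $ j * Bmat \<tau> u z $ j $ l)) has_field_derivative
     (\<Sum>j\<in>UNIV. Amat \<tau> u 0 $ i $ j * dB \<tau> u $ j $ l + dA \<tau> u $ i $ j * Bmat \<tau> u 0 $ j $ l)) (at 0)"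
    by (rule DERIV_finite_sum, rule DERIV_mult'[OF Amat_deriv Bmat_deriv])
  have 2: "(\<Sum>j\<in>UNIV. Amat \<tau> u z $ i $ j * Bmat \<tau> u z $ j $ l) = (if i = l then 1 else 0) * th z" for z
    using arg_cong[OF Amat_Bmat[OF \<tau> u, of z], of "\<lambda>M. M $ i $ l"] by (simp add: matrix_matrix_mult_def mat_def)
  have 3: "((\<lambda>z. (if i = l then 1 else 0) * th z) has_field_derivative (if i = l then 1 else 0) * deriv th 0) (at 0)"
    by (intro DERIV_cmult th_deriv)
  have "(\<Sum>j\<in>UNIV. Amat \<tau> u 0 $ i $ j * dB \<tau> u $ j $ l + dA \<tau> u $ i $ j * Bmat \<tau> u 0 $ j $ l) = (if i = l then 1 else 0) * deriv th 0"
    by (rule DERIV_unique[OF 1[unfolded 2] 3])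
  then show ?thesis
    by (simp add: Bmat_0[OF \<tau>] sum.distrib sum_distrib_right sum_distrib_left algebra_simps split: if_splits)
qed

lemma avec_dA:
  fixes u :: "'n::{finite,linorder} cvec"
  shows "avec \<tau> \<nu> v u $ i = \<nu> * of_nat CARD('n) * (\<Sum>j\<in>UNIV. dA \<tau> u $ i $ j)
    + (\<Sum>j\<in>UNIV. Amat \<tau> u 0 $ i $ j * (\<Sum>k\<in>UNIV. if j = k then v $ j else \<nu> * E1 \<tau> (u $ j - u $ k)))"
proof -
  have "(\<Sum>k\<in>UNIV. if j = k then v $ j else \<nu> * E1 \<tau> (u $ j - u $ k)) = v $ j + \<nu> * (\<Sum>k\<in>UNIV - {j}. E1 \<tau> (u $ j - u $ k))" for j
  proof -
    have "(\<Sum>k\<in>UNIV. if j = k then v $ j else \<nu> * E1 \<tau> (u $ j - u $ k)) = v $ j + (\<Sum>k\<in>UNIV - {j}. if j = k then v $ j else \<nu> * E1 \<tau> (u $ j - u $ k))"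
      by (subst sum.remove[of _ j]) auto
    also have "(\<Sum>k\<in>UNIV - {j}. if j = k then v $ j else \<nu> * E1 \<tau> (u $ j - u $ k)) = (\<Sum>k\<in>UNIV - {j}. \<nu> * E1 \<tau> (u $ j - u $ k))"
      by (intro sum.cong) auto
    finally show ?thesis by (simp add: sum_distrib_left)
  qed
  moreover have "\<nu> * of_nat CARD('n) * (\<Sum>j\<in>UNIV. dA \<tau> u $ i $ j) = (\<Sum>j\<in>UNIV. - (cc \<tau> u j * (\<nu> * deriv (psi \<tau> i) (u $ j))))"
    unfolding dA_eq sum_distrib_left by (intro sum.cong refl) simp
  ultimately show ?thesis
    by (simp add: avec_def Amat_def sum.distrib[symmetric] right_diff_distrib mult_ac)
qed

lemma Kmat_deriv:
  fixes u :: "'n::{finite,linorder} cvec"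
  assumes u: "admissible \<tau> u"
  shows "((\<lambda>z. Kmat \<tau> \<nu> v u z $ i $ l) has_field_derivative (deriv th 0)^2 * Smat \<tau> \<nu> v u $ i $ l) (at 0)"
proof -
  let ?A = "Amat \<tau> u 0" and ?w = "wvec \<tau> u $ l" and ?d = "deriv th 0"
  let ?L = "\<lambda>j k. if j = k then v $ j else \<nu> * E1 \<tau> (u $ j - u $ k)"
  let ?D = "\<Sum>j\<in>UNIV. dA \<tau> u $ i $ j"
  have "((\<lambda>z. Kmat \<tau> \<nu> v u z $ i $ l) has_field_derivative
    (\<Sum>j\<in>UNIV. \<Sum>k\<in>UNIV. (?A $ i $ j * Lhat \<tau> \<nu> v u 0 $ j $ k) * dB \<tau> u $ k $ l
       + (?A $ i $ j * (?d * ?L j k) + dA \<tau> u $ i $ j * Lhat \<tau> \<nu> v u 0 $ j $ k) * Bmat \<tau> u 0 $ k $ l)) (at 0)"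
    unfolding Kmat_nth by (rule DERIV_finite_sum, rule DERIV_finite_sum, rule DERIV_mult'[OF DERIV_mult'[OF Amat_deriv Lhat_deriv] Bmat_deriv])
  also have "(\<Sum>j\<in>UNIV. \<Sum>k\<in>UNIV. (?A $ i $ j * Lhat \<tau> \<nu> v u 0 $ j $ k) * dB \<tau> u $ k $ l
       + (?A $ i $ j * (?d * ?L j k) + dA \<tau> u $ i $ j * Lhat \<tau> \<nu> v u 0 $ j $ k) * Bmat \<tau> u 0 $ k $ l) =
     (\<Sum>j\<in>UNIV. ?A $ i $ j * (\<Sum>k\<in>UNIV. Lhat \<tau> \<nu> v u 0 $ j $ k * dB \<tau> u $ k $ l))
     + ?d^2 * ?w * (\<Sum>j\<in>UNIV. ?A $ i $ j * (\<Sum>k\<in>UNIV. ?L j k))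
     + (\<Sum>j\<in>UNIV. dA \<tau> u $ i $ j * (\<Sum>k\<in>UNIV. Lhat \<tau> \<nu> v u 0 $ j $ k)) * (?d * ?w)"
    unfolding Bmat_0[OF \<tau>]
    by (simp add: ring_distribs sum.distrib sum_distrib_left sum_distrib_right power2_eq_square mult_ac)
  \<comment> \<open>At 0 \<open>Lhat\<close> is a multiple of the all-ones matrix minus the
    identity. The first part dies because the rows of \<open>?A\<close> sum to 0. The identity part
    produces the scalar - \<nu> and, through \<open>Amat_dB\<close>, one more copy of the rank one
    term, completing N - 1 to N.\<close>
  also have "(\<Sum>j\<in>UNIV. ?A $ i $ j * (\<Sum>k\<in>UNIV. Lhat \<tau> \<nu> v u 0 $ j $ k * dB \<tau> u $ k $ l)) = - (\<nu> * ?d * (\<Sum>j\<in>UNIV. ?A $ i $ j * dB \<tau> u $ j $ l))"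
  proof -
    have "(\<Sum>k\<in>UNIV. Lhat \<tau> \<nu> v u 0 $ j $ k * dB \<tau> u $ k $ l) = \<nu> * ?d * ((\<Sum>k\<in>UNIV. dB \<tau> u $ k $ l) - dB \<tau> u $ j $ l)" for j
    proof -
      have "(\<Sum>k\<in>UNIV. Lhat \<tau> \<nu> v u 0 $ j $ k * dB \<tau> u $ k $ l) = (\<Sum>k\<in>UNIV. if j = k then 0 else \<nu> * ?d * dB \<tau> u $ k $ l)"
        by (intro sum.cong refl) (simp add: Lhat_0[OF u])
      then show ?thesis unfolding sum_not_eq by (simp add: sum_distrib_left right_diff_distrib)
    qed
    then have "(\<Sum>j\<in>UNIV. ?A $ i $ j * (\<Sum>k\<in>UNIV. Lhat \<tau> \<nu> v u 0 $ j $ k * dB \<tau> u $ k $ l)) =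
      \<nu> * ?d * ((\<Sum>j\<in>UNIV. ?A $ i $ j) * (\<Sum>k\<in>UNIV. dB \<tau> u $ k $ l)) - \<nu> * ?d * (\<Sum>j\<in>UNIV. ?A $ i $ j * dB \<tau> u $ j $ l)"
      unfolding sum_distrib_right by (simp add: sum_distrib_left right_diff_distrib sum_subtractf mult_ac)
    then show ?thesis by (simp add: Amat_0_row_sum[OF \<tau> u])
  qed
  also have "(\<Sum>j\<in>UNIV. dA \<tau> u $ i $ j * (\<Sum>k\<in>UNIV. Lhat \<tau> \<nu> v u 0 $ j $ k)) = ?D * ((of_nat CARD('n) - 1) * (\<nu> * ?d))"
    unfolding Lhat_0_sum[OF u] sum_distrib_right ..
  also have "- (\<nu> * ?d * (\<Sum>j\<in>UNIV. ?A $ i $ j * dB \<tau> u $ j $ l)) + ?d^2 * ?w * (\<Sum>j\<in>UNIV. ?A $ i $ j * (\<Sum>k\<in>UNIV. ?L j k))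
     + ?D * ((of_nat CARD('n) - 1) * (\<nu> * ?d)) * (?d * ?w) = ?d^2 * Smat \<tau> \<nu> v u $ i $ l"
    unfolding Amat_dB[OF u] Smat_def by (simp add: outer_def mat_def avec_dA power2_eq_square algebra_simps)
  finally show ?thesis .
qed

text \<open>Reduces a transformation law to the intertwining relation X A = A L, into which the
  translation laws of the rows of A can be inserted directly.\<close>

lemma conjugate_unique:
  assumes u: "admissible \<tau> u" and z: "z \<notin> lattice \<tau>" and X: "X ** Amat \<tau> u z = Amat \<tau> u z ** L"
  shows "X = mscale (inverse (th z)) (Amat \<tau> u z ** L ** Bmat \<tau> u z)"
proof -
  have "X = X ** (Amat \<tau> u z ** mscale (inverse (th z)) (Bmat \<tau> u z))"
    using Amat_invertible_off[OF \<tau> u] z by (simp add: vtheta_eq_0_iff[OF \<tau>])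
  also have "\<dots> = mscale (inverse (th z)) (Amat \<tau> u z ** L ** Bmat \<tau> u z)"
    by (simp add: matrix_mul_assoc X mscale_mult_right)
  finally show ?thesis .
qed

lemma conjugate_apply:
  assumes u: "admissible \<tau> u" and z: "z \<notin> lattice \<tau>"
  shows "mscale (inverse (th z)) (Amat \<tau> u z ** L ** Bmat \<tau> u z) ** Amat \<tau> u z = Amat \<tau> u z ** L"
proof -
  have "mscale (inverse (th z)) (Amat \<tau> u z ** L ** Bmat \<tau> u z) ** Amat \<tau> u z = mscale (inverse (th z)) (Amat \<tau> u z ** L ** (Bmat \<tau> u z ** Amat \<tau> u z))"
    by (simp add: mscale_mult_left matrix_mul_assoc)
  also have "\<dots> = Amat \<tau> u z ** L"
    using z by (simp add: Bmat_Amat[OF \<tau> u] mat_mult_right mscale_mscale mscale_1 vtheta_eq_0_iff[OF \<tau>])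
  finally show ?thesis .
qed

lemma Mmat_Kmat: "z \<notin> lattice \<tau> \<Longrightarrow> Mmat \<tau> \<nu> v u z = mscale (inverse (th z ^ 2)) (Kmat \<tau> \<nu> v u z)"
  unfolding Mmat_def L_CM_Lhat Kmat_def
  by (simp add: mscale_mult_left mscale_mult_right mscale_mscale power2_eq_square)

section \<open>Multipliers of the conjugated Lax matrix\<close>

lemma lattice_add_1_iff: "z + 1 \<in> lattice \<tau> \<longleftrightarrow> z \<in> lattice \<tau>"
  by (metis vtheta_eq_0_iff[OF \<tau>] vtheta_add_1 neg_equal_0_iff_equal)

lemma lattice_add_tau_iff: "z + \<tau> \<in> lattice \<tau> \<longleftrightarrow> z \<in> lattice \<tau>"
  by (metis vtheta_eq_0_iff[OF \<tau>] vtheta_add_tau neg_equal_0_iff_equal mult_eq_0_iff ee_nonzero)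

text \<open>\<open>L_CM\<close> has period 1 and the rows of A are multiplied by the eigenvalues
  from \<open>psi_shift\<close>, so the effect is conjugation by \<open>Qmat\<close>; the common
  factor -1 cancels.\<close>

lemma Mmat_add_1:
  fixes u :: "'n::{finite,linorder} cvec"
  assumes u: "admissible \<tau> u" and z: "z \<notin> lattice \<tau>"
  shows "Mmat \<tau> \<nu> v u (z + 1) = (\<chi> i j. ee ((of_nat (idx i) - of_nat (idx j)) / of_nat CARD('n)) * Mmat \<tau> \<nu> v u z $ i $ j)"
    (is "_ = ?X")
proof -
  let ?N = "of_nat CARD('n) :: complex"
  have A: "Amat \<tau> u (z + 1) $ i $ j = ee (of_nat (idx i) / ?N - 1/2) * Amat \<tau> u z $ i $ j" for i j
    using psi_shift[of \<tau> i "u $ j - z / ?N" 1] by (simp add: Amat_def add_divide_distrib diff_diff_eq)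
  have L: "L_CM \<tau> \<nu> (v, u) (z + 1) = L_CM \<tau> \<nu> (v, u) z"
    by (simp add: L_CM_def phi_def vec_eq_iff add.assoc[symmetric] vtheta_add_1)
  have "?X ** Amat \<tau> u (z + 1) = Amat \<tau> u (z + 1) ** L_CM \<tau> \<nu> (v, u) (z + 1)"
  proof -
    have "(?X ** Amat \<tau> u (z + 1)) $ i $ j = (Amat \<tau> u (z + 1) ** L_CM \<tau> \<nu> (v, u) (z + 1)) $ i $ j" for i j
    proof -
      have "(?X ** Amat \<tau> u (z + 1)) $ i $ j = (\<Sum>k\<in>UNIV. ee (of_nat (idx i) / ?N - 1/2) * (Mmat \<tau> \<nu> v u z $ i $ k * Amat \<tau> u z $ k $ j))"
        unfolding matrix_matrix_mult_def vec_lambda_beta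
      proof (intro sum.cong refl)
        fix k :: 'n
        have e: "ee ((of_nat (idx i) - of_nat (idx k)) / ?N) * ee (of_nat (idx k) / ?N - 1/2) = ee (of_nat (idx i) / ?N - 1/2)"
          unfolding ee_add[symmetric] by (simp add: diff_divide_distrib)
        show "ee ((of_nat (idx i) - of_nat (idx k)) / ?N) * Mmat \<tau> \<nu> v u z $ i $ k * Amat \<tau> u (z + 1) $ k $ j =
          ee (of_nat (idx i) / ?N - 1/2) * (Mmat \<tau> \<nu> v u z $ i $ k * Amat \<tau> u z $ k $ j)"
          unfolding A e[symmetric] by (simp only: mult_ac)
      qed
      also have "\<dots> = ee (of_nat (idx i) / ?N - 1/2) * (Mmat \<tau> \<nu> v u z ** Amat \<tau> u z) $ i $ j"
        by (simp add: matrix_matrix_mult_def sum_distrib_left)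
      also have "Mmat \<tau> \<nu> v u z ** Amat \<tau> u z = Amat \<tau> u z ** L_CM \<tau> \<nu> (v, u) z"
        unfolding Mmat_def by (rule conjugate_apply[OF u z])
      finally show ?thesis
        unfolding L by (simp add: matrix_matrix_mult_def A sum_distrib_left mult.assoc)
    qed
    then show ?thesis by (simp add: vec_eq_iff)
  qed
  from conjugate_unique[OF u _ this] z show ?thesis
    unfolding Mmat_def[of \<tau> \<nu> v u "z + 1"] by (simp add: lattice_add_1_iff)
qed

text \<open>A acquires the diagonal matrix of the \<open>ee (u $ j)\<close> on the right, and
  \<open>L_CM\<close> is conjugated by the same matrix, so that it cancels. What remains is the
  cyclic permutation of rows from \<open>psi_tau_shift\<close>.\<close>

lemma Mmat_add_tau:
  fixes u :: "'n::{finite,linorder} cvec"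
  assumes u: "admissible \<tau> u" and z: "z \<notin> lattice \<tau>"
  shows "Mmat \<tau> \<nu> v u (z + \<tau>) = (\<chi> i j. Mmat \<tau> \<nu> v u z $ nxt i $ nxt j)" (is "_ = ?X")
proof -
  let ?N = "of_nat CARD('n) :: complex"
  let ?e = "ee (- (\<tau> / (2 * ?N)) - z / ?N - 1/2)"
  have A: "Amat \<tau> u (z + \<tau>) $ i $ j = ?e * ee (u $ j) * Amat \<tau> u z $ nxt i $ j" for i j
  proof -
    have "ee (- (\<tau> / (2 * ?N)) + (u $ j - z / ?N) - 1/2) = ?e * ee (u $ j)"
      unfolding ee_add[symmetric] by (simp add: algebra_simps)
    then show ?thesis
      using psi_tau_shift[of \<tau> i "u $ j - z / ?N"] by (simp add: Amat_def add_divide_distrib diff_diff_eq)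
  qed
  have ph: "phi \<tau> x (z + \<tau>) = ee (- x) * phi \<tau> x z" for x
  proof -
    have "ee (- (\<tau> / 2) - (x + z)) = ee (- x) * ee (- (\<tau> / 2) - z)"
      unfolding ee_add[symmetric] by (rule arg_cong[where f = ee]) simp
    then show ?thesis
      using vtheta_add_tau[of "x + z" \<tau>] vtheta_add_tau[of z \<tau>] unfolding phi_def add.assoc[symmetric]
      by simp
  qed
  have L: "ee (u $ j) * L_CM \<tau> \<nu> (v, u) (z + \<tau>) $ j $ k = L_CM \<tau> \<nu> (v, u) z $ j $ k * ee (u $ k)" for j k
  proof -
    have "ee (u $ j) * ee (- (u $ j - u $ k)) = ee (u $ k)" unfolding ee_add[symmetric] by simp
    then show ?thesis by (simp add: L_CM_def ph)
  qed
  have "?X ** Amat \<tau> u (z + \<tau>) = Amat \<tau> u (z + \<tau>) ** L_CM \<tau> \<nu> (v, u) (z + \<tau>)"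
  proof -
    have "(?X ** Amat \<tau> u (z + \<tau>)) $ i $ j = (Amat \<tau> u (z + \<tau>) ** L_CM \<tau> \<nu> (v, u) (z + \<tau>)) $ i $ j" for i j
    proof -
      have "(?X ** Amat \<tau> u (z + \<tau>)) $ i $ j = ?e * ee (u $ j) * (\<Sum>k\<in>UNIV. Mmat \<tau> \<nu> v u z $ nxt i $ nxt k * Amat \<tau> u z $ nxt k $ j)"
        by (simp add: matrix_matrix_mult_def A sum_distrib_left mult_ac)
      also have "(\<Sum>k\<in>UNIV. Mmat \<tau> \<nu> v u z $ nxt i $ nxt k * Amat \<tau> u z $ nxt k $ j) = (\<Sum>k\<in>UNIV. Mmat \<tau> \<nu> v u z $ nxt i $ k * Amat \<tau> u z $ k $ j)"
        by (rule sum.reindex_bij_betw[OF nxt_bij])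
      also have "\<dots> = (Mmat \<tau> \<nu> v u z ** Amat \<tau> u z) $ nxt i $ j"
        by (simp add: matrix_matrix_mult_def)
      also have "Mmat \<tau> \<nu> v u z ** Amat \<tau> u z = Amat \<tau> u z ** L_CM \<tau> \<nu> (v, u) z"
        unfolding Mmat_def by (rule conjugate_apply[OF u z])
      also have "?e * ee (u $ j) * (Amat \<tau> u z ** L_CM \<tau> \<nu> (v, u) z) $ nxt i $ j = (\<Sum>k\<in>UNIV. ?e * Amat \<tau> u z $ nxt i $ k * (L_CM \<tau> \<nu> (v, u) z $ k $ j * ee (u $ j)))"
        by (simp add: matrix_matrix_mult_def sum_distrib_left mult_ac)
      also have "\<dots> = (Amat \<tau> u (z + \<tau>) ** L_CM \<tau> \<nu> (v, u) (z + \<tau>)) $ i $ j"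
        unfolding L[symmetric] by (simp add: matrix_matrix_mult_def A mult_ac)
      finally show ?thesis .
    qed
    then show ?thesis by (simp add: vec_eq_iff)
  qed
  from conjugate_unique[OF u _ this] z show ?thesis
    unfolding Mmat_def[of \<tau> \<nu> v u "z + \<tau>"] by (simp add: lattice_add_tau_iff)
qed

section \<open>Comparison with the Lax matrix of the rotator\<close>

lemma omega_notin_lattice:
  assumes "m < N" "n < N" "(m, n) \<noteq> (0, 0)"
  shows "(of_nat m + of_nat n * \<tau>) / of_nat N - of_int k * \<tau> \<notin> \<int>"
proof
  assume "(of_nat m + of_nat n * \<tau>) / of_nat N - of_int k * \<tau> \<in> \<int>"
  then obtain l :: int where "(of_nat m + of_nat n * \<tau>) / of_nat N - of_int k * \<tau> = of_int l" by (auto elim: Ints_cases)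
  then have e: "of_nat m + of_nat n * \<tau> = of_nat N * of_int l + of_nat N * of_int k * \<tau>"
    using assms(1) by (simp add: field_simps)
  from arg_cong[OF this, of Im] have "real n * Im \<tau> = (real N * of_int k) * Im \<tau>" by simp
  then have "real n = real N * of_int k" using \<tau> by simp
  then have n: "of_int (int n) = (of_int (int N * k) :: real)" by simp
  then have "int n = int N * k" by (simp only: of_int_eq_iff)
  then have "int N dvd int n" by simp
  then have n0: "n = 0" using assms(2) by (auto dest: dvd_imp_le)
  with \<open>int n = int N * k\<close> assms(1) have "k = 0" by simp
  with e n0 have "of_int (int m) = (of_int (int N * l) :: complex)" by simp
  then have "int m = int N * l" by (simp only: of_int_eq_iff)
  then have "int N dvd int m" by simp
  then have "m = 0" using assms(1) by (auto dest: dvd_imp_le)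
  then show False using n0 assms(3) by simp
qed

lemma th_omega_nonzero:
  assumes "m < N" "n < N" "(m, n) \<noteq> (0, 0)"
  shows "th (- ((of_nat m + of_nat n * \<tau>) / of_nat N)) \<noteq> 0"
proof
  assume "th (- ((of_nat m + of_nat n * \<tau>) / of_nat N)) = 0"
  then obtain l k :: int where "(of_nat m + of_nat n * \<tau>) / of_nat N = of_int l + of_int k * \<tau>"
    unfolding vtheta_eq_0_iff[OF \<tau>] lattice_minus_iff by (auto simp: lattice_def)
  then have "(of_nat m + of_nat n * \<tau>) / of_nat N - of_int k * \<tau> \<in> \<int>" by simp
  then show False using omega_notin_lattice[OF assms] by simp
qed

lemma Mmat_L_rot:
  fixes u v :: "'n::{finite,linorder} cvec"
  assumes u: "admissible \<tau> u" and v: "(\<Sum>j\<in>UNIV. v $ j) = 0" and z: "z \<notin> lattice \<tau>"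
  shows "Mmat \<tau> \<nu> v u z = L_rot \<tau> (Smat \<tau> \<nu> v u) z"
proof (rule E_coef_eqI)
  let ?N = "CARD('n)"
  fix m n assume mn: "m < ?N" "n < ?N"
  let ?S = "Smat \<tau> \<nu> v u"
  define s where "s = E_coef m n ?S"
  define \<omega> where "\<omega> = (of_nat m + of_nat n * \<tau>) / of_nat ?N"
  define \<kappa> where "\<kappa> = (\<lambda>z. E_coef m n (Kmat \<tau> \<nu> v u z))"
  have \<kappa>M: "E_coef m n (Mmat \<tau> \<nu> v u z) = inverse (th z ^ 2) * \<kappa> z" if "z \<notin> lattice \<tau>" for z
    unfolding Mmat_Kmat[OF that] E_coef_mscale \<kappa>_def ..
  have \<kappa>h: "\<kappa> holomorphic_on UNIV" unfolding \<kappa>_def by (rule E_coef_holomorphic[OF Kmat_holomorphic])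
  show "E_coef m n (Mmat \<tau> \<nu> v u z) = E_coef m n (L_rot \<tau> ?S z)"
  proof (cases "(m, n) = (0, 0)")
    case True
    \<comment> \<open>Index (0, 0) is the resonant case, in which Liouville would leave a constant
      undetermined. Here the trace decides: it is invariant under conjugation and equals sum v_j =
      0.\<close>
    have "trace (Kmat \<tau> \<nu> v u z) = trace (Bmat \<tau> u z ** (Amat \<tau> u z ** Lhat \<tau> \<nu> v u z))"
      unfolding Kmat_def by (rule trace_mul_sym)
    also have "\<dots> = th z * trace (Lhat \<tau> \<nu> v u z)"
      by (simp add: matrix_mul_assoc Bmat_Amat[OF \<tau> u] mat_mult_left mscale_def trace_def sum_distrib_left)
    also have "trace (Lhat \<tau> \<nu> v u z) = (\<Sum>j\<in>UNIV. v $ j) * th z"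
      by (simp add: trace_def Lhat_def sum_distrib_right)
    finally have "\<kappa> z = 0" using True v by (simp add: \<kappa>_def E_coef_0_0)
    then show ?thesis
      unfolding \<kappa>M[OF z] L_rot_coef[OF Smat_trace[OF u] mn] using True by simp
  next
    case False
    have \<omega>: "th (- \<omega>) \<noteq> 0" unfolding \<omega>_def by (rule th_omega_nonzero[OF mn False])
    \<comment> \<open>The coefficient of \<open>L_rot\<close> times the square of
      \<open>vtheta\<close>, to be compared with \<open>\<kappa>\<close>, the same multiple of the
      conjugated matrix. Both vanish at 0, and their derivatives agree there because both residues
      are \<open>?S\<close>.\<close>
    define r where "r = (\<lambda>z. s * ee (- (of_nat n * z / of_nat ?N)) * (th (z - \<omega>) * th z * deriv th 0 / th (- \<omega>)))"
    define d where "d = (\<lambda>z. \<kappa> z - r z)"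
    have rh: "r holomorphic_on UNIV"
      unfolding r_def by (intro holomorphic_intros entire_compose[OF vtheta_entire[OF \<tau>]]) (use \<omega> in auto)
    have "d z = 0"
    proof (rule theta_multiple_vanishes[of d "- (of_nat n / of_nat ?N)" "of_nat m / of_nat ?N"])
      show "d holomorphic_on UNIV" unfolding d_def by (intro holomorphic_intros \<kappa>h rh)
      show "d 0 = 0" by (simp add: d_def \<kappa>_def r_def Kmat_0[OF u] E_coef_def)
      have dk: "(\<kappa> has_field_derivative E_coef m n (mscale ((deriv th 0)^2) ?S)) (at 0)"
        unfolding \<kappa>_def by (rule E_coef_deriv) (simp add: mscale_def Kmat_deriv[OF u])
      let ?f = "\<lambda>z. s * ee (- (of_nat n * z / of_nat ?N)) * (th (z - \<omega>) * deriv th 0 / th (- \<omega>))"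
      have fh: "?f holomorphic_on UNIV"
        by (intro holomorphic_intros entire_compose[OF vtheta_entire[OF \<tau>]]) (use \<omega> in auto)
      have "((\<lambda>z. ?f z * th z) has_field_derivative ?f 0 * deriv th 0 + deriv ?f 0 * th 0) (at 0)"
        by (intro DERIV_mult' th_deriv holomorphic_derivI[OF fh]) auto
      then have dr: "(r has_field_derivative s * (deriv th 0)^2) (at 0)"
        using \<omega> by (simp add: r_def power2_eq_square mult_ac)
      have "deriv d 0 = E_coef m n (mscale ((deriv th 0)^2) ?S) - s * (deriv th 0)^2"
        unfolding d_def by (intro DERIV_imp_deriv DERIV_diff dk dr)
      then show "deriv d 0 = 0" by (simp add: E_coef_mscale s_def)
      fix z assume z: "z \<notin> lattice \<tau>"
      then have tz: "th z \<noteq> 0" by (simp add: vtheta_eq_0_iff[OF \<tau>])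
      have "inverse (th (z + 1) ^ 2) * \<kappa> (z + 1) = ee (- (of_nat n / of_nat ?N)) * (inverse (th z ^ 2) * \<kappa> z)"
        unfolding \<kappa>M[OF z, symmetric] using z by (subst \<kappa>M[symmetric]) (simp_all add: lattice_add_1_iff Mmat_add_1[OF u z] E_coef_diag_conj)
      then have k1: "\<kappa> (z + 1) = ee (- (of_nat n / of_nat ?N)) * \<kappa> z"
        using tz unfolding vtheta_add_1 by (simp add: field_simps)
      have "ee (- (of_nat n * (z + 1) / of_nat ?N)) = ee (- (of_nat n / of_nat ?N)) * ee (- (of_nat n * z / of_nat ?N))"
        unfolding ee_add[symmetric] by (rule arg_cong[where f = ee]) (simp add: field_simps)
      then have "r (z + 1) = ee (- (of_nat n / of_nat ?N)) * r z"
        using vtheta_add_1[of "z - \<omega>" \<tau>] vtheta_add_1[of z \<tau>] by (simp add: r_def add_diff_eq[symmetric] diff_add_eq mult_ac)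
      with k1 show "d (z + 1) = ee (- (of_nat n / of_nat ?N)) * d z" by (simp add: d_def right_diff_distrib)
      have "inverse (th (z + \<tau>) ^ 2) * \<kappa> (z + \<tau>) = ee (of_nat m / of_nat ?N) * (inverse (th z ^ 2) * \<kappa> z)"
        unfolding \<kappa>M[OF z, symmetric] using z by (subst \<kappa>M[symmetric]) (simp_all add: lattice_add_tau_iff Mmat_add_tau[OF u z] E_coef_nxt_conj)
      then have k2: "\<kappa> (z + \<tau>) = ee (of_nat m / of_nat ?N) * ee (- (\<tau> / 2) - z)^2 * \<kappa> z"
        using tz unfolding vtheta_add_tau by (simp add: power_mult_distrib divide_simps del: ee_nonzero) (simp add: mult_ac)
      \<comment> \<open>The phase \<open>ee \<omega>\<close> from the translated theta function and
        the phase of the exponential factor combine to ee (m / N), since \<omega> - n \<tau> / N = m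
        / N.\<close>
      have "ee (- (of_nat n * (z + \<tau>) / of_nat ?N)) * ee (- (\<tau> / 2) - (z - \<omega>)) = ee (of_nat m / of_nat ?N) * ee (- (\<tau> / 2) - z) * ee (- (of_nat n * z / of_nat ?N))"
        unfolding ee_add[symmetric] by (rule arg_cong[where f = ee]) (simp add: \<omega>_def field_simps)
      then have "s * (ee (- (of_nat n * (z + \<tau>) / of_nat ?N)) * ee (- (\<tau> / 2) - (z - \<omega>))) * (th (z - \<omega>) * (ee (- (\<tau> / 2) - z) * th z) * deriv th 0 / th (- \<omega>)) =
        s * (ee (of_nat m / of_nat ?N) * ee (- (\<tau> / 2) - z) * ee (- (of_nat n * z / of_nat ?N))) * (th (z - \<omega>) * (ee (- (\<tau> / 2) - z) * th z) * deriv th 0 / th (- \<omega>))"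
        by (simp only:)
      then have "r (z + \<tau>) = ee (of_nat m / of_nat ?N) * ee (- (\<tau> / 2) - z)^2 * r z"
        using vtheta_add_tau[of "z - \<omega>" \<tau>] vtheta_add_tau[of z \<tau>]
        by (simp add: r_def add_diff_eq[symmetric] diff_add_eq power2_eq_square mult_ac)
      with k2 show "d (z + \<tau>) = ee (of_nat m / of_nat ?N) * ee (- (\<tau> / 2) - z)^2 * d z" by (simp add: d_def right_diff_distrib)
    next
      fix k :: int
      have "of_nat m / of_nat ?N - - (of_nat n / of_nat ?N) * \<tau> = \<omega>" by (simp add: \<omega>_def add_divide_distrib)
      then show "of_nat m / of_nat ?N - - (of_nat n / of_nat ?N) * \<tau> - of_int k * \<tau> \<notin> \<int>"
        using omega_notin_lattice[OF mn False, of k] by (simp add: \<omega>_def)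
    qed
    then have "\<kappa> z = r z" by (simp add: d_def)
    moreover have "th z \<noteq> 0" using z by (simp add: vtheta_eq_0_iff[OF \<tau>])
    ultimately have "E_coef m n (Mmat \<tau> \<nu> v u z) = s * ee (- (of_nat n * z / of_nat ?N)) * phi \<tau> (- \<omega>) z"
      using \<omega> by (simp add: \<kappa>M[OF z] r_def phi_def power2_eq_square field_simps)
    then show ?thesis
      unfolding L_rot_coef[OF Smat_trace[OF u] mn] if_not_P[OF False] by (simp add: s_def \<omega>_def)
  qed
qed

text \<open>Each coefficient of \<open>L_rot\<close> is the one of \<open>S\<close> times an
  explicit function of \<open>z\<close> which is nonzero somewhere off the lattice, so one value of
  \<open>z\<close> recovers it.\<close>

lemma L_rot_injective:
  fixes S :: "'n::{finite,linorder} cmat"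
  assumes tr: "trace S = 0" "trace S' = 0" and eq: "\<And>z. z \<notin> lattice \<tau> \<Longrightarrow> L_rot \<tau> S z = L_rot \<tau> S' z"
  shows "S = S'"
proof (rule E_coef_eqI)
  let ?N = "CARD('n)"
  fix m n assume mn: "m < ?N" "n < ?N"
  show "E_coef m n S = E_coef m n S'"
  proof (cases "(m, n) = (0, 0)")
    case True
    then show ?thesis using tr by (simp add: E_coef_0_0)
  next
    case False
    let ?\<omega> = "(of_nat m + of_nat n * \<tau>) / of_nat ?N"
    have \<omega>: "th (- ?\<omega>) \<noteq> 0" by (rule th_omega_nonzero[OF mn False])
    have "\<exists>z. th (- ?\<omega> + z) \<noteq> 0 \<and> th z \<noteq> 0"
    proof (rule ccontr)
      assume "\<not> ?thesis"
      then have "th (- ?\<omega> + z) * th z = 0" for z by auto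
      then have "th (- ?\<omega> + 0) = 0"
        by (rule holomorphic_prod_eq_zero[OF entire_compose[OF vtheta_entire[OF \<tau>]] vtheta_entire[OF \<tau>] _ vtheta_half_nonzero[OF \<tau>], of "\<lambda>z. - ?\<omega> + z", rotated])
          (intro holomorphic_intros)
      then show False using \<omega> by simp
    qed
    then obtain z where z: "th (- ?\<omega> + z) \<noteq> 0" "th z \<noteq> 0" by blast
    then have "phi \<tau> (- ?\<omega>) z \<noteq> 0" using \<omega> vtheta_deriv_0[OF \<tau>] by (simp add: phi_def)
    moreover have "E_coef m n (L_rot \<tau> S z) = E_coef m n (L_rot \<tau> S' z)"
      using eq z(2) by (simp add: vtheta_eq_0_iff[OF \<tau>])
    ultimately show ?thesis
      unfolding L_rot_coef[OF tr(1) mn] L_rot_coef[OF tr(2) mn] if_not_P[OF False] by simp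
  qed
qed

lemma residue_L_CM:
  fixes u :: "'n::finite cvec"
  assumes u: "admissible \<tau> u"
  shows "residue_mat (L_CM \<tau> \<nu> (v, u)) 0 = S0 \<nu>"
proof -
  have "residue (\<lambda>z. L_CM \<tau> \<nu> (v, u) z $ j $ k) 0 = S0 \<nu> $ j $ k" for j k
  proof (cases "j = k")
    case True
    then show ?thesis by (simp add: L_CM_def S0_def residue_const)
  next
    case False
    let ?x = "u $ j - u $ k"
    have x: "th ?x \<noteq> 0" by (rule vtheta_diff_nonzero[OF \<tau> u False])
    let ?f = "\<lambda>z. \<nu> * th (?x + z) * deriv th 0 / th ?x"
    have fh: "?f holomorphic_on UNIV"
      by (intro holomorphic_intros entire_compose[OF vtheta_entire[OF \<tau>]]) (use x in auto)
    have "residue (\<lambda>z. ?f z / th z) 0 = \<nu>"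
    proof -
      \<comment> \<open>Extends th w / w over 0, so that the pole appears as an explicit factor 1 /
        (w - 0).\<close>
      define q where "q = (\<lambda>w. if w = 0 then deriv th 0 else (th w - th 0) / (w - 0))"
      have qh: "q holomorphic_on UNIV" unfolding q_def by (intro pole_lemma_open vtheta_entire[OF \<tau>] open_UNIV)
      define U where "U = q -` (- {0})"
      have U: "open U" unfolding U_def by (intro open_vimage holomorphic_on_imp_continuous_on[OF qh]) auto
      have U0: "0 \<in> U" using vtheta_deriv_0[OF \<tau>] by (simp add: U_def q_def)
      have "(\<lambda>z. ?f z / q z) holomorphic_on U"
        by (intro holomorphic_on_divide holomorphic_on_subset[OF fh] holomorphic_on_subset[OF qh]) (auto simp: U_def)
      from residue_simple[OF U U0 this] have "residue (\<lambda>w. ?f w / q w / (w - 0)) 0 = ?f 0 / q 0" .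
      \<comment> \<open>The functions agree even at w = 0, where both divisions by zero give
        0.\<close>
      moreover have "(\<lambda>w. ?f w / q w / (w - 0)) = (\<lambda>w. ?f w / th w)"
        by (simp add: q_def fun_eq_iff)
      ultimately have "residue (\<lambda>w. ?f w / th w) 0 = ?f 0 / q 0" by (simp only:)
      then show ?thesis using x vtheta_deriv_0[OF \<tau>] by (simp add: q_def)
    qed
    moreover have "(\<lambda>z. L_CM \<tau> \<nu> (v, u) z $ j $ k) = (\<lambda>z. ?f z / th z)"
      using False by (simp add: L_CM_def phi_def fun_eq_iff)
    ultimately show ?thesis using False by (simp add: S0_def)
  qed
  then show ?thesis by (simp add: residue_mat_def vec_eq_iff)
qed

section \<open>The symplectic form\<close>

lemma th_chain: "(f has_field_derivative f') (at x) \<Longrightarrow> ((\<lambda>x. th (f x)) has_field_derivative deriv th (f x) * f') (at x)"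
  by (rule DERIV_chain2[OF th_deriv])

lemma dth_deriv: "(deriv th has_field_derivative deriv (deriv th) x) (at x)"
  by (rule holomorphic_derivI[OF holomorphic_deriv[OF vtheta_entire[OF \<tau>]]]) auto

lemma dth_chain: "(f has_field_derivative f') (at x) \<Longrightarrow> ((\<lambda>x. deriv th (f x)) has_field_derivative deriv (deriv th) (f x) * f') (at x)"
  by (rule DERIV_chain2[OF dth_deriv])

lemma dth_minus: "deriv th (- x) = deriv th x"
proof -
  have 1: "((\<lambda>x. th (- x)) has_field_derivative deriv th (- x) * (- 1)) (at x)"
    by (rule th_chain) (auto intro!: derivative_eq_intros)
  have 2: "((\<lambda>x. - th x) has_field_derivative - deriv th x) (at x)"
    by (intro DERIV_minus th_deriv)
  show ?thesis using DERIV_unique[OF 1[unfolded vtheta_minus] 2] by simp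
qed

lemma ddth_0: "deriv (deriv th) 0 = 0"
proof -
  have 1: "((\<lambda>x. deriv th (- x)) has_field_derivative deriv (deriv th) (- 0) * (- 1)) (at 0)"
    by (rule dth_chain) (auto intro!: derivative_eq_intros)
  show ?thesis using DERIV_unique[OF dth_deriv[of 0] 1[unfolded dth_minus]] by simp
qed

lemma E1_minus: "E1 \<tau> (- x) = - E1 \<tau> x"
  by (simp add: E1_def dth_minus vtheta_minus)

lemma E1_deriv: "th x \<noteq> 0 \<Longrightarrow> (E1 \<tau> has_field_derivative deriv (E1 \<tau>) x) (at x)"
proof -
  assume "th x \<noteq> 0"
  then have "(E1 \<tau> has_field_derivative (deriv (deriv th) x * th x - deriv th x * deriv th x) / (th x * th x)) (at x)"
    unfolding E1_def[abs_def] by (intro DERIV_divide dth_deriv th_deriv)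
  from this DERIV_imp_deriv[OF this] show ?thesis by simp
qed

lemma dE1_minus: "th x \<noteq> 0 \<Longrightarrow> deriv (E1 \<tau>) (- x) = deriv (E1 \<tau>) x"
proof -
  assume x: "th x \<noteq> 0"
  have 1: "((\<lambda>x. E1 \<tau> (- x)) has_field_derivative deriv (E1 \<tau>) (- x) * (- 1)) (at x)"
    by (rule DERIV_chain2[OF E1_deriv]) (use x in \<open>auto intro!: derivative_eq_intros simp: vtheta_minus\<close>)
  have 2: "((\<lambda>x. - E1 \<tau> x) has_field_derivative - deriv (E1 \<tau>) x) (at x)"
    by (intro DERIV_minus E1_deriv x)
  show ?thesis using DERIV_unique[OF 1[unfolded E1_minus] 2] by simp
qed

section \<open>Variation of the theta product and of the covector w\<close>

lemma thprod_line_deriv: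
  "((\<lambda>t. thprod \<tau> (\<lambda>k. (u + t *s \<delta>) $ k) y) has_field_derivative gd \<tau> u \<delta> y) (at 0)"
proof -
  have "((\<lambda>t. \<Prod>k\<in>UNIV. th (y - (u + t *s \<delta>) $ k)) has_field_derivative
     (\<Sum>l\<in>UNIV. (deriv th (y - (u + 0 *s \<delta>) $ l) * (- \<delta> $ l)) * (\<Prod>k\<in>UNIV - {l}. th (y - (u + 0 *s \<delta>) $ k)))) (at 0)"
    by (rule DERIV_finite_prod, rule th_chain) (auto intro!: derivative_eq_intros)
  then show ?thesis by (simp add: thprod_def gd_def sum_negf mult_ac)
qed

lemma gd_line_deriv:
  "((\<lambda>t. gd \<tau> (u + t *s \<delta>) \<epsilon> y) has_field_derivative gdd \<tau> u \<delta> \<epsilon> y) (at 0)"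
proof -
  have x: "((\<lambda>t. y - (u + t *s \<delta>) $ k) has_field_derivative - \<delta> $ k) (at 0)" for k
    by (auto intro!: derivative_eq_intros)
  have "((\<lambda>t. - (\<Sum>l\<in>UNIV. \<epsilon> $ l * deriv th (y - (u + t *s \<delta>) $ l) * (\<Prod>k\<in>UNIV - {l}. th (y - (u + t *s \<delta>) $ k)))) has_field_derivative
     - (\<Sum>l\<in>UNIV. \<epsilon> $ l * deriv th (y - (u + 0 *s \<delta>) $ l) * (\<Sum>m\<in>UNIV - {l}. (deriv th (y - (u + 0 *s \<delta>) $ m) * - \<delta> $ m) * (\<Prod>k\<in>UNIV - {l} - {m}. th (y - (u + 0 *s \<delta>) $ k)))
        + \<epsilon> $ l * (deriv (deriv th) (y - (u + 0 *s \<delta>) $ l) * - \<delta> $ l) * (\<Prod>k\<in>UNIV - {l}. th (y - (u + 0 *s \<delta>) $ k)))) (at 0)"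
    by (rule DERIV_minus, rule DERIV_finite_sum, rule DERIV_mult', rule DERIV_cmult, rule dth_chain, rule x, rule DERIV_finite_prod, rule th_chain, rule x, simp)
  then show ?thesis
    by (simp add: gd_def gdd_def sum.distrib sum_negf sum_subtractf sum_distrib_left mult_ac)
qed

lemma coef_line_deriv:
  fixes g :: "complex \<Rightarrow> complex \<Rightarrow> complex"
  assumes "\<And>y. ((\<lambda>t. g t y) has_field_derivative g' y) (at x)"
  shows "((\<lambda>t. coef \<tau> (g t) $ i) has_field_derivative coef \<tau> g' $ (i :: 'n::{finite,linorder})) (at x)"
  unfolding coef_def matrix_vector_mult_def vec_lambda_beta
  by (rule DERIV_finite_sum, rule DERIV_cmult, rule assms)

lemma wvec_line_deriv:
  "((\<lambda>t. wvec \<tau> (u + t *s \<delta>) $ i) has_field_derivative coef \<tau> (gd \<tau> u \<delta>) $ i) (at 0)"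
  unfolding wvec_def by (rule coef_line_deriv) (rule thprod_line_deriv)

text \<open>The expansion of \<open>thprod\<close> is differentiated along a line on which the zeros
  keep sum 0, so that every product on the line lies in the same theta space.\<close>

lemma gd_rep:
  fixes u \<delta> :: "'n::{finite,linorder} cvec"
  assumes u: "(\<Sum>k\<in>UNIV. u $ k) = 0" and \<delta>: "(\<Sum>k\<in>UNIV. \<delta> $ k) = 0"
  shows "gd \<tau> u \<delta> y = (\<Sum>i\<in>UNIV. coef \<tau> (gd \<tau> u \<delta>) $ i * psi \<tau> (i :: 'n) y)"
proof -
  have "theta_space \<tau> CARD('n) (thprod \<tau> (\<lambda>k. (u + t *s \<delta>) $ k))" for t
    by (rule thprod_space[OF \<tau>]) (simp add: sum.distrib u \<delta> sum_distrib_left[symmetric])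
  then have "thprod \<tau> (\<lambda>k. (u + t *s \<delta>) $ k) y = (\<Sum>i\<in>UNIV. wvec \<tau> (u + t *s \<delta>) $ i * psi \<tau> (i :: 'n) y)" for t
    unfolding wvec_def by (rule theta_space_rep[OF \<tau>])
  moreover have "((\<lambda>t. \<Sum>i\<in>UNIV. wvec \<tau> (u + t *s \<delta>) $ i * psi \<tau> (i :: 'n) y) has_field_derivative (\<Sum>i\<in>UNIV. coef \<tau> (gd \<tau> u \<delta>) $ i * psi \<tau> (i :: 'n) y)) (at 0)"
    by (rule DERIV_finite_sum) (rule DERIV_cmult_right[OF wvec_line_deriv])
  ultimately show ?thesis using DERIV_unique[OF thprod_line_deriv[of u \<delta> y]] by simp
qed

lemma gd_at_pole: "admissible \<tau> u \<Longrightarrow> cc \<tau> u j * gd \<tau> u \<delta> (u $ j) = \<delta> $ j"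
proof -
  assume u: "admissible \<tau> u"
  have "gd \<tau> u \<delta> (u $ j) = - (\<Sum>l\<in>UNIV. if l = j then \<delta> $ j * deriv th 0 * (\<Prod>k\<in>UNIV - {j}. th (u $ j - u $ k)) else 0)"
    unfolding gd_def
  proof (intro arg_cong[where f = uminus] sum.cong refl)
    fix l
    have "l \<noteq> j \<Longrightarrow> (\<Prod>k\<in>UNIV - {l}. th (u $ j - u $ k)) = 0"
      by (rule prod_zero) (auto intro!: bexI[of _ j])
    then show "\<delta> $ l * deriv th (u $ j - u $ l) * (\<Prod>k\<in>UNIV - {l}. th (u $ j - u $ k)) =
      (if l = j then \<delta> $ j * deriv th 0 * (\<Prod>k\<in>UNIV - {j}. th (u $ j - u $ k)) else 0)" by simp
  qed
  then show ?thesis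
    using vtheta_prod_nonzero[OF \<tau> u, of j] vtheta_deriv_0[OF \<tau>] by (simp add: cc_def)
qed

lemma th_prod_remove:
  assumes u: "admissible \<tau> u" and l: "l \<noteq> j"
  shows "deriv th (u $ j - u $ l) * (\<Prod>k\<in>UNIV - {j} - {l}. th (u $ j - u $ k)) = (\<Prod>k\<in>UNIV - {j}. th (u $ j - u $ k)) * E1 \<tau> (u $ j - u $ l)"
proof -
  have "(\<Prod>k\<in>UNIV - {j}. th (u $ j - u $ k)) = th (u $ j - u $ l) * (\<Prod>k\<in>UNIV - {j} - {l}. th (u $ j - u $ k))"
    using l by (intro prod.remove) auto
  then show ?thesis using vtheta_diff_nonzero[OF \<tau> u, of j l] l by (simp add: E1_def)
qed

text \<open>The term l = j contributes \<delta>_j through the derivative of its cofactor, the others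
  contribute \<delta>_l through the derivative of the factor that vanishes at u_j. The second
  derivative of \<open>vtheta\<close> at 0 is 0 by oddness.\<close>

lemma gd_deriv_at_pole:
  assumes u: "admissible \<tau> u"
  shows "cc \<tau> u j * deriv (gd \<tau> u \<delta>) (u $ j) = (\<Sum>k\<in>UNIV - {j}. (\<delta> $ j + \<delta> $ k) * E1 \<tau> (u $ j - u $ k))"
proof -
  let ?R = "\<lambda>y. \<Prod>k\<in>UNIV - {j}. th (y - u $ k)"
  let ?T = "\<lambda>y. \<Sum>l\<in>UNIV - {j}. \<delta> $ l * deriv th (y - u $ l) * (\<Prod>k\<in>UNIV - {j} - {l}. th (y - u $ k))"
  have g: "gd \<tau> u \<delta> y = - (\<delta> $ j * deriv th (y - u $ j) * ?R y + th (y - u $ j) * ?T y)" for y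
  proof -
    have "(\<Sum>l\<in>UNIV - {j}. \<delta> $ l * deriv th (y - u $ l) * (\<Prod>k\<in>UNIV - {l}. th (y - u $ k))) = th (y - u $ j) * ?T y"
      unfolding sum_distrib_left
    proof (intro sum.cong refl)
      fix l assume "l \<in> UNIV - {j}"
      then have "(\<Prod>k\<in>UNIV - {l}. th (y - u $ k)) = th (y - u $ j) * (\<Prod>k\<in>UNIV - {l} - {j}. th (y - u $ k))"
        by (intro prod.remove) auto
      also have "UNIV - {l} - {j} = UNIV - {j} - {l}" by auto
      finally show "\<delta> $ l * deriv th (y - u $ l) * (\<Prod>k\<in>UNIV - {l}. th (y - u $ k)) =
        th (y - u $ j) * (\<delta> $ l * deriv th (y - u $ l) * (\<Prod>k\<in>UNIV - {j} - {l}. th (y - u $ k)))" by simp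
    qed
    then show ?thesis unfolding gd_def by (subst sum.remove[of _ j]) auto
  qed
  have x: "((\<lambda>y. y - u $ k) has_field_derivative 1) (at y)" for k y
    by (auto intro!: derivative_eq_intros)
  have Th: "?T holomorphic_on UNIV"
    by (intro holomorphic_intros entire_compose[OF vtheta_entire[OF \<tau>]] entire_compose[OF holomorphic_deriv[OF vtheta_entire[OF \<tau>]]]) auto
  have T': "(?T has_field_derivative deriv ?T (u $ j)) (at (u $ j))"
    by (rule holomorphic_derivI[OF Th]) auto
  have R': "(?R has_field_derivative (\<Sum>l\<in>UNIV - {j}. (deriv th (u $ j - u $ l) * 1) * (\<Prod>k\<in>UNIV - {j} - {l}. th (u $ j - u $ k)))) (at (u $ j))"
    by (rule DERIV_finite_prod, rule th_chain, rule x, simp)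
  have "((\<lambda>y. - (\<delta> $ j * deriv th (y - u $ j) * ?R y + th (y - u $ j) * ?T y)) has_field_derivative
     - ((\<delta> $ j * deriv th (u $ j - u $ j) * (\<Sum>l\<in>UNIV - {j}. (deriv th (u $ j - u $ l) * 1) * (\<Prod>k\<in>UNIV - {j} - {l}. th (u $ j - u $ k)))
          + \<delta> $ j * (deriv (deriv th) (u $ j - u $ j) * 1) * ?R (u $ j))
        + (th (u $ j - u $ j) * deriv ?T (u $ j) + deriv th (u $ j - u $ j) * 1 * ?T (u $ j)))) (at (u $ j))"
    by (rule DERIV_minus, rule DERIV_add, rule DERIV_mult'[OF DERIV_cmult[OF dth_chain[OF x]] R'], rule DERIV_mult'[OF th_chain[OF x] T'])
  then have "deriv (gd \<tau> u \<delta>) (u $ j) = - deriv th 0 * (\<delta> $ j * (\<Sum>l\<in>UNIV - {j}. deriv th (u $ j - u $ l) * (\<Prod>k\<in>UNIV - {j} - {l}. th (u $ j - u $ k))) + ?T (u $ j))"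
    unfolding g[symmetric] by (intro DERIV_imp_deriv) (simp add: ddth_0 algebra_simps)
  also have "(\<Sum>l\<in>UNIV - {j}. deriv th (u $ j - u $ l) * (\<Prod>k\<in>UNIV - {j} - {l}. th (u $ j - u $ k))) = ?R (u $ j) * (\<Sum>l\<in>UNIV - {j}. E1 \<tau> (u $ j - u $ l))"
    unfolding sum_distrib_left by (intro sum.cong refl th_prod_remove[OF u]) auto
  also have "?T (u $ j) = ?R (u $ j) * (\<Sum>l\<in>UNIV - {j}. \<delta> $ l * E1 \<tau> (u $ j - u $ l))"
    unfolding sum_distrib_left mult.assoc
    by (intro sum.cong refl) (subst th_prod_remove[OF u], auto)
  also have "- deriv th 0 * (\<delta> $ j * (?R (u $ j) * (\<Sum>l\<in>UNIV - {j}. E1 \<tau> (u $ j - u $ l))) + ?R (u $ j) * (\<Sum>l\<in>UNIV - {j}. \<delta> $ l * E1 \<tau> (u $ j - u $ l)))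
     = - deriv th 0 * ?R (u $ j) * (\<Sum>k\<in>UNIV - {j}. (\<delta> $ j + \<delta> $ k) * E1 \<tau> (u $ j - u $ k))"
    by (simp add: ring_distribs sum.distrib sum_negf sum_distrib_left sum_distrib_right mult_ac)
  finally show ?thesis
    using vtheta_prod_nonzero[OF \<tau> u, of j] vtheta_deriv_0[OF \<tau>] by (simp add: cc_def)
qed

text \<open>The one-form \<open>\<Sum>\<^sub>i a\<^sub>i dw\<^sub>i\<close> pulls back to \<open>\<Sum>\<^sub>l v\<^sub>l du\<^sub>l\<close> plus the closed form
  \<open>\<nu>/2 d (\<Sum>\<^sub>l\<^sub>\<noteq>\<^sub>k log \<vartheta>(u\<^sub>l - u\<^sub>k))\<close>.\<close>

lemma avec_dwvec:
  fixes u \<delta> :: "'n::{finite,linorder} cvec"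
  assumes u: "admissible \<tau> u" and \<delta>: "(\<Sum>k\<in>UNIV. \<delta> $ k) = 0"
  shows "bdot (avec \<tau> \<nu> v u) (coef \<tau> (gd \<tau> u \<delta>)) =
    (\<Sum>l\<in>UNIV. v $ l * \<delta> $ l) + \<nu> * (\<Sum>l\<in>UNIV. \<Sum>k\<in>UNIV - {l}. \<delta> $ l * E1 \<tau> (u $ l - u $ k))"
proof -
  define w where "w = (coef \<tau> (gd \<tau> u \<delta>) :: 'n cvec)"
  let ?S = "\<lambda>j. v $ j + \<nu> * (\<Sum>k\<in>UNIV - {j}. E1 \<tau> (u $ j - u $ k))"
  have rep: "gd \<tau> u \<delta> y = (\<Sum>i\<in>UNIV. w $ i * psi \<tau> i y)" for y
    unfolding w_def using u by (intro gd_rep \<delta>) (simp add: admissible_def)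
  have rep': "deriv (gd \<tau> u \<delta>) y = (\<Sum>i\<in>UNIV. w $ i * deriv (psi \<tau> i) y)" for y
    using DERIV_imp_deriv[OF psi_sum_deriv[of w y]] unfolding rep[symmetric] by simp
  have "bdot (avec \<tau> \<nu> v u) w = (\<Sum>i\<in>UNIV. \<Sum>j\<in>UNIV. ?S j * (cc \<tau> u j * (w $ i * psi \<tau> i (u $ j))) - \<nu> * (cc \<tau> u j * (w $ i * deriv (psi \<tau> i) (u $ j))))"
    unfolding bdot_def avec_def by (simp add: sum_distrib_right sum_distrib_left ring_distribs mult_ac)
  also have "\<dots> = (\<Sum>j\<in>UNIV. ?S j * (cc \<tau> u j * gd \<tau> u \<delta> (u $ j)) - \<nu> * (cc \<tau> u j * deriv (gd \<tau> u \<delta>) (u $ j)))"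
    unfolding rep rep' sum_distrib_left sum_subtractf[symmetric] by (rule sum.swap)
  \<comment> \<open>The \<open>E1\<close> terms of \<open>avec\<close> cancel the \<delta>_j part of
    \<open>gd_deriv_at_pole\<close>. The \<delta>_k part changes sign when the indices are
    exchanged, as \<open>E1\<close> is odd.\<close>
  also have "\<dots> = (\<Sum>j\<in>UNIV. v $ j * \<delta> $ j - \<nu> * (\<Sum>k\<in>UNIV - {j}. \<delta> $ k * E1 \<tau> (u $ j - u $ k)))"
    unfolding gd_at_pole[OF u] gd_deriv_at_pole[OF u]
    by (intro sum.cong refl) (simp add: ring_distribs sum.distrib sum_distrib_left mult_ac)
  also have "\<dots> = (\<Sum>l\<in>UNIV. v $ l * \<delta> $ l) - \<nu> * (\<Sum>l\<in>UNIV. \<Sum>k\<in>UNIV - {l}. \<delta> $ k * E1 \<tau> (u $ l - u $ k))"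
    by (simp add: sum_subtractf sum_distrib_left)
  also have "(\<Sum>l\<in>UNIV. \<Sum>k\<in>UNIV - {l}. \<delta> $ k * E1 \<tau> (u $ l - u $ k)) = (\<Sum>l\<in>UNIV. \<Sum>k\<in>UNIV - {l}. \<delta> $ l * E1 \<tau> (u $ k - u $ l))"
    by (rule sum_offdiag_swap)
  also have "\<dots> = - (\<Sum>l\<in>UNIV. \<Sum>k\<in>UNIV - {l}. \<delta> $ l * E1 \<tau> (u $ l - u $ k))"
  proof -
    have e: "\<delta> $ l * E1 \<tau> (u $ k - u $ l) = - (\<delta> $ l * E1 \<tau> (u $ l - u $ k))" for k l
      using E1_minus[of "u $ l - u $ k"] by simp
    show ?thesis unfolding sum_negf[symmetric] by (intro sum.cong refl e)
  qed
  finally show ?thesis by (simp add: w_def)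
qed

section \<open>The exterior derivative along complex lines\<close>

lemma admissible_line:
  fixes u \<delta> :: "'n::finite cvec"
  assumes u: "admissible \<tau> u" and \<delta>: "(\<Sum>k\<in>UNIV. \<delta> $ k) = 0"
  shows "eventually (\<lambda>t. admissible \<tau> (u + t *s \<delta>)) (nhds 0)"
proof -
  have "eventually (\<lambda>t. th ((u + t *s \<delta>) $ j - (u + t *s \<delta>) $ k) \<noteq> 0) (nhds 0)" if "j \<noteq> k" for j k
  proof -
    let ?f = "\<lambda>t. th ((u + t *s \<delta>) $ j - (u + t *s \<delta>) $ k)"
    have "?f holomorphic_on UNIV"
      by (rule entire_compose[OF vtheta_entire[OF \<tau>]]) (auto intro!: holomorphic_intros)
    then have "open (?f -` (- {0}))"
      by (intro open_vimage holomorphic_on_imp_continuous_on) auto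
    moreover have "0 \<in> ?f -` (- {0})" using vtheta_diff_nonzero[OF \<tau> u that] by simp
    ultimately have "eventually (\<lambda>t. t \<in> ?f -` (- {0})) (nhds 0)" by (rule eventually_nhds_in_open)
    then show ?thesis by simp
  qed
  then have "eventually (\<lambda>t. \<forall>j k. j \<noteq> k \<longrightarrow> th ((u + t *s \<delta>) $ j - (u + t *s \<delta>) $ k) \<noteq> 0) (nhds 0)"
    by (intro eventually_all_finite) (auto simp: eventually_mono)
  then show ?thesis
  proof eventually_elim
    case (elim t)
    have "(\<Sum>j\<in>UNIV. (u + t *s \<delta>) $ j) = 0"
      using u \<delta> by (simp add: admissible_def sum.distrib sum_distrib_left[symmetric])
    with elim show ?case by (simp add: admissible_def vtheta_eq_0_iff[OF \<tau>])
  qed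
qed

text \<open>The derivative of the constraint w^T a = N \<nu>, available on the line near 0 because
  admissibility is an open condition.\<close>

lemma tangent_relation:
  fixes u du v dv da dw :: "'n::{finite,linorder} cvec"
  assumes u: "admissible \<tau> u" and du: "(\<Sum>k\<in>UNIV. du $ k) = 0"
    and da: "\<And>i. ((\<lambda>t. avec \<tau> \<nu> (v + t *s dv) (u + t *s du) $ i) has_field_derivative da $ i) (at 0)"
    and dw: "\<And>i. ((\<lambda>t. wvec \<tau> (u + t *s du) $ i) has_field_derivative dw $ i) (at 0)"
  shows "bdot dw (avec \<tau> \<nu> v u) + bdot (wvec \<tau> u) da = 0"
proof -
  have "eventually (\<lambda>t. bdot (wvec \<tau> (u + t *s du)) (avec \<tau> \<nu> (v + t *s dv) (u + t *s du)) = of_nat CARD('n) * \<nu>) (nhds 0)"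
    using admissible_line[OF u du] by eventually_elim (rule bdot_wvec_avec)
  from DERIV_transform_ev[OF this DERIV_bdot[OF dw da] DERIV_const] show ?thesis
    by (simp add: add.commute)
qed

text \<open>For constant directions the exterior derivative of a one-form is the antisymmetrized
  directional derivative. When \<open>avec_dwvec\<close> is differentiated in both orders, the
  second variations of w and the terms with the derivative of \<open>E1\<close> are symmetric and
  drop out.\<close>

lemma symplectic_relation:
  fixes u v du dv da dw du' dv' da' dw' :: "'n::{finite,linorder} cvec"
  assumes u: "admissible \<tau> u" and du: "(\<Sum>k\<in>UNIV. du $ k) = 0" and du': "(\<Sum>k\<in>UNIV. du' $ k) = 0"
    and da: "\<And>i. ((\<lambda>t. avec \<tau> \<nu> (v + t *s dv) (u + t *s du) $ i) has_field_derivative da $ i) (at 0)"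
    and dw: "\<And>i. ((\<lambda>t. wvec \<tau> (u + t *s du) $ i) has_field_derivative dw $ i) (at 0)"
    and da': "\<And>i. ((\<lambda>t. avec \<tau> \<nu> (v + t *s dv') (u + t *s du') $ i) has_field_derivative da' $ i) (at 0)"
    and dw': "\<And>i. ((\<lambda>t. wvec \<tau> (u + t *s du') $ i) has_field_derivative dw' $ i) (at 0)"
  shows "bdot da dw' - bdot da' dw = omega_CM (dv, du) (dv', du')"
proof -
  let ?a = "avec \<tau> \<nu> v u"
  let ?e = "\<lambda>l k. deriv (E1 \<tau>) (u $ l - u $ k)"
  have main: "bdot ?a (coef \<tau> (gdd \<tau> u du du')) + bdot da (coef \<tau> (gd \<tau> u du')) =
     (\<Sum>l\<in>UNIV. dv $ l * du' $ l) + \<nu> * (\<Sum>l\<in>UNIV. \<Sum>k\<in>UNIV - {l}. du' $ l * (?e l k * (du $ l - du $ k)))"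
    if du: "(\<Sum>k\<in>UNIV. du $ k) = 0" and du': "(\<Sum>k\<in>UNIV. du' $ k) = 0"
    and da: "\<And>i. ((\<lambda>t. avec \<tau> \<nu> (v + t *s dv) (u + t *s du) $ i) has_field_derivative da $ i) (at 0)"
    for du dv du' da :: "'n cvec"
  proof -
    have "eventually (\<lambda>t. bdot (avec \<tau> \<nu> (v + t *s dv) (u + t *s du)) (coef \<tau> (gd \<tau> (u + t *s du) du')) =
       (\<Sum>l\<in>UNIV. (v + t *s dv) $ l * du' $ l) + \<nu> * (\<Sum>l\<in>UNIV. \<Sum>k\<in>UNIV - {l}. du' $ l * E1 \<tau> ((u + t *s du) $ l - (u + t *s du) $ k))) (nhds 0)"
      using admissible_line[OF u du] by eventually_elim (rule avec_dwvec[OF _ du'])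
    moreover have "((\<lambda>t. bdot (avec \<tau> \<nu> (v + t *s dv) (u + t *s du)) (coef \<tau> (gd \<tau> (u + t *s du) du'))) has_field_derivative
       bdot (avec \<tau> \<nu> (v + 0 *s dv) (u + 0 *s du)) (coef \<tau> (gdd \<tau> u du du')) + bdot da (coef \<tau> (gd \<tau> (u + 0 *s du) du'))) (at 0)"
      by (intro DERIV_bdot da coef_line_deriv gd_line_deriv)
    moreover have "((\<lambda>t. (\<Sum>l\<in>UNIV. (v + t *s dv) $ l * du' $ l) + \<nu> * (\<Sum>l\<in>UNIV. \<Sum>k\<in>UNIV - {l}. du' $ l * E1 \<tau> ((u + t *s du) $ l - (u + t *s du) $ k))) has_field_derivative
       (\<Sum>l\<in>UNIV. dv $ l * du' $ l) + \<nu> * (\<Sum>l\<in>UNIV. \<Sum>k\<in>UNIV - {l}. du' $ l * (?e l k * (du $ l - du $ k)))) (at 0)"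
    proof (rule DERIV_add)
      show "((\<lambda>t. (\<Sum>l\<in>UNIV. (v + t *s dv) $ l * du' $ l)) has_field_derivative (\<Sum>l\<in>UNIV. dv $ l * du' $ l)) (at 0)"
        by (rule DERIV_finite_sum) (auto intro!: derivative_eq_intros)
      have "((\<lambda>t. E1 \<tau> ((u + t *s du) $ l - (u + t *s du) $ k)) has_field_derivative ?e l k * (du $ l - du $ k)) (at 0)" if "k \<noteq> l" for l k
      proof (rule DERIV_chain2[of "E1 \<tau>"])
        show "(E1 \<tau> has_field_derivative ?e l k) (at ((u + 0 *s du) $ l - (u + 0 *s du) $ k))"
          using E1_deriv[of "u $ l - u $ k"] vtheta_diff_nonzero[OF \<tau> u, of l k] that by simp
      qed (auto intro!: derivative_eq_intros)
      then show "((\<lambda>t. \<nu> * (\<Sum>l\<in>UNIV. \<Sum>k\<in>UNIV - {l}. du' $ l * E1 \<tau> ((u + t *s du) $ l - (u + t *s du) $ k))) has_field_derivative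
         \<nu> * (\<Sum>l\<in>UNIV. \<Sum>k\<in>UNIV - {l}. du' $ l * (?e l k * (du $ l - du $ k)))) (at 0)"
        by (intro DERIV_cmult DERIV_finite_sum) auto
    qed
    ultimately show ?thesis using DERIV_transform_ev by fastforce
  qed
  have dweq: "dw = coef \<tau> (gd \<tau> u du)" "dw' = coef \<tau> (gd \<tau> u du')"
    using DERIV_unique[OF wvec_line_deriv dw] DERIV_unique[OF wvec_line_deriv dw'] by (auto simp: vec_eq_iff)
  have sym: "gdd \<tau> u du' du = gdd \<tau> u du du'" by (rule ext, rule gdd_sym)
  \<comment> \<open>The Hessian of the logarithmic sum is symmetric: the derivative of the odd
    function \<open>E1\<close> is even.\<close>
  have Q: "(\<Sum>l\<in>UNIV. \<Sum>k\<in>UNIV - {l}. du' $ l * (?e l k * (du $ l - du $ k))) = (\<Sum>l\<in>UNIV. \<Sum>k\<in>UNIV - {l}. du $ l * (?e l k * (du' $ l - du' $ k)))"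
  proof -
    have e: "?e l k = ?e k l" if "l \<noteq> k" for l k
      using dE1_minus[of "u $ l - u $ k"] vtheta_diff_nonzero[OF \<tau> u that] by simp
    have "(\<Sum>l\<in>UNIV. \<Sum>k\<in>UNIV - {l}. ?e l k * du' $ l * du $ k) = (\<Sum>l\<in>UNIV. \<Sum>k\<in>UNIV - {l}. ?e k l * du' $ k * du $ l)"
      by (rule sum_offdiag_swap)
    also have "\<dots> = (\<Sum>l\<in>UNIV. \<Sum>k\<in>UNIV - {l}. ?e l k * du' $ k * du $ l)"
      by (intro sum.cong refl) (metis e DiffD2 insertI1)
    finally show ?thesis
      by (simp add: right_diff_distrib left_diff_distrib sum_subtractf mult_ac)
  qed
  define P where "P = bdot ?a (coef \<tau> (gdd \<tau> u du du'))"
  define R where "R = \<nu> * (\<Sum>l\<in>UNIV. \<Sum>k\<in>UNIV - {l}. du $ l * (?e l k * (du' $ l - du' $ k)))"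
  have "P + bdot da dw' = (\<Sum>l\<in>UNIV. dv $ l * du' $ l) + R"
    using main[OF du du' da] unfolding Q dweq P_def R_def .
  moreover have "P + bdot da' dw = (\<Sum>l\<in>UNIV. dv' $ l * du $ l) + R"
    using main[OF du' du da'] unfolding sym dweq P_def R_def .
  ultimately have "bdot da dw' - bdot da' dw = (\<Sum>l\<in>UNIV. dv $ l * du' $ l) - (\<Sum>l\<in>UNIV. dv' $ l * du $ l)"
    by (metis add_diff_cancel_left add_diff_cancel_right)
  then show ?thesis by (simp add: omega_CM_def sum_subtractf)
qed

section \<open>Holomorphic dependence on the phase point\<close>

lemma cdiff_Smat_parts:
  fixes p :: "'n::{finite,linorder} cvec \<times> 'n cvec"
  assumes u: "admissible \<tau> (snd p)"
  shows "cdiff (\<lambda>p. avec \<tau> \<nu> (fst p) (snd p) $ i) p" "cdiff (\<lambda>p. wvec \<tau> (snd p) $ i) p"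
proof -
  have uu: "cdiff (\<lambda>p. snd p $ j - snd p $ k) p" for j k :: 'n
    by (intro cdiff_diff cdiff_snd)
  have cc: "cdiff (\<lambda>p. cc \<tau> (snd p) j) p" for j
    unfolding cc_def divide_inverse
    by (intro cdiff_mult cdiff_const cdiff_inverse cdiff_prod cdiff_comp[OF th_deriv uu])
      (use vtheta_prod_nonzero[OF \<tau> u] vtheta_deriv_0[OF \<tau>] in auto)
  have E1: "cdiff (\<lambda>p. E1 \<tau> (snd p $ j - snd p $ k)) p" if "j \<noteq> k" for j k
    by (rule cdiff_comp[OF E1_deriv uu]) (use vtheta_diff_nonzero[OF \<tau> u that] in simp)
  have dpsi: "(deriv (psi \<tau> i) has_field_derivative deriv (deriv (psi \<tau> i)) x) (at x)" for x
    by (rule holomorphic_derivI[OF holomorphic_deriv[OF psi_entire[OF \<tau>]]]) auto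
  have psi: "cdiff (\<lambda>p. psi \<tau> i (snd p $ j)) p" "cdiff (\<lambda>p. deriv (psi \<tau> i) (snd p $ j)) p" for j
    by (rule cdiff_comp[OF psi_deriv cdiff_snd], rule cdiff_comp[OF dpsi cdiff_snd])
  show "cdiff (\<lambda>p. avec \<tau> \<nu> (fst p) (snd p) $ i) p"
    unfolding avec_def vec_lambda_beta
    by (intro cdiff_sum cdiff_mult[OF cc] cdiff_diff cdiff_mult[OF psi(1)] cdiff_mult[OF cdiff_const] cdiff_add cdiff_fst psi(2) E1) auto
  show "cdiff (\<lambda>p. wvec \<tau> (snd p) $ i) p"
    unfolding wvec_def coef_def matrix_vector_mult_def vec_lambda_beta thprod_def
    by (intro cdiff_sum cdiff_mult cdiff_const cdiff_prod cdiff_comp[OF th_deriv cdiff_diff[OF cdiff_const cdiff_snd]])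
qed

lemma R_CM_iff: "(v, u) \<in> R_CM \<tau> \<longleftrightarrow> (\<Sum>j\<in>UNIV. v $ j) = 0 \<and> admissible \<tau> u"
  by (simp add: R_CM_def admissible_def)

lemma Smat_symplectic:
  assumes \<nu>: "\<nu> \<noteq> 0" and N: "CARD('n) \<ge> 2"
  shows "symplectic_CM_rot \<tau> (S0 \<nu>) (\<lambda>p :: 'n::{finite,linorder} cvec \<times> 'n cvec. Smat \<tau> \<nu> (fst p) (snd p))"
  unfolding symplectic_CM_rot_def
proof (intro ballI conjI)
  fix p :: "'n cvec \<times> 'n cvec" assume p: "p \<in> R_CM \<tau>"
  obtain v u where vu: "p = (v, u)" by (cases p)
  have u: "admissible \<tau> u" using p by (simp add: vu R_CM_iff)
  let ?S = "\<lambda>p :: 'n cvec \<times> 'n cvec. Smat \<tau> \<nu> (fst p) (snd p)"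
  let ?a = "avec \<tau> \<nu> v u" and ?w = "wvec \<tau> u"
  show "?S p \<in> R_rot (S0 \<nu>)" using Smat_orbit[OF u \<nu>] by (simp add: vu)
  have "\<forall>i. \<exists>D. ((\<lambda>p. avec \<tau> \<nu> (fst p) (snd p) $ i) has_derivative D) (at p) \<and> (\<forall>c \<xi>. D (c *s fst \<xi>, c *s snd \<xi>) = c * D \<xi>)"
    using cdiff_Smat_parts(1)[of p \<nu>] u unfolding vu cdiff_def by simp
  from choice[OF this] obtain A where "\<forall>i. ((\<lambda>p. avec \<tau> \<nu> (fst p) (snd p) $ i) has_derivative A i) (at p) \<and> (\<forall>c \<xi>. A i (c *s fst \<xi>, c *s snd \<xi>) = c * A i \<xi>)"
    by (rule exE)
  then have A: "\<And>i. ((\<lambda>p. avec \<tau> \<nu> (fst p) (snd p) $ i) has_derivative A i) (at p)"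
    "\<And>i c \<xi>. A i (c *s fst \<xi>, c *s snd \<xi>) = c * A i \<xi>" by blast+
  have "\<forall>i. \<exists>D. ((\<lambda>p. wvec \<tau> (snd p) $ i) has_derivative D) (at p) \<and> (\<forall>c \<xi>. D (c *s fst \<xi>, c *s snd \<xi>) = c * D \<xi>)"
    using cdiff_Smat_parts(2)[of p] u unfolding vu cdiff_def by simp
  from choice[OF this] obtain W where "\<forall>i. ((\<lambda>p. wvec \<tau> (snd p) $ i) has_derivative W i) (at p) \<and> (\<forall>c \<xi>. W i (c *s fst \<xi>, c *s snd \<xi>) = c * W i \<xi>)"
    by (rule exE)
  then have W: "\<And>i. ((\<lambda>p. wvec \<tau> (snd p) $ i) has_derivative W i) (at p)"
    "\<And>i c \<xi>. W i (c *s fst \<xi>, c *s snd \<xi>) = c * W i \<xi>" by blast+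
  define da where "da = (\<lambda>\<xi>. \<chi> i. A i \<xi>)"
  define dw where "dw = (\<lambda>\<xi>. \<chi> i. W i \<xi>)"
  define D where "D = (\<lambda>\<xi>. outer (da \<xi>) ?w + outer ?a (dw \<xi>))"
  have da_line: "((\<lambda>t. avec \<tau> \<nu> (v + t *s dv) (u + t *s du) $ i) has_field_derivative da (dv, du) $ i) (at 0)" for dv du i
    using cdiff_line[OF A(1)[unfolded vu] A(2)] by (simp add: da_def)
  have dw_line: "((\<lambda>t. wvec \<tau> (u + t *s du) $ i) has_field_derivative dw (dv, du) $ i) (at 0)" for dv du i
    using cdiff_line[OF W(1)[unfolded vu] W(2), of dv du] by (simp add: dw_def)
  show "\<exists>D. (?S has_derivative D) (at p within R_CM \<tau>) \<and>
            (\<forall>c. \<forall>\<xi>\<in>T_CM. D (c *s fst \<xi>, c *s snd \<xi>) = mscale c (D \<xi>)) \<and>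
            (\<forall>\<xi>\<in>T_CM. D \<xi> \<in> T_rot (S0 \<nu>) (?S p)) \<and>
            (\<forall>\<xi>\<in>T_CM. \<forall>\<eta>\<in>T_CM. omega_rot (S0 \<nu>) (?S p) (D \<xi>) (D \<eta>) = omega_CM \<xi> \<eta>)"
  proof (intro exI[of _ D] conjI ballI allI)
    have "((\<lambda>p. avec \<tau> \<nu> (fst p) (snd p) $ i * wvec \<tau> (snd p) $ j - (mat \<nu> :: 'n cmat) $ i $ j) has_derivative
        (\<lambda>h. avec \<tau> \<nu> (fst p) (snd p) $ i * W j h + A i h * wvec \<tau> (snd p) $ j - 0)) (at p)" for i j
      by (intro has_derivative_diff has_derivative_mult A(1) W(1) has_derivative_const)
    then have "((\<lambda>p. ?S p $ i $ j) has_derivative (\<lambda>h. D h $ i $ j)) (at p)" for i j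
      by (simp add: Smat_def outer_def D_def da_def dw_def vu add.commute)
    then have "(?S has_derivative D) (at p)"
      by (intro has_derivative_vec_componentwise)
    then show "(?S has_derivative D) (at p within R_CM \<tau>)" by (rule has_derivative_at_withinI)
    show "D (c *s fst \<xi>, c *s snd \<xi>) = mscale c (D \<xi>)" for c \<xi>
      by (simp add: D_def outer_def mscale_def vec_eq_iff da_def dw_def A(2) W(2) algebra_simps)
    \<comment> \<open>\<open>D\<close> was obtained in the full space of pairs. A direction in
      \<open>T_CM\<close> keeps the sum of the positions 0, which makes the constraint hold along
      the line.\<close>
    have tan: "bdot (dw \<xi>) ?a + bdot ?w (da \<xi>) = 0" if "\<xi> \<in> T_CM" for \<xi>
    proof -
      obtain dv du where \<xi>: "\<xi> = (dv, du)" by (cases \<xi>)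
      with that have "(\<Sum>j\<in>UNIV. du $ j) = 0" by (simp add: T_CM_def)
      from tangent_relation[OF u this da_line dw_line] show ?thesis by (simp add: \<xi>)
    qed
    note om = rank_one_omega[OF \<nu> N bdot_wvec_avec[OF u]]
    show "D \<xi> \<in> T_rot (S0 \<nu>) (?S p)" if "\<xi> \<in> T_CM" for \<xi>
      using om(1)[OF tan[OF that] tan[OF that]] by (simp add: D_def Smat_def vu)
    show "omega_rot (S0 \<nu>) (?S p) (D \<xi>) (D \<eta>) = omega_CM \<xi> \<eta>" if "\<xi> \<in> T_CM" "\<eta> \<in> T_CM" for \<xi> \<eta>
    proof -
      obtain dv du dv' du' where \<xi>: "\<xi> = (dv, du)" and \<eta>: "\<eta> = (dv', du')" by (cases \<xi>, cases \<eta>)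
      have "omega_rot (S0 \<nu>) (?S p) (D \<xi>) (D \<eta>) = bdot (da \<xi>) (dw \<eta>) - bdot (da \<eta>) (dw \<xi>)"
        using om(2)[OF tan[OF that(1)] tan[OF that(2)]] by (simp add: D_def Smat_def vu)
      also have "\<dots> = omega_CM \<xi> \<eta>"
        unfolding \<xi> \<eta> using that
        by (intro symplectic_relation[OF u _ _ da_line dw_line da_line dw_line]) (auto simp: \<xi> \<eta> T_CM_def)
      finally show ?thesis .
    qed
  qed
qed

end

text \<open>The equivalence pins \<open>F\<close> down at every phase point: the orbit contains
  exactly one matrix satisfying the gauge identity, since a traceless matrix can be recovered from
  its \<open>L_rot\<close>.\<close>

theorem mainTheorem4:
  fixes \<tau> \<nu> :: complex
  assumes "Im \<tau> > 0"
    and "CARD('n::{finite,linorder}) \<ge> 2"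
    and "\<nu> \<noteq> 0"
  shows "(\<forall>p \<in> (R_CM \<tau> :: ('n cvec \<times> 'n cvec) set).
            residue_mat (L_CM \<tau> \<nu> p) 0 = S0 \<nu> \<and>
            \<not> invertible (Xi \<tau> (snd p) 0) \<and>
            (\<forall>z. z \<notin> lattice \<tau> \<longrightarrow> invertible (Xi \<tau> (snd p) z))) \<and>
         (\<exists>F :: 'n cvec \<times> 'n cvec \<Rightarrow> 'n cmat.
            (\<forall>p \<in> R_CM \<tau>. F p \<in> R_rot (S0 \<nu>) \<and>
               (\<forall>S \<in> R_rot (S0 \<nu>).
                  (\<forall>z. z \<notin> lattice \<tau> \<longrightarrow>
                     Xi \<tau> (snd p) z ** L_CM \<tau> \<nu> p z ** matrix_inv (Xi \<tau> (snd p) z) = L_rot \<tau> S z)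
                  \<longleftrightarrow> S = F p)) \<and>
            symplectic_CM_rot \<tau> (S0 \<nu>) F)"
proof (intro conjI ballI exI[of _ "\<lambda>p. Smat \<tau> \<nu> (fst p) (snd p)"])
  note \<tau> = assms(1)
  show "symplectic_CM_rot \<tau> (S0 \<nu>) (\<lambda>p :: 'n cvec \<times> 'n cvec. Smat \<tau> \<nu> (fst p) (snd p))"
    by (rule Smat_symplectic[OF \<tau> assms(3,2)])
  fix p :: "'n cvec \<times> 'n cvec" assume p: "p \<in> R_CM \<tau>"
  obtain v u where vu: "p = (v, u)" by (cases p)
  have v: "(\<Sum>j\<in>UNIV. v $ j) = 0" and u: "admissible \<tau> u" using p by (simp_all add: vu R_CM_iff[OF \<tau>])
  show "residue_mat (L_CM \<tau> \<nu> p) 0 = S0 \<nu>" unfolding vu by (rule residue_L_CM[OF \<tau> u])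
  show "\<not> invertible (Xi \<tau> (snd p) 0)" unfolding vu using Xi_singular[OF \<tau> u] by simp
  show "\<forall>z. z \<notin> lattice \<tau> \<longrightarrow> invertible (Xi \<tau> (snd p) z)" unfolding vu using Xi_invertible[OF \<tau> u] by simp
  show "Smat \<tau> \<nu> (fst p) (snd p) \<in> R_rot (S0 \<nu>)" unfolding vu using Smat_orbit[OF \<tau> u assms(3)] by simp
  fix S :: "'n cmat" assume S: "S \<in> R_rot (S0 \<nu>)"
  have conj: "Xi \<tau> u z ** L_CM \<tau> \<nu> (v, u) z ** matrix_inv (Xi \<tau> u z) = L_rot \<tau> (Smat \<tau> \<nu> v u) z" if "z \<notin> lattice \<tau>" for z
    using Xi_conjugate[OF \<tau> u that] Mmat_L_rot[OF \<tau> u v that] by (simp add: Mmat_def)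
  show "(\<forall>z. z \<notin> lattice \<tau> \<longrightarrow> Xi \<tau> (snd p) z ** L_CM \<tau> \<nu> p z ** matrix_inv (Xi \<tau> (snd p) z) = L_rot \<tau> S z)
      \<longleftrightarrow> S = Smat \<tau> \<nu> (fst p) (snd p)"
  proof
    assume *: "\<forall>z. z \<notin> lattice \<tau> \<longrightarrow> Xi \<tau> (snd p) z ** L_CM \<tau> \<nu> p z ** matrix_inv (Xi \<tau> (snd p) z) = L_rot \<tau> S z"
    have "S = Smat \<tau> \<nu> v u"
    proof (rule L_rot_injective[OF \<tau>])
      show "trace S = 0" using R_rot_trace[OF S] trace_S0 by simp
      show "trace (Smat \<tau> \<nu> v u) = 0" by (rule Smat_trace[OF \<tau> u])
      show "L_rot \<tau> S z = L_rot \<tau> (Smat \<tau> \<nu> v u) z" if "z \<notin> lattice \<tau>" for z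
        using * conj[OF that] that by (simp add: vu)
    qed
    then show "S = Smat \<tau> \<nu> (fst p) (snd p)" by (simp add: vu)
  qed (use conj in \<open>simp add: vu\<close>)
qed

end
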